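(* Let $G=(V,E)$ be a connected undirected unweighted graph with $n$ nodes and $m$ edges, in which every node has degree at most $d>2$, and which is $\delta$-hyperbolic for some $\delta>0$. Let $0<\mu<1$ be any constant. Let $p$ and $q$ be any two nodes of $G$ and let $\Delta=\mathrm{dist}_G(p,q)$. Then there exist at least $t=\max\left\{ \frac{\Delta^\mu}{56\log d},\,1 \right\}$ subsets of nodes $\emptyset\subset S_1 \subset S_2 \subset \dots \subset S_t\subset V$, each of at most $n/2$ nodes, with the following properties: (1) for every $j\in\{1,\dots,t\}$, $$h_G(S_j)\leq \min\left\{ \frac{8\ln(n/2)}{\Delta},\ \max\left\{ \left(\frac{1}{\Delta}\right)^{1-\mu},\ \frac{500\ln n}{\Delta\, 2^{\Delta^{\mu}/(28\,\delta\,\log(2d))}}\right\}\right\};$$ (2) all the subsets can be found in a total of $O(n^3\log n + mn^2)$ time; (3) either all of $S_1,\dots,S_t$ contain $p$, or all of them contain $q$.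
   Context: $\log$ denotes logarithm base 2. $\mathrm{dist}_G(u,v)$ is the number of edges on a shortest path between $u$ and $v$ in $G$. $G$ is $\delta$-hyperbolic if for every triple of shortest paths $(\overline{u,v},\overline{u,w},\overline{v,w})$ and every node $x$ on $\overline{u,v}$ there is a node $y$ on $\overline{u,w}\cup\overline{v,w}$ with $\mathrm{dist}_G(x,y)\le\delta$ (this definition is equivalent, up to a constant factor in $\delta$, to the four-point definition; constants are not optimized). For a subset $S$ of nodes, the boundary $\partial_G(S)$ is the set of nodes in $V\setminus S$ adjacent to at least one node of $S$, and the node expansion ratio is $h_G(S)=|\partial_G(S)|/|S|$. Throughout, $n$ is assumed sufficiently large, and floors and ceilings of fractional quantities are ignored. *)

theory Defs
  imports Complex_Main
begin

section \<open>Finite simple undirected graphs\<close>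

definition simple_graph :: "'a set \<Rightarrow> 'a set set \<Rightarrow> bool" where
  "simple_graph V E \<longleftrightarrow> finite V \<and> (\<forall>e\<in>E. \<exists>u\<in>V. \<exists>v\<in>V. u \<noteq> v \<and> e = {u, v})"

definition node_degree :: "'a set \<Rightarrow> 'a set set \<Rightarrow> 'a \<Rightarrow> nat" where
  "node_degree V E v = card {u \<in> V. {u, v} \<in> E}"

text \<open>A walk is the nonempty list of its nodes, so it has one node more than it has edges.\<close>

definition walk :: "'a set \<Rightarrow> 'a set set \<Rightarrow> 'a \<Rightarrow> 'a \<Rightarrow> 'a list \<Rightarrow> bool" where
  "walk V E u v xs \<longleftrightarrow> xs \<noteq> [] \<and> hd xs = u \<and> last xs = v \<and> set xs \<subseteq> V \<and>
     successively (\<lambda>x y. {x, y} \<in> E) xs"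

definition connected_graph :: "'a set \<Rightarrow> 'a set set \<Rightarrow> bool" where
  "connected_graph V E \<longleftrightarrow> V \<noteq> {} \<and> (\<forall>u\<in>V. \<forall>v\<in>V. \<exists>xs. walk V E u v xs)"

definition gdist :: "'a set \<Rightarrow> 'a set set \<Rightarrow> 'a \<Rightarrow> 'a \<Rightarrow> nat" where
  "gdist V E u v = (LEAST k. \<exists>xs. walk V E u v xs \<and> length xs = k + 1)"

definition shortest_path :: "'a set \<Rightarrow> 'a set set \<Rightarrow> 'a \<Rightarrow> 'a \<Rightarrow> 'a list \<Rightarrow> bool" where
  "shortest_path V E u v xs \<longleftrightarrow> walk V E u v xs \<and> length xs = gdist V E u v + 1"

definition hyperbolic :: "'a set \<Rightarrow> 'a set set \<Rightarrow> real \<Rightarrow> bool" where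
  "hyperbolic V E \<delta> \<longleftrightarrow>
     (\<forall>u v w P Q R. shortest_path V E u v P \<and> shortest_path V E u w Q \<and> shortest_path V E v w R \<longrightarrow>
        (\<forall>x\<in>set P. \<exists>y\<in>set Q \<union> set R. real (gdist V E x y) \<le> \<delta>))"

definition node_boundary :: "'a set \<Rightarrow> 'a set set \<Rightarrow> 'a set \<Rightarrow> 'a set" where
  "node_boundary V E S = {v \<in> V - S. \<exists>u\<in>S. {u, v} \<in> E}"

definition node_expansion :: "'a set \<Rightarrow> 'a set set \<Rightarrow> 'a set \<Rightarrow> real" where
  "node_expansion V E S = real (card (node_boundary V E S)) / real (card S)"


section \<open>Word RAM programs and their running time\<close>

text \<open>
  Programs of a word RAM over natural-number variables and named arrays. A program mentions only
  finitely many variables and arrays, and its expressions have constant size, so every assignment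
  and every test is charged one unit of time. Only values below the bound \<open>W\<close> can be stored:
  otherwise the program has no execution. Instantiating \<open>W\<close> with a fixed power of the number of
  nodes gives the usual words of logarithmically many bits.
\<close>

datatype aexp =
    Const nat
  | Var string
  | Read string aexp
  | Add aexp aexp
  | Sub aexp aexp
  | Mul aexp aexp
  | Quot aexp aexp

datatype bexp = Less aexp aexp | Neg bexp | Conj bexp bexp

datatype com =
    Skip
  | Assign string aexp
  | Write string aexp aexp
  | Seq com com
  | Cond bexp com com
  | While bexp com

record state =
  vars :: "string \<Rightarrow> nat"
  arrs :: "string \<Rightarrow> nat \<Rightarrow> nat"

fun aval :: "aexp \<Rightarrow> state \<Rightarrow> nat" where
  "aval (Const k) s = k"
| "aval (Var x) s = vars s x"
| "aval (Read a e) s = arrs s a (aval e s)"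
| "aval (Add e f) s = aval e s + aval f s"
| "aval (Sub e f) s = aval e s - aval f s"
| "aval (Mul e f) s = aval e s * aval f s"
| "aval (Quot e f) s = aval e s div aval f s"

fun bval :: "bexp \<Rightarrow> state \<Rightarrow> bool" where
  "bval (Less e f) s \<longleftrightarrow> aval e s < aval f s"
| "bval (Neg b) s \<longleftrightarrow> \<not> bval b s"
| "bval (Conj b c) s \<longleftrightarrow> bval b s \<and> bval c s"

text \<open>\<open>exec W c s T s'\<close>: started in \<open>s\<close>, the program \<open>c\<close> halts in \<open>s'\<close> after \<open>T\<close> time units.\<close>

inductive exec :: "nat \<Rightarrow> com \<Rightarrow> state \<Rightarrow> nat \<Rightarrow> state \<Rightarrow> bool" for W :: nat where
  Skip: "exec W Skip s 1 s"
| Assign: "aval e s < W \<Longrightarrow>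
    exec W (Assign x e) s 1 (s\<lparr>vars := (vars s)(x := aval e s)\<rparr>)"
| Write: "aval i s < W \<Longrightarrow> aval e s < W \<Longrightarrow>
    exec W (Write a i e) s 1 (s\<lparr>arrs := (arrs s)(a := (arrs s a)(aval i s := aval e s))\<rparr>)"
| Seq: "exec W c1 s T1 s1 \<Longrightarrow> exec W c2 s1 T2 s2 \<Longrightarrow> exec W (Seq c1 c2) s (T1 + T2) s2"
| CondTrue: "bval b s \<Longrightarrow> exec W c1 s T s' \<Longrightarrow> exec W (Cond b c1 c2) s (T + 1) s'"
| CondFalse: "\<not> bval b s \<Longrightarrow> exec W c2 s T s' \<Longrightarrow> exec W (Cond b c1 c2) s (T + 1) s'"
| WhileFalse: "\<not> bval b s \<Longrightarrow> exec W (While b c) s 1 s"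
| WhileTrue: "bval b s \<Longrightarrow> exec W c s T1 s1 \<Longrightarrow> exec W (While b c) s1 T2 s2 \<Longrightarrow>
    exec W (While b c) s (T1 + T2 + 1) s2"

text \<open>
  The input is the graph as a list of its edges, together with the two nodes. The nodes are numbered
  from \<open>0\<close> by an arbitrary bijection \<open>\<nu>\<close>, and the edges are listed once each, in any order and with
  any orientation. The rest of the memory is zero; in particular the program gets neither the
  degree bound nor the hyperbolicity constant.
\<close>

definition input_state ::
  "'a set \<Rightarrow> 'a set set \<Rightarrow> 'a \<Rightarrow> 'a \<Rightarrow> (nat \<Rightarrow> 'a) \<Rightarrow> state \<Rightarrow> bool" where
  "input_state V E p q \<nu> s \<longleftrightarrow>
     bij_betw \<nu> {..<card V} V \<and>
     vars s ''n'' = card V \<and> vars s ''m'' = card E \<and>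
     vars s ''p'' < card V \<and> \<nu> (vars s ''p'') = p \<and>
     vars s ''q'' < card V \<and> \<nu> (vars s ''q'') = q \<and>
     (\<forall>e<card E. arrs s ''src'' e < card V \<and> arrs s ''tgt'' e < card V) \<and>
     bij_betw (\<lambda>e. {\<nu> (arrs s ''src'' e), \<nu> (arrs s ''tgt'' e)}) {..<card E} E \<and>
     (\<forall>x. x \<notin> {''n'', ''m'', ''p'', ''q''} \<longrightarrow> vars s x = 0) \<and>
     (\<forall>a i. a \<notin> {''src'', ''tgt''} \<or> card E \<le> i \<longrightarrow> arrs s a i = 0)"

text \<open>
  The output is the number \<open>t\<close> of sets and, row by row, the characteristic vectors of the sets
  \<open>S 1, \<dots>, S t\<close>.
\<close>

definition output_state ::
  "'a set \<Rightarrow> (nat \<Rightarrow> 'a) \<Rightarrow> state \<Rightarrow> nat \<Rightarrow> (nat \<Rightarrow> 'a set) \<Rightarrow> bool" where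
  "output_state V \<nu> s t S \<longleftrightarrow>
     vars s ''t'' = t \<and>
     (\<forall>j\<in>{1..t}. S j = \<nu> ` {i. i < card V \<and> arrs s ''out'' (j * card V + i) = 1})"

end

theory Submission imports Defs begin

text \<open>
  Let \<open>y = \<Delta> powr \<mu>\<close>. Balls around \<open>p\<close> and \<open>q\<close> of radius less than \<open>\<Delta> / 2\<close> are disjoint, so one of them has
  at most \<open>n / 2\<close> nodes, and a constant fraction of the smaller balls around its centre has expansion at
  most \<open>8 ln (n / 2) / \<Delta>\<close>, since otherwise they would grow too fast. If fewer than \<open>\<Delta> / 64\<close> balls have
  expansion at most \<open>y / \<Delta>\<close>, the balls of radius \<open>\<Delta> / 3\<close> have size exponential in \<open>y\<close>. Now remove a
  cylinder of radius proportional to \<open>y / log (2 d)\<close> around the middle of a geodesic from \<open>p\<close> to \<open>q\<close>. Its size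
  is exponential in \<open>y\<close> with a smaller exponent, hence negligible, and by hyperbolicity a walk from \<open>p\<close> to \<open>q\<close>
  that avoids it is longer than \<open>\<Delta>\<close> by a factor exponential in \<open>y / (\<delta> log (2 d))\<close>. Growing balls in the
  remaining graph therefore produces a ball that satisfies the last bound, and deleting its last nodes in
  breadth-first order produces the other sets of the chain.

  This yields \<open>\<Delta> / 64\<close> sets, more than required, which frees the program from knowing \<open>\<mu>\<close>, \<open>d\<close> and \<open>\<delta>\<close>: it
  tries all cylinder radii and both centres, orders the nodes by breadth-first search, and
  keeps the search whose \<open>\<Delta> / 64\<close> best prefixes have the smallest expansion.
\<close>

section \<open>Geodesics in hyperbolic graphs\<close>

text \<open>Removed nodes return to the boundary once the cylinder is put back, so the cylinder must
  be smaller than a ball of radius \<Delta> / 3 by more than a polynomial factor in \<Delta>. The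
  constants give about exp (0.11 y) against exp (0.15 y), and the gap exp (0.04 y) absorbs the
  polynomial once \<Delta> is large. For bounded \<Delta> the lower bound on \<delta> bounds the
  power of 2, and a large n lifts the claimed expansion to at least 2, which is trivial for sets
  holding a third of the nodes. If the power of 2 has exponent at most 5, the last bound exceeds the
  first one and plain balls suffice. The program evaluates none of these bounds, and its
  tie-breaking among nodes at equal distance is not known to the existence argument. Existence is
  therefore proved for every enumeration sorted by distance. Optimality transfers the bound: the
  worst of the prefixes kept by the program is no worse than the worst prefix supplied by the
  existence proof, even if the two come from different radii or centres.\<close>

locale conn_graph =
  fixes V :: "'a set" and E :: "'a set set"
  assumes simple: "simple_graph V E" and conn: "connected_graph V E"
begin

abbreviation gd :: "'a \<Rightarrow> 'a \<Rightarrow> nat" where "gd \<equiv> gdist V E"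

lemma finite_V [simp]: "finite V"
  using simple by (simp add: simple_graph_def)

lemma edge_nodes: "{u, v} \<in> E \<Longrightarrow> u \<in> V \<and> v \<in> V \<and> u \<noteq> v"
  using simple unfolding simple_graph_def by (metis doubleton_eq_iff)

lemma walk_append:
  assumes "walk V E u v xs" "walk V E v w ys"
  shows "walk V E u w (xs @ tl ys)"
proof (cases ys)
  case Nil then show ?thesis using assms by (simp add: walk_def)
next
  case (Cons y zs)
  then show ?thesis using assms
    by (cases zs) (auto simp: walk_def successively_append_iff)
qed

lemma walk_rev: "walk V E u v xs \<Longrightarrow> walk V E v u (rev xs)"
  by (auto simp: walk_def hd_rev last_rev insert_commute)

lemma gdist_le_walk: "walk V E u v xs \<Longrightarrow> gd u v \<le> length xs - 1"
  unfolding gdist_def by (rule Least_le) (auto simp: walk_def intro!: exI[of _ xs])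

lemma shortest_path_exists:
  assumes "u \<in> V" "v \<in> V" obtains xs where "shortest_path V E u v xs"
proof -
  obtain ys where "walk V E u v ys" using conn assms unfolding connected_graph_def by blast
  then have "\<exists>k xs. walk V E u v xs \<and> length xs = k + 1"
    by (intro exI[of _ "length ys - 1"] exI[of _ ys]) (auto simp: walk_def)
  from LeastI_ex[OF this] show ?thesis using that unfolding shortest_path_def gdist_def by auto
qed

lemma gdist_triangle:
  assumes "u \<in> V" "v \<in> V" "w \<in> V" shows "gd u w \<le> gd u v + gd v w"
proof -
  obtain xs where xs: "shortest_path V E u v xs" using shortest_path_exists assms by blast
  obtain ys where ys: "shortest_path V E v w ys" using shortest_path_exists assms by blast
  have "gd u w \<le> length (xs @ tl ys) - 1"
    using xs ys by (intro gdist_le_walk walk_append) (auto simp: shortest_path_def)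
  then show ?thesis using xs ys by (auto simp: shortest_path_def)
qed

lemma gdist_sym:
  assumes "u \<in> V" "v \<in> V" shows "gd u v = gd v u"
proof -
  have "gd b a \<le> gd a b" if ab: "a \<in> V" "b \<in> V" for a b
  proof -
    obtain xs where xs: "shortest_path V E a b xs" using shortest_path_exists ab by blast
    then show ?thesis using gdist_le_walk[OF walk_rev, of a b xs] by (auto simp: shortest_path_def)
  qed
  then show ?thesis using assms by (simp add: le_antisym)
qed

lemma gdist_self [simp]: "u \<in> V \<Longrightarrow> gd u u = 0"
  using gdist_le_walk[of u u "[u]"] by (simp add: walk_def)

lemma gdist_edge: "{u, v} \<in> E \<Longrightarrow> gd u v \<le> 1"
  using gdist_le_walk[of u v "[u, v]"] edge_nodes[of u v] by (simp add: walk_def)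

lemma gdist_0: "u \<in> V \<Longrightarrow> v \<in> V \<Longrightarrow> gd u v = 0 \<longleftrightarrow> u = v"
proof -
  assume "u \<in> V" "v \<in> V"
  moreover have "u = v" if "gd u v = 0"
  proof -
    obtain xs where "shortest_path V E u v xs" using shortest_path_exists calculation by blast
    then show ?thesis using that by (auto simp: shortest_path_def walk_def length_Suc_conv)
  qed
  ultimately show ?thesis by auto
qed

lemma walk_take:
  assumes "walk V E u v xs" "i < length xs"
  shows "walk V E u (xs ! i) (take (Suc i) xs)"
proof -
  have "xs = take (Suc i) xs @ drop (Suc i) xs" by simp
  with assms have "successively (\<lambda>x y. {x, y} \<in> E) (take (Suc i) xs)"
    unfolding walk_def by (metis successively_append_iff)
  moreover have "last (take (Suc i) xs) = xs ! i" using assms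
    by (simp add: take_Suc_conv_app_nth)
  ultimately show ?thesis using assms set_take_subset[of "Suc i" xs] by (auto simp: walk_def)
qed

lemma walk_drop:
  assumes "walk V E u v xs" "i < length xs"
  shows "walk V E (xs ! i) v (drop i xs)"
proof -
  have "xs = take i xs @ drop i xs" by simp
  with assms have "successively (\<lambda>x y. {x, y} \<in> E) (drop i xs)"
    unfolding walk_def by (metis successively_append_iff)
  then show ?thesis using assms set_drop_subset[of i xs] by (auto simp: walk_def hd_drop_conv_nth)
qed

lemma shortest_path_nodes: "shortest_path V E u v P \<Longrightarrow> set P \<subseteq> V"
  by (simp add: shortest_path_def walk_def)

lemma shortest_path_ends:
  assumes "shortest_path V E u v P" shows "u \<in> V" "v \<in> V"
  using assms unfolding shortest_path_def walk_def by auto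

lemma shortest_path_length: "shortest_path V E u v P \<Longrightarrow> length P = Suc (gd u v)"
  by (simp add: shortest_path_def)

lemma shortest_path_nth:
  assumes P: "shortest_path V E u v P" and t: "t \<le> gd u v"
  shows "P ! t \<in> V" "gd u (P ! t) = t" "gd (P ! t) v = gd u v - t"
proof -
  have len: "t < length P" using t shortest_path_length[OF P] by simp
  have W: "walk V E u v P" using P by (simp add: shortest_path_def)
  show m: "P ! t \<in> V" using len shortest_path_nodes[OF P] by auto
  have 1: "gd u (P ! t) \<le> t" using gdist_le_walk[OF walk_take[OF W len]] len by simp
  have 2: "gd (P ! t) v \<le> gd u v - t"
    using gdist_le_walk[OF walk_drop[OF W len]] shortest_path_length[OF P] by simp
  have "gd u v \<le> gd u (P ! t) + gd (P ! t) v"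
    using gdist_triangle m shortest_path_ends[OF P] by blast
  then show "gd u (P ! t) = t" "gd (P ! t) v = gd u v - t" using 1 2 t by linarith+
qed

lemma shortest_path_between:
  assumes P: "shortest_path V E u v P" and x: "x \<in> set P"
  shows "gd u x + gd x v = gd u v"
proof -
  obtain t where "t < length P" "x = P ! t" using x by (auto simp: in_set_conv_nth)
  then show ?thesis using shortest_path_nth[OF P, of t] shortest_path_length[OF P] by simp
qed

text \<open>Distances are integers, so slimness may be stated with a natural number. The value 0 can
  occur, which is why later bounds contain \<open>max 1 e\<close>.\<close>

lemma hyperbolic_floor:
  assumes "hyperbolic V E \<delta>" shows "hyperbolic V E (real (nat \<lfloor>\<delta>\<rfloor>))"
proof -
  have "real k \<le> \<delta> \<Longrightarrow> real k \<le> real (nat \<lfloor>\<delta>\<rfloor>)" for k :: nat by (metis le_nat_floor of_nat_le_iff)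
  then show ?thesis using assms unfolding hyperbolic_def by meson
qed

lemma hyperbolicD:
  assumes "hyperbolic V E (real e)" "shortest_path V E u v P" "shortest_path V E u w Q"
    "shortest_path V E v w R" "x \<in> set P"
  obtains y where "y \<in> set Q \<union> set R" "gd x y \<le> e"
  using assms unfolding hyperbolic_def of_nat_le_iff by meson

lemma gdist_walk_fun:
  assumes "\<And>i. i \<le> l \<Longrightarrow> c i \<in> V" and "\<And>i. i < l \<Longrightarrow> {c i, c (Suc i)} \<in> E"
    and "i \<le> j" "j \<le> l"
  shows "gd (c i) (c j) \<le> j - i"
  using assms(3,4)
proof (induction j rule: dec_induct)
  case base then show ?case using assms by simp
next
  case (step j)
  then have "gd (c i) (c (Suc j)) \<le> gd (c i) (c j) + gd (c j) (c (Suc j))"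
    by (intro gdist_triangle assms) auto
  then show ?case using step gdist_edge[OF assms(2), of j] by simp
qed

text \<open>Bisection of the walk: every halving costs one application of slimness, and pieces of length
  at most \<open>b\<close> are within \<open>b div 2\<close> of their ends.\<close>

lemma geodesic_near_walk:
  assumes hyp: "hyperbolic V E (real e)"
    and c: "\<And>i. i \<le> l \<Longrightarrow> c i \<in> V" and cE: "\<And>i. i < l \<Longrightarrow> {c i, c (Suc i)} \<in> E"
    and "i \<le> j" "j \<le> l" "j - i \<le> b * 2 ^ k" "shortest_path V E (c i) (c j) P" "x \<in> set P"
  shows "\<exists>h\<in>{i..j}. gd x (c h) \<le> e * k + b div 2"
  using assms(4-8)
proof (induction k arbitrary: i j P x)
  case 0
  have "gd (c i) (c j) \<le> b" using gdist_walk_fun[of l c i j] c cE 0 by auto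
  moreover have "gd (c i) x + gd x (c j) = gd (c i) (c j)" using shortest_path_between 0 by blast
  moreover have "gd (c i) x = gd x (c i)" using gdist_sym c shortest_path_nodes 0 by (meson order_trans subsetD)
  ultimately have "gd x (c i) \<le> b div 2 \<or> gd x (c j) \<le> b div 2" by linarith
  then show ?case using 0 by auto
next
  case (Suc k)
  define h where "h = (i + j) div 2"
  have h: "i \<le> h" "h \<le> j" "h - i \<le> b * 2 ^ k" "j - h \<le> b * 2 ^ k" "h \<le> l"
    using Suc.prems unfolding h_def by auto
  obtain Q where Q: "shortest_path V E (c i) (c h) Q"
    using shortest_path_exists c h Suc.prems by (meson le_trans)
  obtain R where R: "shortest_path V E (c h) (c j) R"
    using shortest_path_exists c h Suc.prems by (meson le_trans)
  \<comment> \<open>The definition of hyperbolicity orients the third side towards the common node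
    \<open>c h\<close>, hence the reversal.\<close>
  obtain R' where R': "shortest_path V E (c j) (c h) R'" "set R' = set R"
    using R walk_rev[of "c h" "c j" R] gdist_sym[of "c h" "c j"] shortest_path_ends[OF R]
    unfolding shortest_path_def by (metis length_rev set_rev)
  obtain y where y: "y \<in> set Q \<union> set R" "gd x y \<le> e"
    using hyperbolicD[OF hyp Suc.prems(4) Q R'(1) Suc.prems(5)] R'(2) by auto
  have "\<exists>g\<in>{i..j}. gd y (c g) \<le> e * k + b div 2"
    using y(1)
  proof
    assume "y \<in> set Q"
    then show ?thesis using Suc.IH[of i h Q y] h Q by auto
  next
    assume "y \<in> set R"
    then show ?thesis using Suc.IH[of h j R y] h R Suc.prems by auto
  qed
  then obtain g where g: "g \<in> {i..j}" "gd y (c g) \<le> e * k + b div 2" by auto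
  have "x \<in> V" "y \<in> V" "c g \<in> V"
    using shortest_path_nodes Q R Suc.prems y(1) c g(1) by (auto dest: subsetD)
  then have "gd x (c g) \<le> gd x y + gd y (c g)" by (rule gdist_triangle)
  then show ?case using y g by (intro bexI[of _ g]) auto
qed

end

section \<open>The length of walks that stay away from a geodesic\<close>

locale geodesic = conn_graph V E for V :: "'a set" and E +
  fixes p q :: 'a and G :: "'a list" and e :: nat
  assumes hyp: "hyperbolic V E (real e)" and G: "shortest_path V E p q G"
begin

lemma p [simp]: "p \<in> V" and q [simp]: "q \<in> V" using shortest_path_ends[OF G] by auto

lemma node_G: "t \<le> gd p q \<Longrightarrow> G ! t \<in> V"
  using shortest_path_nth[OF G] by blast

lemma gdist_G: assumes "t \<le> gd p q" shows "gd p (G ! t) = t" "gd q (G ! t) = gd p q - t"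
  using shortest_path_nth[OF G assms] gdist_sym[of q "G ! t"] by auto

text \<open>The coordinate \<open>gd p v - gd q v\<close> equals \<open>2 * t - gd p q\<close> at
  \<open>G ! t\<close>. A geodesic from \<open>p\<close> to \<open>z\<close> that passes near
  \<open>G ! t\<close> forces the coordinate of \<open>z\<close> to be at least this value, up to
  \<open>2 * k\<close>. The contrapositive excludes this side of a triangle when \<open>z\<close>
  lies well before \<open>G ! t\<close>.\<close>

lemma near_p_side:
  assumes "t \<le> gd p q" "shortest_path V E p z Q" "y \<in> set Q" "gd (G ! t) y \<le> k"
  shows "2 * t + gd q z \<le> gd p q + gd p z + 2 * k"
proof -
  have V: "y \<in> V" "z \<in> V" "G ! t \<in> V" using assms shortest_path_nodes shortest_path_ends node_G by blast+
  have "gd p (G ! t) \<le> gd p y + gd y (G ! t)" "gd q z \<le> gd q (G ! t) + gd (G ! t) z"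
     "gd (G ! t) z \<le> gd (G ! t) y + gd y z"
    using V by (auto intro: gdist_triangle)
  moreover have "gd p y + gd y z = gd p z" using shortest_path_between assms by blast
  moreover have "gd y (G ! t) = gd (G ! t) y" using V gdist_sym by blast
  ultimately show ?thesis using gdist_G[OF assms(1)] assms by linarith
qed

text \<open>The mirror image: it excludes the side from \<open>q\<close> when \<open>z\<close> lies
  well beyond \<open>G ! t\<close>.\<close>

lemma near_q_side:
  assumes "t \<le> gd p q" "shortest_path V E q z Q" "y \<in> set Q" "gd (G ! t) y \<le> k"
  shows "gd p q + gd p z \<le> 2 * t + gd q z + 2 * k"
proof -
  have V: "y \<in> V" "z \<in> V" "G ! t \<in> V" using assms shortest_path_nodes shortest_path_ends node_G by blast+
  have "gd q (G ! t) \<le> gd q y + gd y (G ! t)" "gd p z \<le> gd p (G ! t) + gd (G ! t) z"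
     "gd (G ! t) z \<le> gd (G ! t) y + gd y z"
    using V by (auto intro: gdist_triangle)
  moreover have "gd q y + gd y z = gd q z" using shortest_path_between assms by blast
  moreover have "gd y (G ! t) = gd (G ! t) y" using V gdist_sym by blast
  ultimately show ?thesis using gdist_G[OF assms(1)] assms by linarith
qed

text \<open>Slimness is used twice. In the triangle \<open>p\<close>, \<open>q\<close>,
  \<open>z\<close> the position of \<open>z\<close> excludes the side from \<open>p\<close>, so a
  point near \<open>G ! t\<close> lies on the side from \<open>q\<close>. In the triangle
  \<open>q\<close>, \<open>z\<close>, \<open>z'\<close> the side from \<open>q\<close> to
  \<open>z'\<close> is excluded likewise. The exclusions are made at distance \<open>e\<close> and
  \<open>2 * e\<close>, whence the terms \<open>2 * e\<close> in \<open>A\<close> and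
  \<open>4 * e\<close> in \<open>B\<close>.\<close>

lemma geodesic_between:
  assumes t: "t \<le> gd p q" and z: "z \<in> V" "z' \<in> V" and R: "shortest_path V E z z' R"
    and A: "gd p q + gd p z + 2 * e < 2 * t + gd q z"
    and B: "2 * t + gd q z' + 4 * e < gd p q + gd p z'"
  shows "\<exists>y\<in>set R. gd (G ! t) y \<le> 2 * e"
proof -
  have m: "G ! t \<in> set G" using t shortest_path_length[OF G] by auto
  obtain Pz where Pz: "shortest_path V E p z Pz" using shortest_path_exists z p by blast
  obtain Qz where Qz: "shortest_path V E q z Qz" using shortest_path_exists z q by blast
  obtain Qz' where Qz': "shortest_path V E q z' Qz'" using shortest_path_exists z q by blast
  obtain y where y: "y \<in> set Pz \<union> set Qz" "gd (G ! t) y \<le> e"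
    using hyperbolicD[OF hyp G Pz Qz m] by blast
  have yQ: "y \<in> set Qz" using near_p_side[OF t Pz _ y(2)] A y(1) by auto
  obtain w where w: "w \<in> set Qz' \<union> set R" "gd y w \<le> e"
    using hyperbolicD[OF hyp Qz Qz' R yQ] by blast
  have V: "y \<in> V" "w \<in> V" using shortest_path_nodes Qz Qz' R yQ w by blast+
  have "gd (G ! t) w \<le> gd (G ! t) y + gd y w" using V node_G[OF t] by (intro gdist_triangle)
  then have near: "gd (G ! t) w \<le> 2 * e" using y w by simp
  then have "w \<notin> set Qz'" using near_q_side[OF t Qz' _ near] B by auto
  then show ?thesis using w near by auto
qed

text \<open>The coordinate \<open>gd p v - gd q v\<close> replaces the nearest-point projection to the geodesic:
  it changes by at most 2 along an edge. The walk is cut where it first reaches equally spaced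
  values of it.\<close>

lemma bypass_length:
  fixes c :: "nat \<Rightarrow> 'a"
  assumes c: "\<And>i. i \<le> l \<Longrightarrow> c i \<in> V" and cE: "\<And>i. i < l \<Longrightarrow> {c i, c (Suc i)} \<in> E"
    and c0: "c 0 = p" and cl: "c l = q"
    and range: "s + J * (3 * e + 2) \<le> gd p q"
    and far: "\<And>i t. i \<le> l \<Longrightarrow> s \<le> t \<Longrightarrow> t \<le> s + J * (3 * e + 2) \<Longrightarrow> f \<le> gd (G ! t) (c i)"
    and k: "e * (k + 3) < f"
  shows "J * (max 1 e * 2 ^ k) \<le> l"
proof -
  \<comment> \<open>The point at offset \<open>e + 1\<close> after a threshold is
    \<open>2 * e + 1\<close> before the next one, which is just enough for both hypotheses of
    \<open>geodesic_between\<close>. This fixes the spacing \<open>3 * e + 2\<close>.\<close>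
  define T where "T j = s + j * (3 * e + 2)" for j
  define pr where "pr j i \<longleftrightarrow> 2 * T j + gd q (c i) \<le> gd p q + gd p (c i)" for j i
  define \<iota> where "\<iota> j = (LEAST i. pr j i)" for j
  have TJ: "T j \<le> T J" if "j \<le> J" for j unfolding T_def by (intro add_left_mono mult_right_mono that) simp
  have prl: "pr j l" if "j \<le> J" for j
    using TJ[OF that] range unfolding pr_def cl T_def by simp
  have prI: "pr j (\<iota> j)" "\<iota> j \<le> l" if "j \<le> J" for j
    using LeastI[of "pr j" l] Least_le[of "pr j" l] prl[OF that] unfolding \<iota>_def by auto
  \<comment> \<open>Just before the first crossing the inequality fails strictly, and one edge
    changes the coordinate by at most 2, so the overshoot is at most 1.\<close>
  have up: "gd p q + gd p (c (\<iota> j)) \<le> 2 * T j + gd q (c (\<iota> j)) + 1" if "j \<le> J" for j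
  proof (cases "\<iota> j")
    case 0 then show ?thesis using c0 gdist_sym[of p q] by simp
  next
    case (Suc i)
    then have "\<not> pr j i" unfolding \<iota>_def by (metis lessI not_less_Least)
    then have 1: "gd p q + gd p (c i) < 2 * T j + gd q (c i)" unfolding pr_def by simp
    have il: "Suc i \<le> l" using prI(2)[OF that] Suc by simp
    have "c i \<in> V" "c (Suc i) \<in> V" using il by (auto intro: c)
    then have "gd p (c (Suc i)) \<le> gd p (c i) + gd (c i) (c (Suc i))"
      "gd q (c i) \<le> gd q (c (Suc i)) + gd (c i) (c (Suc i))"
      using gdist_triangle[of p "c i" "c (Suc i)"] gdist_triangle[of q "c (Suc i)" "c i"]
        gdist_sym[of "c i" "c (Suc i)"] by auto
    moreover have "gd (c i) (c (Suc i)) \<le> 1" using il by (intro gdist_edge cE) simp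
    ultimately show ?thesis using 1 Suc by simp
  qed
  \<comment> \<open>The walk would otherwise come too close to \<open>G ! t\<close>:
    \<open>2 * e\<close> to the geodesic between the ends of the piece, \<open>e * k\<close> for the
    bisection and at most \<open>e\<close> for its last stage add up to
    \<open>e * (k + 3) < f\<close>, against \<open>far\<close>.\<close>
  have step: "\<iota> j + max 1 e * 2 ^ k \<le> \<iota> (Suc j)" if j: "j < J" for j
  proof (rule ccontr)
    assume less: "\<not> ?thesis"
    have mono: "\<iota> j \<le> \<iota> (Suc j)"
    proof -
      have "pr j (\<iota> (Suc j))" using prI(1)[of "Suc j"] j unfolding pr_def T_def by simp
      then show ?thesis unfolding \<iota>_def[of j] by (rule Least_le)
    qed
    define t where "t = T j + e + 1"
    have tT: "s \<le> t" "t \<le> T (Suc j)" unfolding t_def T_def by auto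
    have t: "t \<le> gd p q" using tT TJ[of "Suc j"] j range unfolding T_def by simp
    have z: "c (\<iota> j) \<in> V" "c (\<iota> (Suc j)) \<in> V" using c prI(2) j by auto
    obtain R where R: "shortest_path V E (c (\<iota> j)) (c (\<iota> (Suc j))) R"
      using shortest_path_exists z by blast
    have "\<exists>y\<in>set R. gd (G ! t) y \<le> 2 * e"
    proof (rule geodesic_between[OF t z R])
      show "gd p q + gd p (c (\<iota> j)) + 2 * e < 2 * t + gd q (c (\<iota> j))"
        using up[of j] j unfolding t_def by simp
      show "2 * t + gd q (c (\<iota> (Suc j))) + 4 * e < gd p q + gd p (c (\<iota> (Suc j)))"
        using prI(1)[of "Suc j"] j unfolding t_def pr_def T_def by simp
    qed
    then obtain y where y: "y \<in> set R" "gd (G ! t) y \<le> 2 * e" by blast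
    obtain h where h: "h \<in> {\<iota> j..\<iota> (Suc j)}" "gd y (c h) \<le> e * k + max 1 e div 2"
      using geodesic_near_walk[OF hyp c cE mono prI(2) _ R y(1)] less j by force
    have hl: "h \<le> l" using h prI(2)[of "Suc j"] j by simp
    have "gd (G ! t) (c h) \<le> gd (G ! t) y + gd y (c h)"
      using y(1) shortest_path_nodes[OF R] c[OF hl] node_G[OF t] by (intro gdist_triangle) auto
    also have "\<dots> \<le> 2 * e + (e * k + e)" using y h by (auto simp: max_def split: if_splits)
    also have "\<dots> < f" using k by (simp add: algebra_simps)
    finally show False using far[OF hl tT(1)] tT(2) TJ[of "Suc j"] j unfolding T_def by fastforce
  qed
  have "j \<le> J \<Longrightarrow> j * (max 1 e * 2 ^ k) \<le> \<iota> j" for j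
  proof (induction j)
    case (Suc j) then show ?case using step[of j] by simp
  qed simp
  from this[of J] show ?thesis using prI(2)[of J] by simp
qed

text \<open>By hypothesis the Gromov product of \<open>p\<close> and \<open>q\<close> based at
  \<open>v\<close> is at most \<open>h\<close>. In the triangle \<open>p\<close>, \<open>q\<close>,
  \<open>v\<close> a suitable node of \<open>G\<close> is within \<open>e\<close> of some
  \<open>y\<close> on a side ending in \<open>v\<close>, and the rest of that side, from
  \<open>y\<close> to \<open>v\<close>, has length at most \<open>e + h\<close>.\<close>

lemma cylinder_near:
  assumes v: "v \<in> V" and le: "gd p v + gd q v \<le> gd p q + 2 * h"
  shows "\<exists>m\<in>set G. gd m v \<le> h + 2 * e"
proof -
  \<comment> \<open>The position on \<open>G\<close> with the same coordinate as \<open>v\<close>.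
    Rounding costs nothing because the slack \<open>2 * h\<close> is even.\<close>
  define t where "t = (gd p q + gd p v - gd q v) div 2"
  have tri: "gd q v \<le> gd p q + gd p v" "gd p v \<le> gd p q + gd q v"
    using gdist_triangle[of q p v] gdist_triangle[of p q v] gdist_sym[of p q] v by auto
  have t: "t \<le> gd p q" using tri unfolding t_def by linarith
  have m: "G ! t \<in> set G" using t shortest_path_length[OF G] by auto
  obtain Pz where Pz: "shortest_path V E p v Pz" using shortest_path_exists v p by blast
  obtain Qz where Qz: "shortest_path V E q v Qz" using shortest_path_exists v q by blast
  obtain y where y: "y \<in> set Pz \<union> set Qz" "gd (G ! t) y \<le> e"
    using hyperbolicD[OF hyp G Pz Qz m] by blast
  have yV: "y \<in> V" using y shortest_path_nodes Pz Qz by blast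
  have "gd (G ! t) v \<le> gd (G ! t) y + gd y v" using yV v node_G[OF t] by (intro gdist_triangle)
  moreover have "gd y v \<le> e + h" using y(1)
  proof
    assume "y \<in> set Pz"
    then have "gd p y + gd y v = gd p v" using shortest_path_between Pz by blast
    moreover have "gd p (G ! t) \<le> gd p y + gd y (G ! t)" using yV node_G[OF t] by (intro gdist_triangle) auto
    moreover have "gd y (G ! t) = gd (G ! t) y" using yV node_G[OF t] gdist_sym by blast
    ultimately show ?thesis using y(2) gdist_G(1)[OF t] le tri unfolding t_def by linarith
  next
    assume "y \<in> set Qz"
    then have "gd q y + gd y v = gd q v" using shortest_path_between Qz by blast
    moreover have "gd q (G ! t) \<le> gd q y + gd y (G ! t)" using yV node_G[OF t] by (intro gdist_triangle) auto
    moreover have "gd y (G ! t) = gd (G ! t) y" using yV node_G[OF t] gdist_sym by blast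
    ultimately show ?thesis using y(2) gdist_G(2)[OF t] le tri unfolding t_def by linarith
  qed
  ultimately have "gd (G ! t) v \<le> h + 2 * e" using y(2) by simp
  then show ?thesis using m by blast
qed

end

section \<open>Growth of balls after the removal of a set of nodes\<close>

text \<open>Only newly added nodes are tested against \<open>C\<close>, so the centre belongs to its
  ball even if it lies in \<open>C\<close>. The program agrees with this: it labels the centre after
  marking the removed nodes.\<close>

primrec removal_ball :: "'a set \<Rightarrow> 'a set set \<Rightarrow> 'a set \<Rightarrow> 'a \<Rightarrow> nat \<Rightarrow> 'a set" where
  "removal_ball V E C x 0 = {x}"
| "removal_ball V E C x (Suc r) = removal_ball V E C x r \<union>
     {v \<in> V - C. \<exists>u\<in>removal_ball V E C x r. {u, v} \<in> E}"

text \<open>\<open>P k\<close> are the prefixes of an enumeration of the component of \<open>x\<close> in the graph without \<open>C\<close> that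
  is sorted by the distance from \<open>x\<close>.\<close>

definition ball_chain :: "'a set \<Rightarrow> 'a set set \<Rightarrow> 'a set \<Rightarrow> 'a \<Rightarrow> nat \<Rightarrow> (nat \<Rightarrow> 'a set) \<Rightarrow> bool" where
  "ball_chain V E C x N P \<longleftrightarrow> (\<forall>k\<le>N. P k \<subseteq> V \<and> card (P k) = k) \<and>
     (\<forall>j k. j \<le> k \<longrightarrow> k \<le> N \<longrightarrow> P j \<subseteq> P k) \<and> (\<forall>r. \<exists>k\<le>N. removal_ball V E C x r = P k)"

definition cheap :: "'a set \<Rightarrow> 'a set set \<Rightarrow> nat \<Rightarrow> (nat \<Rightarrow> 'a set) \<Rightarrow> real \<Rightarrow> nat set" where
  "cheap V E N P \<theta> = {k. 1 \<le> k \<and> k \<le> N \<and> 2 * k \<le> card V \<and>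
     real (card (node_boundary V E (P k))) \<le> \<theta> * real k}"

text \<open>The quantifier over all chains covers every way to break ties in a breadth-first search,
  so existence results apply to whatever order the program computes. The strict inequality yields at
  least one set even for \<open>D = 0\<close>.\<close>

definition many_cheap :: "'a set \<Rightarrow> 'a set set \<Rightarrow> nat \<Rightarrow> 'a set \<Rightarrow> real \<Rightarrow> 'a \<Rightarrow> bool" where
  "many_cheap V E D C \<theta> x \<longleftrightarrow> (\<forall>N P. ball_chain V E C x N P \<longrightarrow> D < 64 * card (cheap V E N P \<theta>))"

lemma finite_cheap [simp]: "finite (cheap V E N P \<theta>)"
  by (rule finite_subset[of _ "{..N}"]) (auto simp: cheap_def)

lemma removal_ball_mono: "r \<le> r' \<Longrightarrow> removal_ball V E C x r \<subseteq> removal_ball V E C x r'"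
  by (rule lift_Suc_mono_le[of "removal_ball V E C x"]) auto

lemma centre_in_removal_ball: "x \<in> removal_ball V E C x r"
  using removal_ball_mono[of 0 r V E C x] by auto

lemma removal_ball_subset: "x \<in> V \<Longrightarrow> removal_ball V E C x r \<subseteq> V"
  by (induction r) auto

lemma removal_ball_Suc_boundary:
  assumes "x \<in> V"
  shows "removal_ball V E C x (Suc r) =
    removal_ball V E C x r \<union> (node_boundary V E (removal_ball V E C x r) - C)"
  using removal_ball_subset[OF assms, of E C r] unfolding node_boundary_def by auto

text \<open>Each radius outside \<open>K\<close> contributes one factor; the radii in
  \<open>K\<close> cause no loss, by monotonicity.\<close>

lemma power_le_growing:
  fixes a :: "nat \<Rightarrow> real"
  assumes "\<And>r. r < R \<Longrightarrow> r \<notin> K \<Longrightarrow> (1 + \<theta>) * a r \<le> a (Suc r)" and "\<And>r. a r \<le> a (Suc r)"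
    and "1 \<le> a 0" and "0 \<le> \<theta>"
  shows "(1 + \<theta>) ^ card ({..<R} - K) \<le> a R"
  using assms(1)
proof (induction R)
  case (Suc R)
  have IH: "(1 + \<theta>) ^ card ({..<R} - K) \<le> a R" using Suc by simp
  show ?case
  proof (cases "R \<in> K")
    case True
    then have "{..<Suc R} - K = {..<R} - K" by (auto simp: less_Suc_eq)
    then show ?thesis using IH assms(2)[of R] by simp
  next
    case False
    then have "{..<Suc R} - K = insert R ({..<R} - K)" by (auto simp: less_Suc_eq)
    then have "(1 + \<theta>) ^ card ({..<Suc R} - K) = (1 + \<theta>) * (1 + \<theta>) ^ card ({..<R} - K)" by simp
    also have "\<dots> \<le> (1 + \<theta>) * a R" using IH assms(4) by (intro mult_left_mono) auto
    finally show ?thesis using Suc.prems[of R] False by simp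
  qed
qed (use assms(3) in simp)

lemma ball_chain_ball:
  assumes "ball_chain V E C x N P"
  shows "card (removal_ball V E C x r) \<le> N"
    "removal_ball V E C x r = P (card (removal_ball V E C x r))"
  using assms unfolding ball_chain_def by metis+

lemma ball_chain_centre:
  assumes "ball_chain V E C x N P" "1 \<le> k" "k \<le> N" shows "x \<in> P k"
proof -
  have "P 1 = {x}" using ball_chain_ball(2)[OF assms(1), of 0] by simp
  moreover have "P 1 \<subseteq> P k" using assms unfolding ball_chain_def by blast
  ultimately show ?thesis by auto
qed

context conn_graph
begin

lemma finite_subset_V [intro]: "A \<subseteq> V \<Longrightarrow> finite A"
  by (rule finite_subset[OF _ finite_V])

lemma node_boundary_subset: "node_boundary V E S \<subseteq> V - S"
  by (auto simp: node_boundary_def)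

lemma finite_node_boundary [simp]: "finite (node_boundary V E S)"
  using node_boundary_subset[of S] by auto

lemma finite_removal_ball [simp]: "x \<in> V \<Longrightarrow> finite (removal_ball V E C x r)"
  using removal_ball_subset[of x V E C r] by auto

lemma card_removal_ball_Suc:
  assumes "x \<in> V"
  shows "card (removal_ball V E C x (Suc r)) =
    card (removal_ball V E C x r) + card (node_boundary V E (removal_ball V E C x r) - C)"
  unfolding removal_ball_Suc_boundary[OF assms] using assms
  by (intro card_Un_disjoint) (auto simp: node_boundary_def)

lemma removal_ball_walk:
  assumes "x \<in> V" "v \<in> removal_ball V E C x r"
  shows "\<exists>xs. walk V E x v xs \<and> length xs \<le> r + 1 \<and> set xs \<inter> C \<subseteq> {x}"
  using assms(2)
proof (induction r arbitrary: v)
  case 0 then show ?case using assms(1) by (auto simp: walk_def intro!: exI[of _ "[x]"])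
next
  case (Suc r)
  show ?case
  proof (cases "v \<in> removal_ball V E C x r")
    case True then show ?thesis using Suc.IH by fastforce
  next
    case False
    then obtain u where u: "u \<in> removal_ball V E C x r" "{u, v} \<in> E" "v \<in> V - C" using Suc.prems by auto
    obtain xs where "walk V E x u xs" "length xs \<le> r + 1" "set xs \<inter> C \<subseteq> {x}" using Suc.IH[OF u(1)] by blast
    then show ?thesis using u
      by (intro exI[of _ "xs @ [v]"]) (auto simp: walk_def successively_append_iff)
  qed
qed

lemma removal_ball_gdist:
  assumes "x \<in> V" "v \<in> V" shows "v \<in> removal_ball V E {} x r \<longleftrightarrow> gd x v \<le> r"
proof
  assume "v \<in> removal_ball V E {} x r"
  then obtain xs where "walk V E x v xs" "length xs \<le> r + 1" using removal_ball_walk assms by blast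
  then show "gd x v \<le> r" using gdist_le_walk by fastforce
next
  assume "gd x v \<le> r"
  then show "v \<in> removal_ball V E {} x r" using assms(2)
  proof (induction r arbitrary: v)
    case 0 then show ?case using gdist_0 assms(1) by simp
  next
    case (Suc r)
    show ?case
    proof (cases "gd x v \<le> r")
      case True then show ?thesis using Suc by simp
    next
      case False
      then have d: "gd x v = Suc r" using Suc by simp
      obtain P where P: "shortest_path V E x v P" using shortest_path_exists assms(1) Suc by blast
      have l: "length P = Suc (Suc r)" using shortest_path_length[OF P] d by simp
      have r: "P ! r \<in> V" "gd x (P ! r) = r" using shortest_path_nth[OF P, of r] d by auto
      have "P ! Suc r = v" using P l unfolding shortest_path_def walk_def
        by (metis diff_Suc_1 last_conv_nth)
      then have "{P ! r, v} \<in> E" using P l unfolding shortest_path_def walk_def successively_conv_nth by auto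
      moreover have "P ! r \<in> removal_ball V E {} x r" using Suc.IH[of "P ! r"] r by simp
      ultimately show ?thesis using Suc.prems by auto
    qed
  qed
qed

lemma removal_ball_far:
  assumes "x \<in> V" "\<And>v. v \<in> C \<Longrightarrow> v \<in> V \<Longrightarrow> R < gd x v" "r \<le> R"
  shows "removal_ball V E C x r = removal_ball V E {} x r"
  using assms(3)
proof (induction r)
  case (Suc r)
  then have IH: "removal_ball V E C x r = removal_ball V E {} x r" by simp
  have "v \<notin> C" if "v \<in> removal_ball V E {} x (Suc r)" for v
  proof -
    have "v \<in> V" using subsetD[OF removal_ball_subset[OF assms(1)] that] .
    then have "gd x v \<le> R" using that removal_ball_gdist[OF assms(1), of v "Suc r"] Suc.prems by linarith
    then show ?thesis using assms(2)[of v] \<open>v \<in> V\<close> by linarith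
  qed
  then show ?case using IH by auto
qed simp

lemma card_node_boundary_le:
  assumes deg: "\<forall>v\<in>V. node_degree V E v \<le> d" and S: "S \<subseteq> V"
  shows "card (node_boundary V E S) \<le> d * card S"
proof -
  have "node_boundary V E S \<subseteq> (\<Union>u\<in>S. {v \<in> V. {v, u} \<in> E})"
    by (auto simp: node_boundary_def insert_commute)
  then have "card (node_boundary V E S) \<le> card (\<Union>u\<in>S. {v \<in> V. {v, u} \<in> E})"
    using S by (intro card_mono) auto
  also have "\<dots> \<le> (\<Sum>u\<in>S. card {v \<in> V. {v, u} \<in> E})" using S by (intro card_UN_le) auto
  also have "\<dots> \<le> (\<Sum>u\<in>S. d)" using deg S by (intro sum_mono) (auto simp: node_degree_def)
  finally show ?thesis by (simp add: mult.commute)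
qed

text \<open>One step multiplies the size by at most \<open>1 + d \<le> 2 * d\<close>. This is where
  the base \<open>2 * d\<close> of the logarithm in the final bound enters.\<close>

lemma card_removal_ball_le:
  assumes deg: "\<forall>v\<in>V. node_degree V E v \<le> d" and d: "1 \<le> d" and x: "x \<in> V"
  shows "card (removal_ball V E C x r) \<le> (2 * d) ^ r"
proof (induction r)
  case (Suc r)
  let ?B = "removal_ball V E C x r"
  have "card (removal_ball V E C x (Suc r)) \<le> card ?B + card (node_boundary V E ?B)"
    unfolding card_removal_ball_Suc[OF x] by (intro add_left_mono card_mono) auto
  also have "\<dots> \<le> card ?B + d * card ?B"
    using card_node_boundary_le[OF deg removal_ball_subset[OF x]] by simp
  also have "\<dots> \<le> 2 * d * card ?B" using d by (cases d) auto
  also have "\<dots> \<le> 2 * d * (2 * d) ^ r" by (intro mult_left_mono Suc) auto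
  finally show ?case by simp
qed simp

lemma gdist_less_card:
  assumes "x \<in> V" "z \<in> V" shows "gd x z < card V"
proof -
  obtain P where P: "shortest_path V E x z P" using shortest_path_exists assms by blast
  have "inj_on ((!) P) {..gd x z}"
    by (rule inj_on_inverseI[of _ "gd x"]) (use shortest_path_nth[OF P] in auto)
  moreover have "(!) P ` {..gd x z} \<subseteq> V" using shortest_path_nth[OF P] by auto
  ultimately have "card {..gd x z} \<le> card V" by (intro card_inj_on_le) auto
  then show ?thesis by simp
qed

lemma ball_chain_full:
  assumes "x \<in> V" "ball_chain V E {} x N P" shows "card V \<le> N"
proof -
  have "removal_ball V E {} x (card V) = V"
    using removal_ball_subset[OF assms(1)] removal_ball_gdist[OF assms(1)] gdist_less_card[OF assms(1)]
    by (auto simp: less_imp_le)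
  then show ?thesis using ball_chain_ball(1)[OF assms(2), of "card V"] by simp
qed

text \<open>A set with at least a third of the nodes has at most twice its size outside, hence
  expansion at most 2. About a sixth of all sizes lie between a third and a half of the
  nodes.\<close>

lemma cheap_if_ge_2:
  assumes x: "x \<in> V" and ch: "ball_chain V E {} x N P" and \<theta>: "2 \<le> \<theta>" and n: "2 \<le> card V"
  shows "card V < 64 * card (cheap V E N P \<theta>)"
proof -
  let ?I = "{(card V + 2) div 3..card V div 2}"
  have "?I \<subseteq> cheap V E N P \<theta>"
  proof
    fix k assume k: "k \<in> ?I"
    have "1 \<le> (card V + 2) div 3" using n by linarith
    then have k': "1 \<le> k" "k \<le> N" "2 * k \<le> card V" "card V \<le> 3 * k"
      using k n ball_chain_full[OF x ch] by auto
    have "P k \<subseteq> V" "card (P k) = k" using ch k'(2) unfolding ball_chain_def by auto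
    then have "card (V - P k) = card V - k" by (simp add: card_Diff_subset finite_subset_V)
    then have "card (node_boundary V E (P k)) \<le> card V - k"
      using card_mono[OF _ node_boundary_subset, of "P k"] by simp
    then have "real (card (node_boundary V E (P k))) \<le> 2 * real k" using k' by linarith
    also have "\<dots> \<le> \<theta> * real k" using \<theta> by (intro mult_right_mono) auto
    finally show "k \<in> cheap V E N P \<theta>" using k' unfolding cheap_def by simp
  qed
  then have "card ?I \<le> card (cheap V E N P \<theta>)" by (intro card_mono) auto
  moreover have "card V < 64 * card ?I" using n by simp
  ultimately show ?thesis by linarith
qed

text \<open>A node \<open>z\<close> at distance at least \<open>R\<close> makes the balls grow
  strictly up to radius \<open>R\<close>, so radii with a small boundary inject into the cheap
  prefix sizes. All other radii, at least \<open>R\<close> minus the number of cheap sizes, multiply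
  the ball by \<open>1 + \<theta>\<close>.\<close>

lemma few_cheap_growth:
  fixes \<theta> :: real
  assumes x: "x \<in> V" and ch: "ball_chain V E {} x N P" and z: "z \<in> V" "R \<le> gd x z"
    and half: "2 * card (removal_ball V E {} x R) \<le> card V" and \<theta>: "0 \<le> \<theta>"
  shows "(1 + \<theta>) ^ (R - card (cheap V E N P \<theta>)) \<le> card (removal_ball V E {} x R)"
proof -
  let ?B = "removal_ball V E {} x"
  define K where "K = {r. r < R \<and> real (card (node_boundary V E (?B r))) \<le> \<theta> * card (?B r)}"
  have strict: "card (?B r) < card (?B r')" if r: "r < r'" "r' \<le> R" for r r'
  proof -
    obtain Q where Q: "shortest_path V E x z Q" using shortest_path_exists x z by blast
    have "Q ! r' \<in> ?B r'" "Q ! r' \<notin> ?B r"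
      using shortest_path_nth[OF Q, of r'] r z removal_ball_gdist[OF x, of "Q ! r'"] by auto
    then have "?B r \<subset> ?B r'" using removal_ball_mono[of r r' V E "{}" x] r by auto
    then show ?thesis using x by (intro psubset_card_mono) auto
  qed
  have pos: "1 \<le> card (?B r)" for r
    using centre_in_removal_ball[of x V E "{}" r] x by (simp add: card_gt_0_iff Suc_le_eq) blast
  have "inj_on (\<lambda>r. card (?B r)) K"
    using strict unfolding K_def by (intro linorder_inj_onI) (auto, metis less_imp_le less_irrefl)
  moreover have "(\<lambda>r. card (?B r)) ` K \<subseteq> cheap V E N P \<theta>"
  proof (rule image_subsetI)
    fix r assume r: "r \<in> K"
    have "card (?B r) \<le> card (?B R)" using r removal_ball_mono[of r R V E "{}" x] x
      unfolding K_def by (intro card_mono) auto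
    then show "card (?B r) \<in> cheap V E N P \<theta>"
      using r half pos[of r] ball_chain_ball[OF ch, of r] unfolding cheap_def K_def by simp
  qed
  ultimately have K: "card K \<le> card (cheap V E N P \<theta>)" by (intro card_inj_on_le) auto
  have "card ({..<R} - K) = R - card K"
    by (subst card_Diff_subset) (auto simp: K_def intro: finite_subset[of _ "{..<R}"])
  then have "(1 + \<theta>) ^ (R - card (cheap V E N P \<theta>)) \<le> (1 + \<theta>) ^ card ({..<R} - K)"
    using K \<theta> by (intro power_increasing) auto
  also have "\<dots> \<le> real (card (?B R))"
  proof (rule power_le_growing[where a = "\<lambda>r. real (card (?B r))"])
    fix r assume "r < R" "r \<notin> K"
    then show "(1 + \<theta>) * real (card (?B r)) \<le> real (card (?B (Suc r)))"
      unfolding card_removal_ball_Suc[OF x] K_def by (simp add: algebra_simps)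
  qed (use \<theta> in \<open>auto simp: card_removal_ball_Suc[OF x] simp del: removal_ball.simps(2)\<close>)
  finally show ?thesis .
qed

text \<open>The walks from both centres to a common node are joined. Since the centres are outside
  \<open>C\<close>, the whole walk avoids \<open>C\<close>. It is presented as a function on
  indices, the form that \<open>bypass_length\<close> expects.\<close>

lemma removal_balls_meet:
  assumes p: "p \<in> V" "p \<notin> C" and q: "q \<in> V" "q \<notin> C"
    and meet: "removal_ball V E C p r \<inter> removal_ball V E C q r \<noteq> {}"
  shows "\<exists>c l. l \<le> 2 * r \<and> c 0 = p \<and> c l = q \<and> (\<forall>i\<le>l. c i \<in> V - C) \<and>
    (\<forall>i<l. {c i, c (Suc i)} \<in> E)"
proof -
  obtain v where v: "v \<in> removal_ball V E C p r" "v \<in> removal_ball V E C q r" using meet by blast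
  obtain xs where xs: "walk V E p v xs" "length xs \<le> r + 1" "set xs \<inter> C \<subseteq> {p}"
    using removal_ball_walk[OF p(1) v(1)] by blast
  obtain ys where ys: "walk V E q v ys" "length ys \<le> r + 1" "set ys \<inter> C \<subseteq> {q}"
    using removal_ball_walk[OF q(1) v(2)] by blast
  define zs where "zs = xs @ tl (rev ys)"
  have w: "walk V E p q zs" unfolding zs_def using walk_append[OF xs(1) walk_rev[OF ys(1)]] .
  have "xs \<noteq> []" using xs by (simp add: walk_def)
  then have len: "length zs - 1 \<le> 2 * r" "length zs > 0" using xs ys unfolding zs_def by auto
  have "set zs \<subseteq> set xs \<union> set ys" unfolding zs_def using list.set_sel(2)[of "rev ys"]
    by (cases "rev ys") auto
  then have C: "set zs \<inter> C = {}" using xs ys p q by auto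
  have "zs ! i \<in> V - C" if "i \<le> length zs - 1" for i

  proof -
    have "zs ! i \<in> set zs" using that len(2) by (intro nth_mem) linarith
    then show ?thesis using w C unfolding walk_def by auto
  qed
  then show ?thesis
    by (intro exI[of _ "(!) zs"] exI[of _ "length zs - 1"])
      (use w len in \<open>auto simp: walk_def hd_conv_nth last_conv_nth successively_conv_nth\<close>)
qed

lemma half_ball:
  assumes "p \<in> V" "q \<in> V" "removal_ball V E C p r \<inter> removal_ball V E C q r = {}"
  shows "\<exists>x\<in>{p, q}. 2 * card (removal_ball V E C x r) \<le> card V"
proof -
  have "card (removal_ball V E C p r) + card (removal_ball V E C q r) \<le> card V"
    using assms removal_ball_subset[of _ V E C r] card_mono[of V "removal_ball V E C p r \<union> removal_ball V E C q r"]
    by (simp add: card_Un_disjoint)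
  then show ?thesis by auto
qed

lemma cheap_balls:
  fixes \<theta> :: real
  assumes p: "p \<in> V" and q: "q \<in> V" and pq: "0 < gd p q" and \<theta>: "0 \<le> \<theta>"
    and big: "real (card V) / 2 < (1 + \<theta>) ^ ((gd p q - 1) div 2 - gd p q div 64)"
  shows "\<exists>x\<in>{p, q}. many_cheap V E (gd p q) {} \<theta> x"
proof -
  \<comment> \<open>The largest radius with \<open>2 * R < gd p q\<close>, so that the two balls are
    disjoint.\<close>
  define R where "R = (gd p q - 1) div 2"
  have "removal_ball V E {} p R \<inter> removal_ball V E {} q R = {}"
  proof (rule ccontr)
    assume "\<not> ?thesis"
    then obtain v where v: "v \<in> removal_ball V E {} p R" "v \<in> removal_ball V E {} q R" by blast
    then have "v \<in> V" using subsetD[OF removal_ball_subset[OF p]] by blast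
    then have "gd p v \<le> R" "gd q v \<le> R" "gd p q \<le> gd p v + gd v q" "gd v q = gd q v"
      using v removal_ball_gdist p q gdist_triangle[of p v q] gdist_sym[of v q] by blast+
    then show False using pq unfolding R_def by linarith
  qed
  then obtain x where x: "x \<in> {p, q}" "2 * card (removal_ball V E {} x R) \<le> card V"
    using half_ball[OF p q] by blast
  show ?thesis unfolding many_cheap_def
  proof (intro bexI[OF _ x(1)] allI impI, rule ccontr)
    fix N P assume ch: "ball_chain V E {} x N P" and "\<not> gd p q < 64 * card (cheap V E N P \<theta>)"
    then have few: "card (cheap V E N P \<theta>) \<le> gd p q div 64" by linarith
    obtain z where z: "z \<in> V" "R \<le> gd x z" using x(1) p q gdist_sym[of p q] unfolding R_def by force
    have "(1 + \<theta>) ^ (R - gd p q div 64) \<le> (1 + \<theta>) ^ (R - card (cheap V E N P \<theta>))"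
      using few \<theta> by (intro power_increasing) auto
    also have "\<dots> \<le> card (removal_ball V E {} x R)"
      using few_cheap_growth[OF _ ch z x(2) \<theta>] x(1) p q by blast
    finally show False using big x(2) unfolding R_def by linarith
  qed
qed

text \<open>A boundary node of a shortened ball is a boundary node of the ball outside
  \<open>C\<close>, or lies in \<open>C\<close>, or has been deleted. The three kinds account for
  the summands on the left of the last hypothesis, while all but at most \<open>J\<close> nodes of
  the ball remain.\<close>

lemma cheap_prefixes:
  fixes \<eta> \<theta> :: real
  assumes x: "x \<in> V" and C: "C \<subseteq> V" and ch: "ball_chain V E C x N P"
    and half: "2 * card (removal_ball V E C x r) \<le> card V"
    and few: "real (card (node_boundary V E (removal_ball V E C x r) - C)) \<le> \<eta> * card (removal_ball V E C x r)"
    and J: "J < card (removal_ball V E C x r)"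
    and \<theta>: "\<eta> * card (removal_ball V E C x r) + card C + J \<le> \<theta> * (real (card (removal_ball V E C x r)) - real J)"
  shows "J < card (cheap V E N P \<theta>)"
proof -
  let ?B = "removal_ball V E C x r" and ?bd = "node_boundary V E"
  define K where "K = card ?B"
  have PK: "P K = ?B" "K \<le> N" using ball_chain_ball[OF ch, of r] unfolding K_def by auto
  have "{K - J..K} \<subseteq> cheap V E N P \<theta>"
  proof
    fix k assume k: "k \<in> {K - J..K}"
    have kN: "1 \<le> k" "k \<le> N" "2 * k \<le> card V" using k J half PK(2) unfolding K_def by auto
    have sub: "P k \<subseteq> P K" "P K \<subseteq> V" "card (P k) = k" "card (P K) = K"
      using ch k PK(2) kN(2) unfolding ball_chain_def by auto
    have "?bd (P k) \<subseteq> (?bd ?B - C) \<union> C \<union> (P K - P k)"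
      using sub PK(1) unfolding node_boundary_def by auto
    moreover have fin: "finite (P K)" "finite (P k)" using sub by auto
    ultimately have "card (?bd (P k)) \<le> card ((?bd ?B - C) \<union> C \<union> (P K - P k))"
      using C by (intro card_mono) auto
    also have "\<dots> \<le> card (?bd ?B - C) + card C + card (P K - P k)"
      by (meson add_mono card_Un_le le_trans order_refl)
    also have "card (P K - P k) = K - k" using sub fin by (simp add: card_Diff_subset)
    finally have "card (?bd (P k)) \<le> card (?bd ?B - C) + card C + J" using k by (auto simp del: Diff_iff)
    then have "real (card (?bd (P k))) \<le> card (?bd ?B - C) + card C + J" by linarith
    also have "\<dots> \<le> \<eta> * K + card C + J" using few unfolding K_def by simp
    also have "\<dots> \<le> \<theta> * (real K - J)" using \<theta> J unfolding K_def by (simp add: of_nat_diff)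
    also have "\<dots> \<le> \<theta> * k"
    proof (rule mult_left_mono)
      show "real K - J \<le> k" using k by auto
      have "0 \<le> \<theta> * (real K - J)"
        using \<theta> few of_nat_0_le_iff[of "card (?bd ?B - C)"] J unfolding K_def by (simp add: of_nat_diff)
      moreover have "0 < real K - J" using J unfolding K_def by simp
      ultimately show "0 \<le> \<theta>" by (simp add: zero_le_mult_iff)
    qed
    finally show "k \<in> cheap V E N P \<theta>" using kN unfolding cheap_def by simp
  qed
  then have "card {K - J..K} \<le> card (cheap V E N P \<theta>)" by (intro card_mono) auto
  then show ?thesis using J unfolding K_def by simp
qed

text \<open>Otherwise each step from \<open>R\<close> to \<open>R'\<close> multiplies the ball by
  more than \<open>1 + \<eta>\<close>, and the ball of radius \<open>R'\<close> exceeds half of the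
  nodes. The lower limit \<open>R\<close> keeps the slow ball large.\<close>

lemma slow_ball_exists:
  fixes \<eta> :: real
  assumes x: "x \<in> V" and \<eta>: "0 \<le> \<eta>" and R: "R \<le> R'"
    and half: "2 * card (removal_ball V E C x R') \<le> card V"
    and big: "real (card V) / 2 < (1 + \<eta>) ^ (R' - R)"
  shows "\<exists>r. R \<le> r \<and> r < R' \<and>
    real (card (node_boundary V E (removal_ball V E C x r) - C)) \<le> \<eta> * card (removal_ball V E C x r)"
proof (rule ccontr)
  let ?B = "removal_ball V E C x"
  assume no: "\<not> ?thesis"
  have "(1 + \<eta>) ^ card ({..<R' - R} - {}) \<le> real (card (?B (R + (R' - R))))"
  proof (rule power_le_growing[where a = "\<lambda>r. real (card (?B (R + r)))"])
    fix r assume r: "r < R' - R"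
    then have "\<not> real (card (node_boundary V E (?B (R + r)) - C)) \<le> \<eta> * card (?B (R + r))"
      using no by auto
    then show "(1 + \<eta>) * real (card (?B (R + r))) \<le> real (card (?B (R + Suc r)))"
      unfolding add_Suc_right card_removal_ball_Suc[OF x] by (simp add: algebra_simps)
  next
    have "0 < card (?B R)" using centre_in_removal_ball[of x V E C R] x by (auto simp: card_gt_0_iff)
    then show "1 \<le> real (card (?B (R + 0)))" by simp
  qed (use \<eta> in \<open>auto simp: card_removal_ball_Suc[OF x] simp del: removal_ball.simps(2)\<close>)
  then show False using big half R by simp
qed

end

section \<open>Cylinders around geodesics\<close>

text \<open>For \<open>0 < f\<close>, the nodes whose Gromov product of \<open>p\<close> and \<open>q\<close> is less than \<open>f\<close>, away from \<open>p\<close> and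
  \<open>q\<close>: up to the hyperbolicity constant, a cylinder of radius \<open>f - 1\<close> around the middle of a geodesic.\<close>

definition cylinder :: "'a set \<Rightarrow> 'a set set \<Rightarrow> 'a \<Rightarrow> 'a \<Rightarrow> nat \<Rightarrow> 'a set" where
  "cylinder V E p q f = {v \<in> V. gdist V E p q \<le> 3 * gdist V E p v \<and> gdist V E p q \<le> 3 * gdist V E q v \<and>
     gdist V E p v + gdist V E q v + 2 \<le> gdist V E p q + 2 * f}"

lemma cylinder_subset: "cylinder V E p q f \<subseteq> V"
  by (auto simp: cylinder_def)

text \<open>Radius 0 stands for the plain graph, so a single loop over the radii covers the searches
  with and without removal.\<close>

lemma (in conn_graph) cylinder_0:
  assumes "p \<in> V" "q \<in> V" shows "cylinder V E p q 0 = {}"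
proof -
  have "gd p q \<le> gd p v + gd q v" if "v \<in> V" for v
    using gdist_triangle[OF assms(1) that assms(2)] gdist_sym[OF assms(2) that] by simp
  then show ?thesis unfolding cylinder_def by force
qed

context geodesic
begin

text \<open>\<open>cylinder_near\<close> with \<open>h = f - 1\<close> covers the cylinder by balls
  around the nodes of \<open>G\<close>.\<close>

lemma card_cylinder:
  assumes deg: "\<forall>v\<in>V. node_degree V E v \<le> d" and d: "1 \<le> d" and f: "1 \<le> f"
  shows "card (cylinder V E p q f) \<le> (gd p q + 1) * (2 * d) ^ (f - 1 + 2 * e)"
proof -
  let ?U = "\<Union>m\<in>set G. removal_ball V E {} m (f - 1 + 2 * e)"
  have GV: "set G \<subseteq> V" using shortest_path_nodes[OF G] .
  have "cylinder V E p q f \<subseteq> ?U"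
  proof
    fix v assume "v \<in> cylinder V E p q f"
    then have v: "v \<in> V" "gd p v + gd q v \<le> gd p q + 2 * (f - 1)" using f unfolding cylinder_def by auto
    obtain m where "m \<in> set G" "gd m v \<le> f - 1 + 2 * e" using cylinder_near[OF v] by blast
    then show "v \<in> ?U" using removal_ball_gdist v GV by blast
  qed
  then have "card (cylinder V E p q f) \<le> card ?U"
    by (intro card_mono finite_UN_I) (use GV in auto)
  also have "\<dots> \<le> (\<Sum>m\<in>set G. card (removal_ball V E {} m (f - 1 + 2 * e)))" by (intro card_UN_le) auto
  also have "\<dots> \<le> (\<Sum>m\<in>set G. (2 * d) ^ (f - 1 + 2 * e))"
    using GV by (intro sum_mono card_removal_ball_le[OF deg d]) auto
  also have "\<dots> = card (set G) * (2 * d) ^ (f - 1 + 2 * e)" by simp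
  also have "\<dots> \<le> (gd p q + 1) * (2 * d) ^ (f - 1 + 2 * e)"
    using card_length[of G] shortest_path_length[OF G] by (intro mult_right_mono) auto
  finally show ?thesis .
qed

text \<open>The conditions on \<open>s\<close> and \<open>J\<close> keep the positions used on
  \<open>G\<close> at least \<open>f - 1\<close> away from its outer thirds. A node within
  \<open>f - 1\<close> of such a position is then at least a third of the distance away from
  \<open>p\<close> and from \<open>q\<close>, hence in the cylinder. Intersecting balls would give a
  walk of length at most \<open>2 * r\<close> that is too short for
  \<open>bypass_length\<close>.\<close>

lemma cylinder_bypass:
  assumes s: "gd p q + 3 * (f - 1) \<le> 3 * s"
    and sJ: "3 * (s + J * (3 * e + 2)) + 3 * (f - 1) \<le> 2 * gd p q"
    and k: "e * (k + 3) < f" and r: "2 * r < J * (max 1 e * 2 ^ k)" and pq: "0 < gd p q"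
  shows "removal_ball V E (cylinder V E p q f) p r \<inter> removal_ball V E (cylinder V E p q f) q r = {}"
proof (rule ccontr)
  assume meet: "\<not> ?thesis"
  have "p \<notin> cylinder V E p q f" "q \<notin> cylinder V E p q f" using pq unfolding cylinder_def by auto
  then obtain c l where c: "l \<le> 2 * r" "c 0 = p" "c l = q" "\<forall>i\<le>l. c i \<in> V - cylinder V E p q f"
      "\<forall>i<l. {c i, c (Suc i)} \<in> E"
    using removal_balls_meet[OF p _ q _ meet] by blast
  have "J * (max 1 e * 2 ^ k) \<le> l"
  proof (rule bypass_length[OF _ _ c(2,3) _ _ k])
    show sJ': "s + J * (3 * e + 2) \<le> gd p q"
      by (rule mult_left_le_imp_le[of 2]) (use sJ in linarith, simp)
    fix i t assume i: "i \<le> l" and t: "s \<le> t" "t \<le> s + J * (3 * e + 2)"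
    have v: "c i \<in> V" "c i \<notin> cylinder V E p q f" using c(4) i by auto
    have tl: "t \<le> gd p q" using t sJ' by linarith
    have t3: "3 * t + 3 * (f - 1) \<le> 2 * gd p q"
      using sJ mult_le_mono2[OF t(2), of 3] by (rule order_trans[OF add_right_mono, rotated])
    show "f \<le> gd (G ! t) (c i)"
    proof (rule ccontr)
      assume "\<not> ?thesis"
      then have near: "gd (G ! t) (c i) \<le> f - 1" "gd (c i) (G ! t) \<le> f - 1" "1 \<le> f"
        using gdist_sym[OF v(1) node_G[OF tl]] by auto
      have "gd p (c i) \<le> t + (f - 1)" "gd q (c i) \<le> gd p q - t + (f - 1)"
        "t \<le> gd p (c i) + (f - 1)" "gd p q - t \<le> gd q (c i) + (f - 1)"
        using gdist_triangle[OF p node_G[OF tl] v(1)] gdist_triangle[OF q node_G[OF tl] v(1)]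
         gdist_triangle[OF p v(1) node_G[OF tl]] gdist_triangle[OF q v(1) node_G[OF tl]]
         gdist_G[OF tl] near by linarith+
      then have "c i \<in> cylinder V E p q f" using v(1) s t(1) t3 tl near(3) unfolding cylinder_def by auto
      then show False using v(2) by blast
    qed
  qed (use c in auto)
  then show False using r c(1) by linarith
qed

text \<open>Up to radius \<open>R\<close>, below a third of the distance, the cylinder is not met
  and the shortage of cheap prefixes makes the balls grow. Up to \<open>R'\<close> the balls around
  \<open>p\<close> and \<open>q\<close> are disjoint, so one of them stays below half of the nodes
  and has a slow radius in between. The remaining arithmetic is isolated in \<open>num\<close>,
  where \<open>K\<close> stands for the size of the slow ball.\<close>

lemma cheap_around_cylinder:
  fixes \<eta> \<theta> \<phi> :: real
  assumes deg: "\<forall>v\<in>V. node_degree V E v \<le> d" and d: "1 \<le> d" and f: "1 \<le> f"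
    and s: "gd p q + 3 * (f - 1) \<le> 3 * s"
    and sJ: "3 * (s + J * (3 * e + 2)) + 3 * (f - 1) \<le> 2 * gd p q"
    and k: "e * (k + 3) < f" and R': "2 * R' < J * (max 1 e * 2 ^ k)"
    and R: "3 * R < gd p q" "R \<le> R'"
    and \<eta>: "0 \<le> \<eta>" "real (card V) / 2 < (1 + \<eta>) ^ (R' - R)" and \<phi>: "0 \<le> \<phi>"
    and few: "\<not> (\<exists>x\<in>{p, q}. many_cheap V E (gd p q) {} \<phi> x)"
    and num: "\<And>K :: nat. (1 + \<phi>) ^ (R - gd p q div 64) \<le> K \<Longrightarrow> gd p q div 64 < K \<and>
      \<eta> * K + real ((gd p q + 1) * (2 * d) ^ (f - 1 + 2 * e)) + real (gd p q div 64) \<le>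
      \<theta> * (real K - real (gd p q div 64))"
  shows "\<exists>x\<in>{p, q}. many_cheap V E (gd p q) (cylinder V E p q f) \<theta> x"
proof -
  let ?C = "cylinder V E p q f"
  have pq: "0 < gd p q" using R by linarith
  obtain x where x: "x \<in> {p, q}" and half: "2 * card (removal_ball V E ?C x R') \<le> card V"
    using half_ball[OF p q cylinder_bypass[OF s sJ k R' pq]] by blast
  have xV: "x \<in> V" using x by auto
  obtain z where z: "z \<in> V" "gd x z = gd p q" using x gdist_sym[of p q] by force
  obtain r where r: "R \<le> r" "r < R'"
    "real (card (node_boundary V E (removal_ball V E ?C x r) - ?C)) \<le> \<eta> * card (removal_ball V E ?C x r)"
    using slow_ball_exists[OF xV \<eta>(1) R(2) half \<eta>(2)] by blast
  have same: "removal_ball V E ?C x R = removal_ball V E {} x R"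
    by (rule removal_ball_far[OF xV _ order_refl]) (use R x in \<open>auto simp: cylinder_def\<close>)
  have mono: "card (removal_ball V E ?C x a) \<le> card (removal_ball V E ?C x b)" if "a \<le> b" for a b
    using that xV by (intro card_mono removal_ball_mono) auto
  have half_r: "2 * card (removal_ball V E ?C x r) \<le> card V" using half mono[of r R'] r by linarith
  have half_R: "2 * card (removal_ball V E {} x R) \<le> card V" using half mono[of R R'] R same by simp
  \<comment> \<open>One enumeration with few cheap prefixes is enough: the growth it implies is a
    statement about balls and so serves every enumeration around the cylinder.\<close>
  obtain N P where NP: "ball_chain V E {} x N P" "\<not> gd p q < 64 * card (cheap V E N P \<phi>)"
    using few x unfolding many_cheap_def by blast
  then have "R - gd p q div 64 \<le> R - card (cheap V E N P \<phi>)" by linarith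
  then have "(1 + \<phi>) ^ (R - gd p q div 64) \<le> (1 + \<phi>) ^ (R - card (cheap V E N P \<phi>))"
    using \<phi> by (intro power_increasing) auto
  also have "\<dots> \<le> card (removal_ball V E {} x R)"
    using few_cheap_growth[OF xV NP(1) z(1) _ half_R \<phi>] z(2) R by linarith
  also have "\<dots> \<le> card (removal_ball V E ?C x r)" using mono[of R r] r same by simp
  finally have "(1 + \<phi>) ^ (R - gd p q div 64) \<le> card (removal_ball V E ?C x r)" .
  note num = num[OF this]
  have "real (card ?C) \<le> real ((gd p q + 1) * (2 * d) ^ (f - 1 + 2 * e))"
    using card_cylinder[OF deg d f] by (simp only: of_nat_le_iff)
  then have "\<eta> * card (removal_ball V E ?C x r) + card ?C + real (gd p q div 64) \<le>
      \<theta> * (real (card (removal_ball V E ?C x r)) - real (gd p q div 64))"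
    using num by linarith
  then have "gd p q div 64 < card (cheap V E N P \<theta>)" if "ball_chain V E ?C x N P" for N P
    using cheap_prefixes[OF xV cylinder_subset that half_r r(3)] num by blast
  then show ?thesis unfolding many_cheap_def using x by (intro bexI[OF _ x]) (auto simp: div_less_iff_less_mult mult.commute)
qed

end

section \<open>Estimates for exponentials and powers\<close>

lemma exp_half_le:
  fixes x :: real assumes "0 \<le> x" "x \<le> 2" shows "exp (x / 2) \<le> 1 + x"
proof -
  have "exp (x / 2) \<le> 1 + x / 2 + (x / 2)\<^sup>2" using assms by (intro exp_bound) auto
  also have "\<dots> \<le> 1 + x" using mult_left_mono[OF assms(2,1)] by (simp add: power2_eq_square)
  finally show ?thesis .
qed

text \<open>This is \<open>ln (1 + x) \<ge> x / 2\<close> in exponential form. The range up to 2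
  suffices because expansion bounds of at least 2 are treated directly.\<close>

lemma exp_le_power_1_plus:
  fixes x :: real assumes "0 \<le> x" "x \<le> 2" shows "exp (real m * x / 2) \<le> (1 + x) ^ m"
proof -
  have "exp (real m * x / 2) = exp (x / 2) ^ m" by (simp add: exp_of_nat_mult flip: times_divide_eq_right)
  then show ?thesis using exp_half_le[OF assms] by (simp add: power_mono)
qed

text \<open>The exponential beats the power through \<open>z / k \<le> exp (z / k)\<close>, raised
  to the power \<open>k\<close>, with \<open>z = real D powr \<mu> / 25\<close>.\<close>

lemma powr_domination:
  fixes \<mu> :: real assumes "0 < \<mu>" "\<mu> < 1"
  shows "\<exists>D0 :: nat. \<forall>D\<ge>D0. 1000 \<le> D \<and> 1 \<le> real D powr \<mu> \<and> 100 * real D powr \<mu> \<le> D \<and>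
     6 * real D ^ 2 \<le> exp (real D powr \<mu> / 25)"
proof -
  \<comment> \<open>With \<open>3 / \<mu> \<le> k\<close> the \<open>k\<close>-th power of
    \<open>real D powr \<mu>\<close> is at least \<open>D ^ 3\<close>. Two factors \<open>D\<close>
    are needed for the claim; the third absorbs \<open>6 * (25 * k) ^ k\<close>, a summand of
    \<open>D0\<close>.\<close>
  define k where "k = nat \<lceil>3 / \<mu>\<rceil>"
  define D0 where "D0 = 1000 + nat \<lceil>100 powr (1 / (1 - \<mu>))\<rceil> + 6 * (25 * k) ^ k"
  have k: "3 / \<mu> \<le> k" "0 < k" using assms unfolding k_def by (auto simp: real_nat_ceiling_ge)
  show ?thesis
  proof (intro exI[of _ D0] allI impI conjI)
    fix D assume D: "D0 \<le> D"
    then show D1: "1000 \<le> D" unfolding D0_def by simp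
    show "1 \<le> real D powr \<mu>" using D1 assms by (intro ge_one_powr_ge_zero) auto
    have "100 powr (1 / (1 - \<mu>)) \<le> D" using D unfolding D0_def by linarith
    then have "(100 powr (1 / (1 - \<mu>))) powr (1 - \<mu>) \<le> real D powr (1 - \<mu>)"
      using assms by (intro powr_mono2) auto
    then have "100 \<le> real D powr (1 - \<mu>)" using assms by (simp add: powr_powr)
    then have "100 * real D powr \<mu> \<le> real D powr (1 - \<mu>) * real D powr \<mu>"
      by (intro mult_right_mono) auto
    then show "100 * real D powr \<mu> \<le> D" using D1 by (simp flip: powr_add)
    have "real (6 * (25 * k) ^ k) \<le> real D" using D unfolding D0_def of_nat_le_iff by linarith
    then have big: "6 * (25 * real k) ^ k \<le> D" by simp
    have "6 * real D ^ 2 * (25 * real k) ^ k \<le> real D * real D ^ 2"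
      using mult_right_mono[OF big, of "real D ^ 2"] by (simp add: mult_ac)
    also have "\<dots> = real D powr 3" using D1 by (simp add: powr_numeral power_numeral_reduce)
    also have "\<dots> \<le> real D powr (\<mu> * k)"
      using D1 k(1) assms by (intro powr_mono) (auto simp: field_simps)
    also have "\<dots> = (real D powr \<mu>) ^ k" using D1 by (simp add: powr_realpow flip: powr_powr)
    finally have "6 * real D ^ 2 \<le> (real D powr \<mu>) ^ k / (25 * real k) ^ k"
      using k(2) by (simp add: field_simps)
    also have "\<dots> = (real D powr \<mu> / 25 / k) ^ k" by (simp add: power_divide power_mult_distrib)
    also have "\<dots> \<le> exp (real D powr \<mu> / 25 / k) ^ k"
      by (intro power_mono) (use exp_ge_add_one_self[of "real D powr \<mu> / 25 / k"] in linarith, simp)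
    also have "\<dots> = exp (real D powr \<mu> / 25)" using k(2) by (simp flip: exp_of_nat_mult)
    finally show "6 * real D ^ 2 \<le> exp (real D powr \<mu> / 25)" .
  qed
qed

text \<open>Turns the exponent \<open>11 / 70\<close> to base 2 of the cylinder size into the
  exponent \<open>0.11\<close> to base e.\<close>

lemma ln_2_le: "ln 2 \<le> (0.7 :: real)"
proof -
  have "(2 :: real) \<le> 1.19 ^ 4" by (simp add: power_divide)
  also have "\<dots> \<le> exp 0.175 ^ 4"
    using exp_lower_Taylor_quadratic[of "0.175 :: real"] by (intro power_mono) (auto simp: power2_eq_square)
  also have "\<dots> = exp (0.7 :: real)" by (simp flip: exp_of_nat_mult)
  finally have "ln 2 \<le> ln (exp (0.7 :: real))" by (subst ln_le_cancel_iff) auto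
  then show ?thesis by simp
qed

section \<open>Choice of the radii and verification of the constants\<close>

context conn_graph
begin

lemma cheap_mono:
  assumes "\<theta> \<le> \<theta>'" shows "card (cheap V E N P \<theta>) \<le> card (cheap V E N P \<theta>')"
proof (rule card_mono)
  have "\<theta> * real k \<le> \<theta>' * real k" for k :: nat using assms by (intro mult_right_mono) auto
  then show "cheap V E N P \<theta> \<subseteq> cheap V E N P \<theta>'" unfolding cheap_def by (auto intro: order_trans)
qed simp

lemma many_cheap_mono: "\<theta> \<le> \<theta>' \<Longrightarrow> many_cheap V E D C \<theta> x \<Longrightarrow> many_cheap V E D C \<theta>' x"
  unfolding many_cheap_def using cheap_mono by (meson mult_le_mono2 order_less_le_trans)

text \<open>The factor 28 in \<open>x\<close> is 4 times 7. The radius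
  \<open>y / (7 * log 2 (2 * d)) = 4 * x * \<delta>\<close> keeps the cylinder small and lengthens a
  bypass by a factor of about \<open>2 powr (4 * x)\<close>. The surplus
  \<open>2 powr (3 * x)\<close> pays for the constants, and \<open>2 powr x\<close> remains for
  \<open>\<eta>\<close>.\<close>

lemma cheap_cylinder:
  fixes \<delta> x y \<eta> :: real and d :: nat and p q :: 'a
  defines "D \<equiv> gd p q"
  assumes p: "p \<in> V" and q: "q \<in> V" and hyp: "hyperbolic V E \<delta>" and \<delta>: "0 < \<delta>"
    and deg: "\<forall>v\<in>V. node_degree V E v \<le> d" and d: "3 \<le> d"
    and D: "1000 \<le> D" and y: "1 \<le> y" "100 * y \<le> D" "6 * real D ^ 2 \<le> exp (y / 25)"
    and x: "x = y / (28 * \<delta> * log 2 (2 * real d))" "5 < x"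
    and \<eta>: "\<eta> = 250 * ln (real (card V)) / (D * 2 powr x)" "\<eta> \<le> 1"
  shows "\<exists>f<card V. \<exists>x\<in>{p, q}. many_cheap V E D (cylinder V E p q f) (max (y / D) (2 * \<eta>)) x"
proof (cases "\<exists>x\<in>{p, q}. many_cheap V E D {} (y / D) x")
  case True
  then have "\<exists>x\<in>{p, q}. many_cheap V E D (cylinder V E p q 0) (max (y / D) (2 * \<eta>)) x"
    unfolding cylinder_0[OF p q] using many_cheap_mono[OF max.cobounded1] by blast
  moreover have "0 < card V" using gdist_less_card[OF p q] by simp
  ultimately show ?thesis by blast
next
  case False
  obtain G where G: "shortest_path V E p q G" using shortest_path_exists p q by blast
  define e where "e = nat \<lfloor>\<delta>\<rfloor>"
  interpret geodesic V E p q G e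
    by unfold_locales (use hyperbolic_floor[OF hyp] G in \<open>auto simp: e_def\<close>)
  have nD: "D < card V" using gdist_less_card[OF p q] unfolding D_def .
  define lg where "lg = log 2 (2 * real d)"
  have lg: "1 \<le> lg" using d unfolding lg_def by (subst le_log_iff) auto
  have y_eq: "y = 28 * x * \<delta> * lg" using x(1) lg \<delta> unfolding lg_def[symmetric] by (simp add: field_simps)
  \<comment> \<open>At this radius \<open>(2 * d) ^ (f - 1)\<close> is at most
    \<open>2 powr (y / 7)\<close>. Rounding up is harmless since only \<open>f - 1\<close> enters
    the size of the cylinder.\<close>
  define f where "f = nat \<lceil>y / (7 * lg)\<rceil>"
  have f_ge: "4 * x * \<delta> \<le> f"
  proof -
    have "y / (7 * lg) = 4 * x * \<delta>" using y_eq lg by (simp add: field_simps)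
    then show ?thesis unfolding f_def using real_nat_ceiling_ge[of "y / (7 * lg)"] by simp
  qed
  have f1: "1 \<le> f"
  proof -
    have "0 < 4 * x * \<delta>" using x(2) \<delta> by simp
    then show ?thesis using f_ge by linarith
  qed
  have f_le: "real (f - 1) \<le> y / (7 * lg)" using f1 y(1) lg unfolding f_def by linarith
  have f7: "real (f - 1) \<le> y / 7"
    using f_le frac_le[of y y 7 "7 * lg"] lg y(1) by simp
  have e: "real e \<le> \<delta>" using \<delta> unfolding e_def by simp
  \<comment> \<open>From \<open>5 < x\<close>, \<open>y\<close> is more than
    \<open>140 * \<delta> * lg\<close>, so the \<open>2 * e\<close> in the radius of the covering
    balls adds only \<open>y / 70\<close> to the exponent.\<close>
  have e140: "real e * lg \<le> y / 140"
  proof -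
    have "real e * lg \<le> \<delta> * lg" using e lg by (intro mult_right_mono) auto
    moreover have "140 * (\<delta> * lg) \<le> 28 * x * \<delta> * lg" using x(2) \<delta> lg by (simp add: mult_right_mono)
    ultimately show ?thesis using y_eq by simp
  qed
  have e_small: "real e \<le> y / 140" using e140 mult_left_mono[OF lg, of "real e"] by simp
  define b where "b = max 1 e"
  \<comment> \<open>A quarter of the geodesic, less than the middle third, leaves room for the
    margin \<open>f\<close> at both ends.\<close>
  define J where "J = (D div 4) div (3 * e + 2)"
  define s where "s = D div 3 + f"
  \<comment> \<open>Rounding up and subtracting 4 gives \<open>k + 3 < 4 * x\<close>, which keeps
    \<open>e * (k + 3)\<close> below \<open>f\<close>, and loses at most a factor 16 of
    \<open>2 powr (4 * x)\<close>.\<close>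
  define k where "k = nat \<lceil>4 * x\<rceil> - 4"
  have k: "4 * x - 4 \<le> k" "real k + 3 < 4 * x" using x(2) unfolding k_def by linarith+
  define L where "L = J * (b * 2 ^ k)"
  define R' where "R' = (L - 1) div 2"
  define R where "R = (D - 1) div 3"
  have Jw: "J * (3 * e + 2) \<le> D div 4" unfolding J_def by (rule div_times_less_eq_dividend)
  have Jb: "real D / 25 \<le> J * b"
  proof -
    have "D div 4 < J * (3 * e + 2) + (3 * e + 2)"
      using div_mult_mod_eq[of "D div 4" "3 * e + 2"] mod_less_divisor[of "3 * e + 2" "D div 4"]
      unfolding J_def by linarith
    also have "J * (3 * e + 2) \<le> J * (5 * b)" unfolding b_def by (intro mult_le_mono2) auto
    finally have "D div 4 < 5 * (J * b) + (3 * e + 2)" by simp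
    then have "real D / 4 \<le> 5 * real (J * b) + 3 * e + 3" by linarith
    then show ?thesis using e_small y(2) D by simp
  qed
  \<comment> \<open>Since \<open>3 * x - 4\<close> exceeds 11, at least
    \<open>2000 / 25 = 80\<close> remains beside \<open>2 powr x\<close>; 25 is the loss from
    \<open>Jb\<close>.\<close>
  have L: "real D * 2 powr x * 80 \<le> L"
  proof -
    have "2 powr 11 \<le> 2 powr (3 * x - 4)" using x(2) by (intro powr_mono) auto
    then have "2000 * 2 powr x \<le> 2 powr (3 * x - 4) * 2 powr x"
      by (intro mult_right_mono) (simp_all add: powr_numeral)
    also have "\<dots> = 2 powr (4 * x - 4)" by (simp flip: powr_add)
    also have "\<dots> \<le> 2 powr k" using k(1) by (intro powr_mono) auto
    also have "\<dots> = 2 ^ k" by (simp add: powr_realpow)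
    finally have "real D / 25 * (2000 * 2 powr x) \<le> real (J * b) * 2 ^ k"
      using Jb by (intro mult_mono) auto
    then show ?thesis unfolding L_def by (simp add: mult_ac)
  qed
  have x32: "32 \<le> 2 powr x" using powr_mono[of 5 x 2] x(2) by (simp add: powr_numeral)
  have D32: "real D * 32 \<le> real D * 2 powr x" using x32 by (intro mult_left_mono) auto
  have LD: "2560 * real D \<le> L" using L D32 by linarith
  have R'_R: "real D * 2 powr x / 125 \<le> real (R' - R)"
  proof -
    have "real L / 2 - 1 \<le> R'" using LD D unfolding R'_def by linarith
    moreover have "real R \<le> D" unfolding R_def by linarith
    ultimately have "real D * 2 powr x * 40 - 1 - D \<le> real R' - real R" using L by linarith
    then show ?thesis using D32 D by linarith
  qed
  have RR': "R \<le> R'" using R'_R D32 D by linarith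
  have M: "0.3 * real D \<le> real (R - D div 64)" using D unfolding R_def by linarith
  have n: "ln (real (card V)) > 0" "real (card V) > 0" using nD D by auto
  have \<eta>0: "0 \<le> \<eta>" using \<eta>(1) n by simp
  have yD: "y / D \<le> 1 / 100" "0 \<le> y / D" "1 / D \<le> y / D" using y D by (auto simp: field_simps)
  have "\<exists>x\<in>{p, q}. many_cheap V E (gd p q) (cylinder V E p q f) (max (y / D) (2 * \<eta>)) x"
  proof (rule cheap_around_cylinder[OF deg _ f1, of s J k R' R \<eta> "y / D"])
    show "1 \<le> d" using d by simp
    show "gd p q + 3 * (f - 1) \<le> 3 * s"
    proof -
      have "D < 3 * (D div 3) + 3" by presburger
      then show ?thesis unfolding s_def D_def[symmetric] using f1 by simp
    qed
    have "real (f - 1) \<le> D / 700" using f7 y(2) by linarith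
    then show "3 * (s + J * (3 * e + 2)) + 3 * (f - 1) \<le> 2 * gd p q"
      using Jw f1 D unfolding s_def D_def[symmetric] distrib_left[of 3] by linarith
    show "e * (k + 3) < f"
    proof (cases "e = 0")
      case False
      then have "real e * (real k + 3) < real e * (4 * x)" using k(2) by (intro mult_strict_left_mono) auto
      also have "\<dots> \<le> \<delta> * (4 * x)" using e x(2) by (intro mult_right_mono) auto
      also have "\<dots> \<le> f" using f_ge by (simp add: mult_ac)
      finally have "real (e * (k + 3)) < real f" by simp
      then show ?thesis by (simp only: of_nat_less_iff)
    qed (use f1 in simp)
    show "2 * R' < J * (max 1 e * 2 ^ k)"
      using LD D unfolding b_def[symmetric] L_def[symmetric] R'_def by linarith
    show "3 * R < gd p q" using D unfolding R_def D_def[symmetric] by linarith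
    show "real (card V) / 2 < (1 + \<eta>) ^ (R' - R)"
    proof -
      \<comment> \<open>The constant 250 in \<open>\<eta>\<close> comes from
        \<open>250 / 125 / 2 = 1\<close>; it is half of 500 because the final bound is
        \<open>2 * \<eta>\<close>.\<close>
      have "ln (real (card V)) = real D * 2 powr x / 125 * \<eta> / 2" using D unfolding \<eta>(1) by simp
      also have "\<dots> \<le> real (R' - R) * \<eta> / 2" using mult_right_mono[OF R'_R \<eta>0] by (simp add: mult_ac)
      finally have "exp (ln (real (card V))) \<le> exp (real (R' - R) * \<eta> / 2)" by simp
      also have "\<dots> \<le> (1 + \<eta>) ^ (R' - R)" using \<eta>(2) \<eta>0 by (intro exp_le_power_1_plus) auto
      finally show ?thesis using n by simp
    qed
    show "\<not> (\<exists>x\<in>{p, q}. many_cheap V E (gd p q) {} (y / D) x)"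
      using False unfolding D_def .
    fix K :: nat assume K: "(1 + y / D) ^ (R - gd p q div 64) \<le> K"
    \<comment> \<open>At least \<open>0.3 * D\<close> radii remain after discounting
      \<open>D div 64\<close> cheap ones, each worth \<open>exp (y / D / 2)\<close>.\<close>
    have "exp (0.15 * y) \<le> exp (real (R - D div 64) * (y / D) / 2)"
      using mult_right_mono[OF M yD(2)] D by (simp add: mult_ac)
    also have "\<dots> \<le> (1 + y / D) ^ (R - D div 64)" using yD(1,2) by (intro exp_le_power_1_plus) linarith+
    finally have K15: "exp (0.15 * y) \<le> K" using K unfolding D_def by linarith
    define c where "c = real ((D + 1) * (2 * d) ^ (f - 1 + 2 * e))"
    have "c \<le> (real D + 1) * exp (0.11 * y)"
    proof -
      have "real ((2 * d) ^ (f - 1 + 2 * e)) = (2 powr lg) ^ (f - 1 + 2 * e)"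
        using d unfolding lg_def by simp
      also have "\<dots> = 2 powr (lg * real (f - 1 + 2 * e))"
        unfolding powr_powr[symmetric] by (rule powr_realpow[symmetric]) simp
      also have "\<dots> = exp (lg * real (f - 1 + 2 * e) * ln 2)" by (simp add: powr_def)
      also have "\<dots> \<le> exp (0.11 * y)"
      proof -
        \<comment> \<open>The shares of \<open>f - 1\<close> and of \<open>2 * e\<close> in the
          exponent are \<open>1 / 7\<close> and \<open>1 / 70\<close>, together
          \<open>11 / 70\<close>.\<close>
        have "lg * real (f - 1) \<le> y / 7" using f_le lg by (simp add: field_simps)
        then have "lg * real (f - 1 + 2 * e) \<le> 11 * y / 70" using e140 by (simp add: algebra_simps)
        moreover have "0 \<le> lg * real (f - 1 + 2 * e)" using lg by simp
        moreover have "ln 2 \<le> (0.7 :: real)" by (rule ln_2_le)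
        ultimately have "lg * real (f - 1 + 2 * e) * ln 2 \<le> 11 * y / 70 * 0.7"
          using y(1) by (intro mult_mono) auto
        then show ?thesis by simp
      qed
      finally show ?thesis unfolding c_def of_nat_mult[of "D + 1"] of_nat_add of_nat_1
        by (rule mult_left_mono) simp
    qed
    moreover have one: "1 \<le> exp (0.11 * y)" using y(1) by simp
    moreover have "real (D div 64) \<le> real D / 64 * exp (0.11 * y)"
      using mult_left_mono[OF one, of "real D / 64"] by simp
    ultimately have "c + 3 * real (D div 64) \<le> (real D + 1 + 3 * (real D / 64)) * exp (0.11 * y)"
      by (simp add: algebra_simps)
    also have "\<dots> \<le> 3 * real D * exp (0.11 * y)" using D by (intro mult_right_mono) auto
    finally have "2 * real D * (c + 3 * real (D div 64)) \<le> 2 * real D * (3 * real D * exp (0.11 * y))"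
      by (intro mult_left_mono) auto
    also have "\<dots> = 6 * real D ^ 2 * exp (0.11 * y)" by (simp add: power2_eq_square)
    \<comment> \<open>The gap \<open>0.15 - 0.11 = 1 / 25\<close> between the exponents absorbs the
      factor \<open>6 * D ^ 2\<close>.\<close>
    also have "\<dots> \<le> exp (y / 25) * exp (0.11 * y)" using y(3) by (intro mult_right_mono) auto
    also have "\<dots> = exp (0.15 * y)" by (simp flip: exp_add)
    finally have cK: "2 * real D * (c + 3 * real (D div 64)) \<le> K" using K15 by simp
    define \<theta> where "\<theta> = max (y / D) (2 * \<eta>)"
    have \<theta>: "1 / D \<le> \<theta>" "2 * \<eta> \<le> \<theta>" "\<theta> \<le> 2" using yD \<eta>(2) unfolding \<theta>_def by linarith+
    \<comment> \<open>One half of \<open>\<theta> * K\<close> pays for \<open>\<eta> * K\<close>,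
      the other half for the cylinder and the deleted nodes. The coefficient 3 is 1 for the deleted
      nodes in the boundary plus \<open>\<theta> \<le> 2\<close> for the reduced size of the
      prefix.\<close>
    have "c + 3 * real (D div 64) \<le> K / 2 * (1 / D)" using cK D by (simp add: field_simps)
    also have "\<dots> \<le> K / 2 * \<theta>" using \<theta>(1) by (intro mult_left_mono) auto
    finally have 1: "c + 3 * real (D div 64) \<le> \<theta> * K / 2" by (simp add: mult_ac)
    have 2: "\<eta> * K \<le> \<theta> * K / 2" using mult_right_mono[OF \<theta>(2), of "real K"] by simp
    have 3: "\<theta> * real (D div 64) \<le> 2 * real (D div 64)" using \<theta>(3) by (intro mult_right_mono) auto
    have "\<eta> * K + c + real (D div 64) \<le> \<theta> * (real K - real (D div 64))"
      using 1 2 3 by (simp add: algebra_simps)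
    moreover have "D div 64 < K"
    proof -
      have "0 < (D + 1) * (2 * d) ^ (f - 1 + 2 * e)" using d by (intro mult_pos_pos zero_less_power) auto
      then have "1 \<le> (D + 1) * (2 * d) ^ (f - 1 + 2 * e)" by linarith
      then have "1 \<le> c" unfolding c_def by (metis of_nat_1 of_nat_le_iff)
      then have "2 * real D * 1 \<le> 2 * real D * (c + 3 * real (D div 64))" by (intro mult_left_mono) auto
      then have "2 * real D \<le> K" using cK by simp
      then show ?thesis using D by linarith
    qed
    ultimately show "gd p q div 64 < K \<and>
      \<eta> * K + real ((gd p q + 1) * (2 * d) ^ (f - 1 + 2 * e)) + real (gd p q div 64) \<le>
      max (y / D) (2 * \<eta>) * (real K - real (gd p q div 64))"
      unfolding c_def \<theta>_def D_def by blast
  qed (use RR' \<eta>0 yD in auto)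
  moreover have "f < card V" using f7 y(2) nD f1 D by linarith
  ultimately show ?thesis unfolding D_def by blast
qed

lemma cheap_balls_ln:
  assumes p: "p \<in> V" and q: "q \<in> V" and D: "1000 \<le> gd p q"
    and a: "a = 8 * ln (real (card V) / 2) / gd p q" "a \<le> 2"
  shows "\<exists>x\<in>{p, q}. many_cheap V E (gd p q) {} a x"
proof (rule cheap_balls[OF p q])
  let ?D = "gd p q" and ?n = "real (card V) / 2"
  have n: "1 < ?n" using gdist_less_card[OF p q] D by linarith
  then have lnn: "0 < ln ?n" by simp
  show a0: "0 \<le> a" using lnn a(1) by simp
  define M where "M = (?D - 1) div 2 - ?D div 64"
  \<comment> \<open>Half of the distance minus a 64th is more than \<open>0.4 * D\<close>, and
    \<open>0.4 * 8 / 2 = 1.6\<close> exceeds 1; this is what the constant 8 has to achieve.\<close>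
  have M: "0.4 * real ?D \<le> M" using D unfolding M_def by linarith
  have "ln ?n < 1.6 * ln ?n" using lnn by simp
  also have "\<dots> = 0.4 * real ?D * a / 2" using D unfolding a(1) by simp
  also have "\<dots> \<le> real M * a / 2" using mult_right_mono[OF M a0] by (simp add: mult_ac)
  finally have "exp (ln ?n) < exp (real M * a / 2)" by simp
  also have "\<dots> \<le> (1 + a) ^ M" using a0 a(2) by (intro exp_le_power_1_plus) auto
  finally show "?n < (1 + a) ^ ((?D - 1) div 2 - ?D div 64)" using n unfolding M_def by simp
qed (use D in simp)

end

section \<open>The expansion bound at every distance of the two nodes\<close>

definition expansion_bound :: "real \<Rightarrow> nat \<Rightarrow> real \<Rightarrow> nat \<Rightarrow> nat \<Rightarrow> real" where
  "expansion_bound \<mu> d \<delta> n D = min (8 * ln (real n / 2) / real D)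
     (max ((1 / real D) powr (1 - \<mu>))
       (500 * ln (real n) / (real D * 2 powr (real D powr \<mu> / (28 * \<delta> * log 2 (2 * real d))))))"

lemma cheap_family_exists:
  fixes \<mu> \<delta>0 :: real
  assumes \<mu>: "0 < \<mu>" "\<mu> < 1" and \<delta>0: "0 < \<delta>0"
  shows "\<exists>n0. \<forall>(V :: 'a set) E d \<delta> p q. conn_graph V E \<and> n0 \<le> card V \<and> d > 2 \<and> (\<forall>v\<in>V. node_degree V E v \<le> d) \<and>
    \<delta> \<ge> \<delta>0 \<and> hyperbolic V E \<delta> \<and> p \<in> V \<and> q \<in> V \<and> 0 < gdist V E p q \<longrightarrow>
    (\<exists>f<card V. \<exists>x\<in>{p, q}. many_cheap V E (gdist V E p q) (cylinder V E p q f)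
      (expansion_bound \<mu> d \<delta> (card V) (gdist V E p q)) x)"
proof -
  obtain D0 :: nat where D0: "\<And>D. D0 \<le> D \<Longrightarrow> 1000 \<le> D \<and> 1 \<le> real D powr \<mu> \<and> 100 * real D powr \<mu> \<le> D \<and>
     6 * real D ^ 2 \<le> exp (real D powr \<mu> / 25)"
    using powr_domination[OF \<mu>] by blast
  \<comment> \<open>\<open>X\<close> bounds the exponent \<open>x\<close> for all distances below
    \<open>D0\<close> by means of \<open>\<delta>0\<close>. The exponentials in \<open>n0\<close>
    then make \<open>a\<close> and \<open>b2\<close> at least 2 at these distances, contradicting
    \<open>\<theta> < 2\<close>.\<close>
  define X where "X = real D0 powr \<mu> / (28 * \<delta>0)"
  define n0 where "n0 = 4 + nat \<lceil>2 * exp (real D0)\<rceil> + nat \<lceil>exp (real D0 * 2 powr X)\<rceil>"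
  show ?thesis
  proof (rule exI[of _ n0], intro allI impI, elim conjE, goal_cases)
    case (1 V E d \<delta> p q)
    note n = 1(2) and d = 1(3) and deg = 1(4) and \<delta> = 1(5) and hyp = 1(6) and p = 1(7) and q = 1(8) and pq = 1(9)
    interpret conn_graph V E by (rule 1(1))
    define D where "D = gd p q"
    define a where "a = 8 * ln (real (card V) / 2) / real D"
    define x where "x = real D powr \<mu> / (28 * \<delta> * log 2 (2 * real d))"
    define b2 where "b2 = 500 * ln (real (card V)) / (real D * 2 powr x)"
    define \<theta> where "\<theta> = expansion_bound \<mu> d \<delta> (card V) D"
    have \<theta>_eq: "\<theta> = min a (max ((1 / real D) powr (1 - \<mu>)) b2)"
      unfolding \<theta>_def expansion_bound_def a_def b2_def x_def ..
    have D: "0 < D" "D < card V" using pq gdist_less_card[OF p q] unfolding D_def by auto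
    have n2: "2 \<le> card V" "2 \<le> real (card V)" "0 < card V" using n unfolding n0_def by auto
    have lg: "1 \<le> log 2 (2 * real d)" using d by (subst le_log_iff) auto
    have \<delta>': "0 < \<delta>" using \<delta> \<delta>0 by simp
    have "\<exists>f<card V. \<exists>x\<in>{p, q}. many_cheap V E D (cylinder V E p q f) \<theta> x" (is ?concl)
    proof -
      have by0: ?concl if "\<exists>x\<in>{p, q}. many_cheap V E D {} \<theta> x"
        using that n2(3) cylinder_0[OF p q] by (intro exI[of _ 0]) simp
      consider "2 \<le> \<theta>" | "\<theta> < 2" "D < D0" | "\<theta> < 2" "D0 \<le> D" by linarith
      then show ?concl
      proof cases
        case 1
        then show ?concl using cheap_if_ge_2[OF p _ _ n2(1)] D(2)
          by (intro by0 bexI[of _ p]) (auto simp: many_cheap_def intro: less_trans)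
      next
        case 2
        have e1: "exp (real D0) \<le> real (card V) / 2" "exp (real D0 * 2 powr X) \<le> real (card V)"
          using n unfolding n0_def by linarith+
        have l1: "real D0 \<le> ln (real (card V) / 2)" "real D0 * 2 powr X \<le> ln (real (card V))"
          using e1 n2 by (auto simp: ln_ge_iff)
        have "2 * real D \<le> 8 * ln (real (card V) / 2)" using l1(1) 2 by linarith
        then have a2: "2 \<le> a" using D(1) unfolding a_def by (simp add: field_simps)
        have "x \<le> X" unfolding x_def X_def
        proof (rule frac_le)
          show "real D powr \<mu> \<le> real D0 powr \<mu>" using 2 \<mu> by (intro powr_mono2) auto
          show "28 * \<delta>0 \<le> 28 * \<delta> * log 2 (2 * real d)" using \<delta> \<delta>' lg mult_mono[of \<delta>0 \<delta> 1 "log 2 (2 * real d)"] by simp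
        qed (use \<delta>0 in auto)
        then have "real D * 2 powr x \<le> real D0 * 2 powr X" using 2 by (intro mult_mono powr_mono) auto
        then have "2 * (real D * 2 powr x) \<le> 500 * ln (real (card V))" using l1(2) ln_ge_zero[of "real (card V)"] n2(2) by linarith
        then have "2 \<le> b2" using D(1) unfolding b2_def by (simp add: field_simps)
        then show ?concl using a2 2(1) unfolding \<theta>_eq by linarith
      next
        case 3
        note DD = D0[OF 3(2)]
        define y where "y = real D powr \<mu>"
        have yD: "y / D = (1 / real D) powr (1 - \<mu>)"
          using D(1) unfolding y_def by (simp add: powr_diff powr_divide field_simps)
        have by_a: ?concl if "\<theta> = a"
        proof (rule by0)
          have "a \<le> 2" using that 3 by simp
          then show "\<exists>x\<in>{p, q}. many_cheap V E D {} \<theta> x"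
            using cheap_balls_ln[OF p q _ a_def[unfolded D_def]] DD unfolding that D_def by blast
        qed
        have lnn: "0 \<le> ln (real (card V) / 2)" "ln (real (card V) / 2) \<le> ln (real (card V))" using n2(2) by auto
        show ?concl
        proof (cases "x \<le> 5")
          case True
          have "2 powr x \<le> 2 powr 5" using True by (intro powr_mono) auto
          then have x32: "2 powr x \<le> 32" by (simp add: powr_numeral)
          \<comment> \<open>Because \<open>8 * 32 \<le> 500\<close>, the last term is at least the
            first for \<open>x \<le> 5\<close>, and the minimum is \<open>a\<close>.\<close>
          have "8 * ln (real (card V) / 2) * 2 powr x \<le> 8 * ln (real (card V)) * 32"
            using lnn x32 by (intro mult_mono) auto
          also have "\<dots> \<le> 500 * ln (real (card V))" using lnn by simp
          finally have "a \<le> b2" using D(1) unfolding a_def b2_def by (simp add: field_simps)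
          then show ?concl using by_a \<theta>_eq by simp
        next
          case False
          show ?concl
          proof (cases "\<theta> = a")
            case False
            then have \<theta>b: "\<theta> = max (y / D) b2" unfolding \<theta>_eq yD by linarith
            define \<eta> where "\<eta> = 250 * ln (real (card V)) / (D * 2 powr x)"
            have b2: "b2 = 2 * \<eta>" unfolding b2_def \<eta>_def by simp
            then have "\<eta> \<le> 1" using \<theta>b 3 by simp
            then show ?concl
              using cheap_cylinder[OF p q hyp \<delta>' deg, of y x \<eta>] DD d \<open>\<not> x \<le> 5\<close>
              unfolding \<theta>b b2 D_def[symmetric] y_def[symmetric] x_def \<eta>_def by simp
          qed (rule by_a)
        qed
      qed
    qed
    then show ?case unfolding \<theta>_def D_def .
  qed
qed

section \<open>Running times of programs\<close>

text \<open>Total correctness with a time budget. The equations below are simplification rules, so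
  straight-line code is verified by rewriting; general sequences and loops have introduction
  rules.\<close>

definition runs :: "nat \<Rightarrow> com \<Rightarrow> state \<Rightarrow> nat \<Rightarrow> (state \<Rightarrow> bool) \<Rightarrow> bool" where
  "runs W c s T Q \<longleftrightarrow> (\<exists>T' s'. exec W c s T' s' \<and> T' \<le> T \<and> Q s')"

inductive_cases exec_SkipE: "exec W Skip s T s'"
inductive_cases exec_AssignE: "exec W (Assign x e) s T s'"
inductive_cases exec_WriteE: "exec W (Write a i e) s T s'"
inductive_cases exec_SeqE: "exec W (Seq c1 c2) s T s'"
inductive_cases exec_CondE: "exec W (Cond b c1 c2) s T s'"

lemma exec_Skip_iff: "exec W Skip s T s' \<longleftrightarrow> T = 1 \<and> s' = s"
  by (auto elim: exec_SkipE intro: exec.Skip[unfolded One_nat_def])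

lemma exec_Assign_iff: "exec W (Assign x e) s T s' \<longleftrightarrow>
    T = 1 \<and> aval e s < W \<and> s' = s\<lparr>vars := (vars s)(x := aval e s)\<rparr>"
  by (auto elim: exec_AssignE intro: exec.Assign[unfolded One_nat_def])

lemma exec_Write_iff: "exec W (Write a i e) s T s' \<longleftrightarrow> T = 1 \<and> aval i s < W \<and> aval e s < W \<and>
    s' = s\<lparr>arrs := (arrs s)(a := (arrs s a)(aval i s := aval e s))\<rparr>"
  by (auto elim: exec_WriteE intro: exec.Write[unfolded One_nat_def])

lemma exec_Cond_iff: "exec W (Cond b c1 c2) s T s' \<longleftrightarrow>
    (\<exists>T'. T = T' + 1 \<and> exec W (if bval b s then c1 else c2) s T' s')"
  by (auto elim!: exec_CondE intro: exec.CondTrue[unfolded Suc_eq_plus1[symmetric]]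
      exec.CondFalse[unfolded Suc_eq_plus1[symmetric]] split: if_splits)

lemma runs_Skip [simp]: "runs W Skip s T Q \<longleftrightarrow> 1 \<le> T \<and> Q s"
  unfolding runs_def exec_Skip_iff by auto

lemma runs_Assign [simp]: "runs W (Assign x e) s T Q \<longleftrightarrow>
    1 \<le> T \<and> aval e s < W \<and> Q (s\<lparr>vars := (vars s)(x := aval e s)\<rparr>)"
  unfolding runs_def exec_Assign_iff by auto

lemma runs_Write [simp]: "runs W (Write a i e) s T Q \<longleftrightarrow> 1 \<le> T \<and> aval i s < W \<and> aval e s < W \<and>
    Q (s\<lparr>arrs := (arrs s)(a := (arrs s a)(aval i s := aval e s))\<rparr>)"
  unfolding runs_def exec_Write_iff by auto

lemma runs_Cond [simp]: "runs W (Cond b c1 c2) s T Q \<longleftrightarrow>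
    1 \<le> T \<and> (if bval b s then runs W c1 s (T - 1) Q else runs W c2 s (T - 1) Q)"
proof -
  have "runs W (Cond b c1 c2) s T Q \<longleftrightarrow> 1 \<le> T \<and> runs W (if bval b s then c1 else c2) s (T - 1) Q"
    unfolding runs_def exec_Cond_iff by (cases T) auto
  then show ?thesis by simp
qed

lemma runs_mono: "runs W c s T Q \<Longrightarrow> T \<le> T' \<Longrightarrow> runs W c s T' Q"
  unfolding runs_def by (blast intro: order_trans)

lemma runs_Seq_iff: "runs W (Seq c1 c2) s T Q \<longleftrightarrow>
    (\<exists>T1 s1. exec W c1 s T1 s1 \<and> T1 \<le> T \<and> runs W c2 s1 (T - T1) Q)" (is "?L \<longleftrightarrow> ?R")
proof
  assume ?L
  then obtain T1 T2 s1 s2 where "exec W c1 s T1 s1" "exec W c2 s1 T2 s2" "T1 + T2 \<le> T" "Q s2"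
    unfolding runs_def by (auto elim!: exec_SeqE)
  then show ?R unfolding runs_def
    by (intro exI[of _ T1] exI[of _ s1]) (auto intro!: exI[of _ T2] exI[of _ s2])
next
  assume ?R
  then obtain T1 s1 T2 s2 where "exec W c1 s T1 s1" "T1 \<le> T" "exec W c2 s1 T2 s2" "T2 \<le> T - T1" "Q s2"
    unfolding runs_def by blast
  then show ?L unfolding runs_def by (intro exI[of _ "T1 + T2"] exI[of _ s2]) (auto intro: exec.Seq)
qed

lemma runs_Seq_Assign [simp]: "runs W (Seq (Assign x e) c) s T Q \<longleftrightarrow>
    1 \<le> T \<and> aval e s < W \<and> runs W c (s\<lparr>vars := (vars s)(x := aval e s)\<rparr>) (T - 1) Q"
  unfolding runs_Seq_iff exec_Assign_iff by auto

lemma runs_Seq_Write [simp]: "runs W (Seq (Write a i e) c) s T Q \<longleftrightarrow> 1 \<le> T \<and> aval i s < W \<and> aval e s < W \<and>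
    runs W c (s\<lparr>arrs := (arrs s)(a := (arrs s a)(aval i s := aval e s))\<rparr>) (T - 1) Q"
  unfolding runs_Seq_iff exec_Write_iff by auto

lemma runs_Seq:
  assumes "runs W c1 s T1 (\<lambda>s1. runs W c2 s1 T2 Q)" "T1 + T2 \<le> T" shows "runs W (Seq c1 c2) s T Q"
proof -
  obtain T' s1 where "exec W c1 s T' s1" "T' \<le> T1" "runs W c2 s1 T2 Q"
    using assms(1) unfolding runs_def[of W c1] by blast
  moreover from this have "runs W c2 s1 (T - T') Q" using assms(2) by (auto intro: runs_mono)
  ultimately show ?thesis using assms(2) unfolding runs_Seq_iff by (intro exI[of _ T'] exI[of _ s1]) auto
qed

lemma runs_conseq: "runs W c s T Q \<Longrightarrow> (\<And>s. Q s \<Longrightarrow> Q' s) \<Longrightarrow> T \<le> T' \<Longrightarrow> runs W c s T' Q'"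
  by (drule runs_mono, assumption) (auto simp: runs_def)

definition For :: "string \<Rightarrow> aexp \<Rightarrow> com \<Rightarrow> com" where
  "For i e c = Seq (Assign i (Const 0))
     (While (Less (Var i) e) (Seq c (Assign i (Add (Var i) (Const 1)))))"

text \<open>Each round costs the body, the increment and the test; the final \<open>+ 2\<close> is
  the initialisation and the last test. The invariant is required on the incremented state, and the
  body must leave the counter alone.\<close>

lemma runs_For:
  assumes step: "\<And>k s. k < N \<Longrightarrow> I k s \<Longrightarrow> vars s i = k \<Longrightarrow>
      runs W c s T (\<lambda>s'. vars s' i = k \<and> I (Suc k) (s'\<lparr>vars := (vars s')(i := Suc k)\<rparr>))"
    and init: "I 0 (s\<lparr>vars := (vars s)(i := 0)\<rparr>)"
    and bound: "\<And>k s. I k s \<Longrightarrow> aval e s = N" and W: "N < W"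
    and fin: "\<And>s. I N s \<Longrightarrow> Q s" and T: "N * (T + 2) + 2 \<le> T'"
  shows "runs W (For i e c) s T' Q"
proof -
  let ?w = "While (Less (Var i) e) (Seq c (Assign i (Add (Var i) (Const 1))))"
  have loop: "runs W ?w s ((N - k) * (T + 2) + 1) (I N)" if "k \<le> N" "I k s" "vars s i = k" for k s
    using that
  proof (induction k arbitrary: s rule: inc_induct)
    case base
    then have "exec W ?w s 1 s" by (intro exec.WhileFalse) (simp add: bound[OF base(1)])
    then show ?case using base unfolding runs_def by auto
  next
    case (step k)
    obtain T1 s1 where s1: "exec W c s T1 s1" "T1 \<le> T" "vars s1 i = k"
        "I (Suc k) (s1\<lparr>vars := (vars s1)(i := Suc k)\<rparr>)"
      using assms(1)[OF step(2,4,5)] unfolding runs_def by blast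
    let ?s2 = "s1\<lparr>vars := (vars s1)(i := Suc k)\<rparr>"
    have a: "exec W (Seq c (Assign i (Add (Var i) (Const 1)))) s (T1 + 1) ?s2"
      using exec.Seq[OF s1(1) exec.Assign[of "Add (Var i) (Const 1)" s1 W i]] s1(3) W step(2) by simp
    obtain T2 s2 where s2: "exec W ?w ?s2 T2 s2" "T2 \<le> (N - Suc k) * (T + 2) + 1" "I N s2"
      using step(3)[OF s1(4)] unfolding runs_def by auto
    have "exec W ?w s ((T1 + 1) + T2 + 1) s2"
      by (rule exec.WhileTrue[OF _ a s2(1)]) (use step bound in simp)
    moreover have "(T1 + 1) + T2 + 1 \<le> (N - k) * (T + 2) + 1"
    proof -
      have "N - k = Suc (N - Suc k)" using step by simp
      then show ?thesis using s1(2) s2(2) by simp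
    qed
    ultimately show ?case using s2(3) unfolding runs_def by blast
  qed
  have "runs W ?w (s\<lparr>vars := (vars s)(i := 0)\<rparr>) (N * (T + 2) + 1) (I N)"
    using loop[OF _ init] by simp
  then have "runs W ?w (s\<lparr>vars := (vars s)(i := 0)\<rparr>) (T' - 1) Q"
    by (rule runs_conseq[OF _ fin]) (use T in auto)
  then show ?thesis using W T unfolding For_def by simp
qed

definition frame :: "string set \<Rightarrow> string set \<Rightarrow> state \<Rightarrow> state \<Rightarrow> bool" where
  "frame X A s s' \<longleftrightarrow> (\<forall>x. x \<notin> X \<longrightarrow> vars s' x = vars s x) \<and> (\<forall>a. a \<notin> A \<longrightarrow> arrs s' a = arrs s a)"

definition eq_b :: "aexp \<Rightarrow> aexp \<Rightarrow> bexp" where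
  "eq_b e f = Conj (Neg (Less e f)) (Neg (Less f e))"

definition le_b :: "aexp \<Rightarrow> aexp \<Rightarrow> bexp" where
  "le_b e f = Neg (Less f e)"

lemma bval_eq_b [simp]: "bval (eq_b e f) s \<longleftrightarrow> aval e s = aval f s"
  by (auto simp: eq_b_def)

lemma bval_le_b [simp]: "bval (le_b e f) s \<longleftrightarrow> aval e s \<le> aval f s"
  by (auto simp: le_b_def)

section \<open>The search program\<close>

text \<open>The array \<open>L\<close> holds the distance from \<open>x\<close> plus one, \<open>0\<close> for unreached nodes and \<open>n + 2\<close> for removed
  ones; \<open>rk\<close> holds the rank in the breadth-first order, \<open>n\<close> for nodes that are never reached.\<close>

definition init_levels :: com where
  "init_levels = Seq (For ''v'' (Var ''n'')
     (Cond (Conj (le_b (Var ''D'') (Mul (Const 3) (Read ''dp'' (Var ''v''))))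
       (Conj (le_b (Var ''D'') (Mul (Const 3) (Read ''dq'' (Var ''v''))))
         (le_b (Add (Add (Read ''dp'' (Var ''v'')) (Read ''dq'' (Var ''v''))) (Const 2))
           (Add (Var ''D'') (Mul (Const 2) (Var ''f''))))))
       (Write ''L'' (Var ''v'') (Add (Var ''n'') (Const 2)))
       (Write ''L'' (Var ''v'') (Const 0))))
     (Write ''L'' (Var ''x'') (Const 1))"

text \<open>Scanning the whole edge list once per round avoids adjacency lists. Over
  \<open>n\<close> radii this costs the term \<open>m * n ^ 2\<close> of the running time. A node
  labelled \<open>r + 2\<close> in round \<open>r\<close> is not extended in the same round, whose
  test asks for \<open>r + 1\<close>.\<close>

definition levels :: com where
  "levels = For ''r'' (Var ''n'') (For ''e'' (Var ''m'')
     (Cond (Conj (eq_b (Read ''L'' (Read ''src'' (Var ''e''))) (Add (Var ''r'') (Const 1)))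
         (eq_b (Read ''L'' (Read ''tgt'' (Var ''e''))) (Const 0)))
       (Write ''L'' (Read ''tgt'' (Var ''e'')) (Add (Var ''r'') (Const 2)))
     (Cond (Conj (eq_b (Read ''L'' (Read ''tgt'' (Var ''e''))) (Add (Var ''r'') (Const 1)))
         (eq_b (Read ''L'' (Read ''src'' (Var ''e''))) (Const 0)))
       (Write ''L'' (Read ''src'' (Var ''e'')) (Add (Var ''r'') (Const 2)))
       Skip)))"

locale ram =
  fixes n m W :: nat and src tgt :: "nat \<Rightarrow> nat"
  assumes n: "1 \<le> n" and W: "n * n + n + 2 < W" "m < W"
    and src: "\<And>e. e < m \<Longrightarrow> src e < n" and tgt: "\<And>e. e < m \<Longrightarrow> tgt e < n"
begin

definition ready :: "state \<Rightarrow> bool" where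
  "ready s \<longleftrightarrow> vars s ''n'' = n \<and> vars s ''m'' = m \<and> arrs s ''src'' = src \<and> arrs s ''tgt'' = tgt"

definition masked :: "state \<Rightarrow> nat set" where
  "masked s = {v. vars s ''D'' \<le> 3 * arrs s ''dp'' v \<and> vars s ''D'' \<le> 3 * arrs s ''dq'' v \<and>
     arrs s ''dp'' v + arrs s ''dq'' v + 2 \<le> vars s ''D'' + 2 * vars s ''f''}"

definition edges :: "nat set set" where "edges = {{src e, tgt e} |e. e < m}"

abbreviation iball :: "nat set \<Rightarrow> nat \<Rightarrow> nat \<Rightarrow> nat set" where
  "iball \<equiv> removal_ball {..<n} edges"

text \<open>Labels of reached nodes are at most \<open>n + 1\<close> after \<open>n\<close> rounds,
  so \<open>n + 2\<close> is the first value free to mark removed nodes.\<close>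

definition level :: "nat set \<Rightarrow> nat \<Rightarrow> nat \<Rightarrow> nat \<Rightarrow> nat" where
  "level M x r v = (if v \<in> iball M x r then Suc (LEAST i. v \<in> iball M x i) else if v \<in> M then n + 2 else 0)"

lemma bounds: "n < W" "n + 1 < W" "n + 2 < W" "0 < W" "Suc 0 < W"
  using W n by auto

lemma readyD:
  assumes "ready s"
  shows "vars s ''n'' = n" "vars s ''m'' = m" "arrs s ''src'' = src" "arrs s ''tgt'' = tgt"
  using assms unfolding ready_def by auto

lemma runs_init_levels:
  assumes "ready s" "vars s ''x'' < n"
  shows "runs W init_levels s (n * 4 + 3) (\<lambda>s'. frame {''v''} {''L''} s s' \<and>
     (\<forall>v<n. arrs s' ''L'' v = level (masked s) (vars s ''x'') 0 v))"
  unfolding init_levels_def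
proof (rule runs_Seq, rule runs_For[where T = 2 and N = n and I = "\<lambda>k s'. frame {''v''} {''L''} s s' \<and>
     (\<forall>v<k. arrs s' ''L'' v = (if v \<in> masked s then n + 2 else 0))"])
  show "n * (2 + 2) + 2 \<le> n * 4 + 2" by simp
  show "n * 4 + 2 + 1 \<le> n * 4 + 3" by simp
qed (use assms(2) bounds in \<open>auto simp: readyD[OF assms(1)] frame_def masked_def level_def less_Suc_eq\<close>)

definition front :: "nat set \<Rightarrow> nat \<Rightarrow> nat \<Rightarrow> nat set" where
  "front M x r = {u \<in> iball M x r. \<forall>i<r. u \<notin> iball M x i}"

definition hit :: "nat set \<Rightarrow> nat \<Rightarrow> nat \<Rightarrow> nat \<Rightarrow> nat \<Rightarrow> bool" where
  "hit M x r e v \<longleftrightarrow> src e \<in> front M x r \<and> tgt e = v \<or> tgt e \<in> front M x r \<and> src e = v"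

text \<open>The content of \<open>L\<close> in the middle of round \<open>r\<close>, after
  \<open>k\<close> edges.\<close>

definition part_level :: "nat set \<Rightarrow> nat \<Rightarrow> nat \<Rightarrow> nat \<Rightarrow> nat \<Rightarrow> nat" where
  "part_level M x r k v = (if v \<in> iball M x r \<or> v \<in> M then level M x r v
     else if \<exists>e<k. hit M x r e v then r + 2 else 0)"

lemma Least_ball:
  assumes "v \<in> iball M x r"
  shows "(LEAST i. v \<in> iball M x i) \<le> r" "(LEAST i. v \<in> iball M x i) = r \<longleftrightarrow> v \<in> front M x r"
proof -
  show "(LEAST i. v \<in> iball M x i) \<le> r" using assms by (rule Least_le)
  show "(LEAST i. v \<in> iball M x i) = r \<longleftrightarrow> v \<in> front M x r"
  proof
    assume "(LEAST i. v \<in> iball M x i) = r"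
    then show "v \<in> front M x r" using assms not_less_Least unfolding front_def by blast
  next
    assume "v \<in> front M x r"
    then show "(LEAST i. v \<in> iball M x i) = r" unfolding front_def
      by (intro Least_equality) (auto simp: not_less[symmetric])
  qed
qed

lemma part_level_front:
  assumes "r < n" shows "part_level M x r k v = Suc r \<longleftrightarrow> v \<in> front M x r"
  using assms Least_ball[of v M x r] unfolding part_level_def level_def by (auto simp: front_def)

lemma part_level_zero: "part_level M x r k v = 0 \<longleftrightarrow> v \<notin> iball M x r \<and> v \<notin> M \<and> (\<forall>e<k. \<not> hit M x r e v)"
  unfolding part_level_def level_def by auto

lemma part_level_0: "part_level M x r 0 v = level M x r v"
  unfolding part_level_def level_def by auto

text \<open>A neighbour of an older layer is already in the ball, so every new node is adjacent to
  the outermost layer. Testing for the single label \<open>r + 1\<close> therefore finds the whole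
  next ball.\<close>

lemma part_level_m:
  assumes v: "v < n" shows "part_level M x r m v = level M x (Suc r) v"
proof (cases "v \<in> iball M x r \<or> v \<in> M")
  case True
  then show ?thesis unfolding part_level_def level_def by auto
next
  case False
  have "(\<exists>e<m. hit M x r e v) \<longleftrightarrow> v \<in> iball M x (Suc r)"
  proof
    assume "\<exists>e<m. hit M x r e v"
    then obtain e u where "e < m" "u \<in> iball M x r" "{u, v} = {src e, tgt e}"
      unfolding hit_def front_def by auto
    then show "v \<in> iball M x (Suc r)" using False v unfolding edges_def by auto
  next
    assume "v \<in> iball M x (Suc r)"
    then obtain u where u: "u \<in> iball M x r" "{u, v} \<in> edges" using False by auto
    have "u \<in> front M x r"
    proof (rule ccontr)
      assume "u \<notin> front M x r"
      then obtain i where i: "i < r" "u \<in> iball M x i" using u unfolding front_def by auto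
      then have "v \<in> iball M x (Suc i)" using u(2) False v by auto
      then show False using False removal_ball_mono[of "Suc i" r] i by fastforce
    qed
    moreover obtain e where "e < m" "{u, v} = {src e, tgt e}" using u(2) unfolding edges_def by auto
    ultimately show "\<exists>e<m. hit M x r e v" unfolding hit_def doubleton_eq_iff by blast
  qed
  moreover have "(LEAST i. v \<in> iball M x i) = Suc r" if "v \<in> iball M x (Suc r)"
  proof (rule Least_equality, fact that)
    fix i assume "v \<in> iball M x i"
    then show "Suc r \<le> i" using False removal_ball_mono[of i r] by (metis not_less_eq_eq subsetD)
  qed
  ultimately show ?thesis using False unfolding part_level_def level_def by auto
qed

lemma runs_levels:
  assumes s: "ready s" and L: "\<forall>v<n. arrs s ''L'' v = level M x 0 v"
  shows "runs W levels s (n * (m * 5 + 4) + 2) (\<lambda>s'. frame {''r'', ''e''} {''L''} s s' \<and>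
     (\<forall>v<n. arrs s' ''L'' v = level M x n v))"
  unfolding levels_def
proof (rule runs_For[where T = "m * 5 + 2" and N = n and I = "\<lambda>r s'. frame {''r'', ''e''} {''L''} s s' \<and>
     (\<forall>v<n. arrs s' ''L'' v = level M x r v)"], goal_cases)
  case (1 r s1)
  then have r: "r < n" and s1: "frame {''r'', ''e''} {''L''} s s1" "\<forall>v<n. arrs s1 ''L'' v = level M x r v" "vars s1 ''r'' = r"
    by auto
  show ?case
  proof (rule runs_For[where T = 3 and N = m and I = "\<lambda>k s'. vars s' ''r'' = r \<and> frame {''r'', ''e''} {''L''} s s' \<and>
     (\<forall>v<n. arrs s' ''L'' v = part_level M x r k v)"], goal_cases)
    case (1 k s2)
    then have k: "k < m" and s2: "vars s2 ''r'' = r" "frame {''r'', ''e''} {''L''} s s2"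
     "\<forall>v<n. arrs s2 ''L'' v = part_level M x r k v" "vars s2 ''e'' = k" by auto
    have *: "r + 2 < W" "src k < W" "tgt k < W" using src[OF k] tgt[OF k] W r by auto
    have ST: "arrs s2 ''src'' = src" "arrs s2 ''tgt'' = tgt"
      using s2(2) readyD[OF s] by (auto simp: frame_def)
    have up: "part_level M x r (Suc k) v = (if v \<notin> iball M x r \<and> v \<notin> M \<and> hit M x r k v then r + 2
        else part_level M x r k v)" for v
      unfolding part_level_def by (auto simp: less_Suc_eq)
    have Leq: "arrs s2 ''L'' (src k) = Suc r \<longleftrightarrow> src k \<in> front M x r"
       "arrs s2 ''L'' (tgt k) = Suc r \<longleftrightarrow> tgt k \<in> front M x r"
       "arrs s2 ''L'' (src k) = 0 \<longleftrightarrow> src k \<notin> iball M x r \<and> src k \<notin> M \<and> (\<forall>e<k. \<not> hit M x r e (src k))"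
       "arrs s2 ''L'' (tgt k) = 0 \<longleftrightarrow> tgt k \<notin> iball M x r \<and> tgt k \<notin> M \<and> (\<forall>e<k. \<not> hit M x r e (tgt k))"
      using s2(3) src[OF k] tgt[OF k] part_level_front[OF r] part_level_zero by auto
    have fr: "v \<in> front M x r \<Longrightarrow> v \<in> iball M x r" for v unfolding front_def by auto
    \<comment> \<open>An end in the front has a nonzero label, so at most one end of the edge can
      receive a new label and the nested conditional misses nothing.\<close>
    show ?case
    proof (cases "src k \<in> front M x r \<and> arrs s2 ''L'' (tgt k) = 0")
      case True
      then have "part_level M x r (Suc k) v = (if v = tgt k then r + 2 else part_level M x r k v)" for v
        using Leq(4) fr unfolding up hit_def by auto
      then show ?thesis using True s2 ST * Leq(1) by (auto simp: frame_def)
    next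
      case F: False
      show ?thesis
      proof (cases "tgt k \<in> front M x r \<and> arrs s2 ''L'' (src k) = 0")
        case True
        then have "part_level M x r (Suc k) v = (if v = src k then r + 2 else part_level M x r k v)" for v
          using Leq(3) fr unfolding up hit_def by auto
        then show ?thesis using True F s2 ST * Leq(1,2) by (auto simp: frame_def)
      next
        case False
        \<comment> \<open>If neither branch is taken, any node hit by this edge already has a
          nonzero label from an earlier edge.\<close>
        have "\<exists>e<k. hit M x r e v" if "v \<notin> iball M x r" "v \<notin> M" "hit M x r k v" for v
          using that False F Leq(3,4) unfolding hit_def[of M x r k] by blast
        then have "part_level M x r (Suc k) v = part_level M x r k v" for v
          unfolding up by (auto simp: part_level_def)
        then show ?thesis using False F s2 ST * Leq(1,2) by (auto simp: frame_def)
      qed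
    qed
  qed (use s1 W in \<open>auto simp: readyD[OF s] frame_def part_level_0 part_level_m\<close>)
next
  case 6 show ?case by (simp add: algebra_simps)
qed (use L W in \<open>auto simp: readyD[OF s] frame_def\<close>)

end

section \<open>Breadth-first ranks and boundary sizes of the prefixes\<close>

definition rank_pass :: com where
  "rank_pass = For ''r'' (Add (Var ''n'') (Const 1)) (For ''v'' (Var ''n'')
     (Cond (eq_b (Read ''L'' (Var ''v'')) (Add (Var ''r'') (Const 1)))
       (Seq (Write ''rk'' (Var ''v'') (Var ''cnt'')) (Assign ''cnt'' (Add (Var ''cnt'') (Const 1))))
       Skip))"

definition ranks :: com where
  "ranks = Seq (For ''v'' (Var ''n'') (Write ''rk'' (Var ''v'') (Var ''n'')))
     (Seq (Assign ''cnt'' (Const 0))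
     rank_pass)"

text \<open>\<open>nb\<close> holds the least rank of a neighbour. A node lies in the boundary of
  the prefix of size \<open>k\<close> iff \<open>nb < k \<le> rk\<close>, so all boundary sizes
  together take quadratic time once \<open>nb\<close> is known.\<close>

definition neighbours :: com where
  "neighbours = Seq (For ''v'' (Var ''n'') (Write ''nb'' (Var ''v'') (Var ''n'')))
     (For ''e'' (Var ''m'') (Seq
       (Cond (Less (Read ''rk'' (Read ''src'' (Var ''e''))) (Read ''nb'' (Read ''tgt'' (Var ''e''))))
         (Write ''nb'' (Read ''tgt'' (Var ''e'')) (Read ''rk'' (Read ''src'' (Var ''e'')))) Skip)
       (Cond (Less (Read ''rk'' (Read ''tgt'' (Var ''e''))) (Read ''nb'' (Read ''src'' (Var ''e''))))
         (Write ''nb'' (Read ''src'' (Var ''e'')) (Read ''rk'' (Read ''tgt'' (Var ''e'')))) Skip)))"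

definition count_boundary :: com where
  "count_boundary = For ''v'' (Var ''n'')
     (Cond (Conj (Less (Read ''nb'' (Var ''v'')) (Var ''k'')) (le_b (Var ''k'') (Read ''rk'' (Var ''v''))))
       (Assign ''b'' (Add (Var ''b'') (Const 1))) Skip)"

definition boundaries :: com where
  "boundaries = For ''k'' (Var ''n'') (Seq (Assign ''b'' (Const 0))
     (Seq count_boundary
       (Write ''B'' (Var ''k'') (Var ''b''))))"

text \<open>Strict growth up to radius \<open>card V\<close> would produce more than
  \<open>card V\<close> nodes, and a ball that fails to grow once never grows again. Hence
  \<open>n\<close> rounds reach the whole component.\<close>

lemma removal_ball_stable:
  assumes "finite V" "x \<in> V" shows "removal_ball V E C x r \<subseteq> removal_ball V E C x (card V)"
proof -
  let ?B = "removal_ball V E C x"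
  have "\<exists>i\<le>card V. ?B (Suc i) = ?B i"
  proof (rule ccontr)
    assume no: "\<not> ?thesis"
    have grow: "i \<le> Suc (card V) \<Longrightarrow> i < card (?B i)" for i
    proof (induction i)
      case (Suc i)
      have fin: "finite (?B j)" for j using finite_subset[OF removal_ball_subset[OF assms(2)] assms(1)] .
      have "?B i \<subset> ?B (Suc i)" using no Suc removal_ball_mono[of i "Suc i" V E C x] by auto
      then have "card (?B i) < card (?B (Suc i))" using fin by (intro psubset_card_mono)
      then show ?case using Suc by simp
    qed simp
    show False
      using grow[of "card V"] card_mono[OF assms(1) removal_ball_subset[OF assms(2)], of E C "card V"]
      by linarith
  qed
  then obtain i where i: "i \<le> card V" "?B (Suc i) = ?B i" by blast
  have "?B (i + j) = ?B i" for j
  proof (induction j)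
    case (Suc j) then show ?case using i(2) by simp
  qed simp
  then have st: "?B j = ?B i" if "i \<le> j" for j using that le_Suc_ex by metis
  show ?thesis using st[OF i(1)] st[of r] removal_ball_mono[of r i V E C x] by (metis nat_le_linear order_refl)
qed

lemma down_closed_eq_lessThan:
  fixes A :: "nat set"
  assumes "finite A" "\<And>i j. i \<in> A \<Longrightarrow> j < i \<Longrightarrow> j \<in> A" shows "A = {..<card A}"
proof -
  define c where "c = (LEAST i. i \<notin> A)"
  have "\<exists>i. i \<notin> A" using assms(1) ex_new_if_finite infinite_UNIV_nat by blast
  then have c: "c \<notin> A" unfolding c_def by (rule LeastI_ex)
  have "i \<in> A" if "i < c" for i using not_less_Least[of i "\<lambda>i. i \<notin> A"] that unfolding c_def by blast
  moreover have "i < c" if "i \<in> A" for i using assms(2)[OF that, of c] c that by (metis linorder_neqE_nat)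
  ultimately have "A = {..<c}" by auto
  then show ?thesis by simp
qed

context ram
begin

definition ranked :: "(nat \<Rightarrow> nat) \<Rightarrow> nat set \<Rightarrow> (nat \<Rightarrow> nat) \<Rightarrow> nat \<Rightarrow> bool" where
  "ranked L Z rk c \<longleftrightarrow> Z \<subseteq> {..<n} \<and> bij_betw rk Z {..<c} \<and>
     (\<forall>u\<in>Z. \<forall>v\<in>Z. L u < L v \<longrightarrow> rk u < rk v) \<and> (\<forall>u<n. u \<notin> Z \<longrightarrow> rk u = n)"

lemma ranked_card: "ranked L Z rk c \<Longrightarrow> c = card Z \<and> c \<le> n \<and> finite Z"
  unfolding ranked_def using bij_betw_same_card[of rk Z "{..<c}"] card_mono[of "{..<n}" Z]
  by (auto intro: finite_subset)

lemma ranked_insert: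
  assumes r: "ranked L Z rk c" and v: "v < n" "v \<notin> Z" "\<And>u. u \<in> Z \<Longrightarrow> L u \<le> L v"
  shows "ranked L (insert v Z) (rk(v := c)) (Suc c)"
proof -
  have b: "bij_betw rk Z {..<c}" using r unfolding ranked_def by simp
  have "bij_betw (rk(v := c)) Z {..<c}" using b v(2) by (subst bij_betw_cong[of Z _ rk]) auto
  moreover have "bij_betw (rk(v := c)) {v} {c}" by simp
  ultimately have "bij_betw (rk(v := c)) (Z \<union> {v}) ({..<c} \<union> {c})" by (rule bij_betw_combine) auto
  moreover have "Z \<union> {v} = insert v Z" "{..<c} \<union> {c} = {..<Suc c}" by auto
  moreover have "rk u < c" if "u \<in> Z" for u using b that by (auto dest: bij_betwE)
  moreover have "\<not> L v < L u" if "u \<in> Z" for u using v(3)[OF that] by simp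
  ultimately show ?thesis using r v unfolding ranked_def by auto
qed

text \<open>Progress of the sort in the middle of a pass: pass \<open>r\<close> treats label
  \<open>r + 1\<close>. Label 0 is never treated, and the label \<open>n + 2\<close> of removed
  nodes comes after the last pass.\<close>

definition seen :: "(nat \<Rightarrow> nat) \<Rightarrow> nat \<Rightarrow> nat \<Rightarrow> nat set" where
  "seen L r k = {u. u < n \<and> 0 < L u \<and> (L u \<le> r \<or> L u = Suc r \<and> u < k)}"

lemma seen_Suc: "seen L r (Suc k) = (if k < n \<and> L k = Suc r then insert k (seen L r k) else seen L r k)"
  unfolding seen_def by (auto simp: less_Suc_eq)

lemma seen_n: "seen L r n = seen L (Suc r) 0"
  unfolding seen_def by auto

lemma runs_ranks:
  assumes s: "ready s"
  shows "runs W ranks s (n * 3 + 3 + ((n + 1) * (n * 5 + 4) + 2)) (\<lambda>s'. frame {''v'', ''r'', ''cnt''} {''rk''} s s' \<and>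
     ranked (arrs s ''L'') (seen (arrs s ''L'') (n + 1) 0) (arrs s' ''rk'') (vars s' ''cnt''))"
  unfolding ranks_def
proof (rule runs_Seq[where ?T1.0 = "n * 3 + 2" and ?T2.0 = "Suc ((n + 1) * (n * 5 + 4) + 2)"],
    rule runs_For[where T = 1 and N = n and I = "\<lambda>k s'. frame {''v'', ''r'', ''cnt''} {''rk''} s s' \<and>
     (\<forall>v<k. arrs s' ''rk'' v = n)"], goal_cases)
  case (5 s1)
  let ?L = "arrs s ''L''"
  have "runs W rank_pass (s1\<lparr>vars := (vars s1)(''cnt'' := 0)\<rparr>) ((n + 1) * (n * 5 + 4) + 2) (\<lambda>s'. frame {''v'', ''r'', ''cnt''} {''rk''} s s' \<and>
     ranked ?L (seen ?L (n + 1) 0) (arrs s' ''rk'') (vars s' ''cnt''))"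
    unfolding rank_pass_def
  proof (rule runs_For[where T = "n * 5 + 2" and N = "n + 1" and I = "\<lambda>r s'. frame {''v'', ''r'', ''cnt''} {''rk''} s s' \<and>
     ranked ?L (seen ?L r 0) (arrs s' ''rk'') (vars s' ''cnt'')"], goal_cases)
    case (1 r s2)
    show ?case
    proof (rule runs_For[where T = 3 and N = n and I = "\<lambda>k s'. vars s' ''r'' = r \<and> frame {''v'', ''r'', ''cnt''} {''rk''} s s' \<and>
     ranked ?L (seen ?L r k) (arrs s' ''rk'') (vars s' ''cnt'')"], goal_cases)
      case (1 k s3)
      then have k: "k < n" "vars s3 ''v'' = k" and fr: "vars s3 ''r'' = r" "frame {''v'', ''r'', ''cnt''} {''rk''} s s3"
        and rk: "ranked ?L (seen ?L r k) (arrs s3 ''rk'') (vars s3 ''cnt'')" by auto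
      have L: "arrs s3 ''L'' = ?L" using fr(2) by (simp add: frame_def)
      have c: "vars s3 ''cnt'' \<le> n" using ranked_card[OF rk] by simp
      show ?case
      proof (cases "?L k = Suc r")
        case True
        have "k \<notin> seen ?L r k" "\<And>u. u \<in> seen ?L r k \<Longrightarrow> ?L u \<le> ?L k" using True by (auto simp: seen_def)
        then have "ranked ?L (seen ?L r (Suc k)) ((arrs s3 ''rk'')(k := vars s3 ''cnt'')) (Suc (vars s3 ''cnt''))"
          using ranked_insert[OF rk k(1)] True k(1) unfolding seen_Suc by simp
        then show ?thesis using True k fr L c bounds by (auto simp: frame_def)
      next
        case False
        then show ?thesis using rk k fr L unfolding seen_Suc by (auto simp: frame_def)
      qed
    qed (use 1 bounds in \<open>auto simp: readyD[OF s] frame_def seen_n\<close>)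
  next
    case 2
    have "seen ?L 0 0 = {}" by (auto simp: seen_def)
    moreover have "ranked ?L {} (arrs s1 ''rk'') 0" using 5 by (simp add: ranked_def bij_betw_def)
    moreover have "frame {''v'', ''r'', ''cnt''} {''rk''} s s1" using 5 by simp
    ultimately show ?case by (simp add: frame_def)
  next
    case 6 show ?case by (simp add: algebra_simps)
  qed (use bounds in \<open>auto simp: readyD[OF s] frame_def\<close>)
  then show ?case using bounds by simp
qed (use bounds in \<open>auto simp: readyD[OF s] frame_def less_Suc_eq\<close>)

text \<open>The minimum is specified by its thresholds up to \<open>n\<close>. This avoids minima of
  possibly empty sets, and the initial value \<open>n\<close> is neutral for them.\<close>

lemma runs_neighbours:
  assumes s: "ready s" and rk: "\<forall>v<n. arrs s ''rk'' v \<le> n"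
  shows "runs W neighbours s (n * 3 + 2 + (m * 6 + 2)) (\<lambda>s'. frame {''v'', ''e''} {''nb''} s s' \<and>
     (\<forall>v<n. \<forall>i\<le>n. arrs s' ''nb'' v < i \<longleftrightarrow>
       (\<exists>e<m. tgt e = v \<and> arrs s ''rk'' (src e) < i \<or> src e = v \<and> arrs s ''rk'' (tgt e) < i)))"
  unfolding neighbours_def
proof (rule runs_Seq[where ?T1.0 = "n * 3 + 2" and ?T2.0 = "m * 6 + 2"],
    rule runs_For[where T = 1 and N = n and I = "\<lambda>k s'. frame {''v'', ''e''} {''nb''} s s' \<and>
     (\<forall>v<k. arrs s' ''nb'' v = n)"], goal_cases)
  case (5 s1)
  show ?case
  proof (rule runs_For[where T = 4 and N = m and I = "\<lambda>k s'. frame {''v'', ''e''} {''nb''} s s' \<and>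
     (\<forall>v<n. \<forall>i\<le>n. arrs s' ''nb'' v < i \<longleftrightarrow>
       (\<exists>e<k. tgt e = v \<and> arrs s ''rk'' (src e) < i \<or> src e = v \<and> arrs s ''rk'' (tgt e) < i))"], goal_cases)
    case (1 k s2)
    then have k: "k < m" "vars s2 ''e'' = k" and fr: "frame {''v'', ''e''} {''nb''} s s2"
      and nb: "\<And>v i. v < n \<Longrightarrow> i \<le> n \<Longrightarrow> arrs s2 ''nb'' v < i \<longleftrightarrow>
       (\<exists>e<k. tgt e = v \<and> arrs s ''rk'' (src e) < i \<or> src e = v \<and> arrs s ''rk'' (tgt e) < i)" by auto
    have st: "src k < n" "tgt k < n" using src tgt k by auto
    have rkW: "arrs s ''rk'' (src k) < W" "arrs s ''rk'' (tgt k) < W" "src k < W" "tgt k < W"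
      using rk[rule_format, OF st(1)] rk[rule_format, OF st(2)] st bounds by auto
    have eqs: "arrs s2 ''src'' = src" "arrs s2 ''tgt'' = tgt" "arrs s2 ''rk'' = arrs s ''rk''"
      using fr readyD[OF s] by (auto simp: frame_def)
    let ?a = "arrs s ''rk'' (src k)" and ?b = "arrs s ''rk'' (tgt k)"
    define nb1 where "nb1 = (if ?a < arrs s2 ''nb'' (tgt k) then (arrs s2 ''nb'')(tgt k := ?a) else arrs s2 ''nb'')"
    define nb2 where "nb2 = (if ?b < nb1 (src k) then nb1(src k := ?b) else nb1)"
    have nb2: "nb2 v < i \<longleftrightarrow> (\<exists>e<Suc k. tgt e = v \<and> arrs s ''rk'' (src e) < i \<or> src e = v \<and> arrs s ''rk'' (tgt e) < i)"
      if vi: "v < n" "i \<le> n" for v i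
    proof -
      have "nb2 v < i \<longleftrightarrow> arrs s2 ''nb'' v < i \<or> (tgt k = v \<and> ?a < i \<or> src k = v \<and> ?b < i)"
        unfolding nb2_def nb1_def by auto
      then show ?thesis unfolding nb[OF vi] by (auto simp: less_Suc_eq)
    qed
    have c1: "runs W (Cond (Less (Read ''rk'' (Read ''src'' (Var ''e''))) (Read ''nb'' (Read ''tgt'' (Var ''e''))))
         (Write ''nb'' (Read ''tgt'' (Var ''e'')) (Read ''rk'' (Read ''src'' (Var ''e'')))) Skip) s2 2
       (\<lambda>s'. frame {''v'', ''e''} {''nb''} s s' \<and> vars s' ''e'' = k \<and> arrs s' ''nb'' = nb1)"
      using k fr rkW eqs by (auto simp: frame_def nb1_def)
    show ?case
    proof (rule runs_Seq[where ?T1.0 = 2 and ?T2.0 = 2, OF runs_conseq[OF c1 _ order_refl]], goal_cases)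
      case (1 s')
      then have eqs': "arrs s' ''src'' = src" "arrs s' ''tgt'' = tgt" "arrs s' ''rk'' = arrs s ''rk''"
        using readyD[OF s] by (auto simp: frame_def)
      have "runs W (Cond (Less (Read ''rk'' (Read ''tgt'' (Var ''e''))) (Read ''nb'' (Read ''src'' (Var ''e''))))
         (Write ''nb'' (Read ''src'' (Var ''e'')) (Read ''rk'' (Read ''tgt'' (Var ''e'')))) Skip) s' 2
       (\<lambda>s'. frame {''v'', ''e''} {''nb''} s s' \<and> vars s' ''e'' = k \<and> arrs s' ''nb'' = nb2)"
        using 1 rkW eqs' by (auto simp: frame_def nb2_def)
      then show ?case by (rule runs_conseq) (use nb2 in \<open>auto simp: frame_def\<close>)
    qed simp_all
  qed (use 5 W bounds in \<open>auto simp: readyD[OF s] frame_def\<close>)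
qed (use bounds in \<open>auto simp: readyD[OF s] frame_def less_Suc_eq\<close>)

lemma runs_boundaries:
  assumes s: "ready s"
  shows "runs W boundaries s (n * (n * 4 + 6) + 2) (\<lambda>s'. frame {''v'', ''k'', ''b''} {''B''} s s' \<and>
     (\<forall>k<n. arrs s' ''B'' k = card {v. v < n \<and> arrs s ''nb'' v < k \<and> k \<le> arrs s ''rk'' v}))"
  unfolding boundaries_def
proof (rule runs_For[where T = "n * 4 + 4" and N = n and I = "\<lambda>k s'. frame {''v'', ''k'', ''b''} {''B''} s s' \<and>
     (\<forall>i<k. arrs s' ''B'' i = card {v. v < n \<and> arrs s ''nb'' v < i \<and> i \<le> arrs s ''rk'' v})"], goal_cases)
  case (1 k s1)
  have loop: "runs W count_boundary (s1\<lparr>vars := (vars s1)(''b'' := 0)\<rparr>) (n * 4 + 2)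
    (\<lambda>s'. frame {''v'', ''k'', ''b''} {''B''} s s' \<and> arrs s' ''B'' = arrs s1 ''B'' \<and> vars s' ''k'' = k \<and>
       vars s' ''b'' = card {v. v < n \<and> arrs s ''nb'' v < k \<and> k \<le> arrs s ''rk'' v})"
    unfolding count_boundary_def
  proof (rule runs_For[where T = 2 and N = n and I = "\<lambda>j s'. frame {''v'', ''k'', ''b''} {''B''} s s' \<and>
      arrs s' ''B'' = arrs s1 ''B'' \<and> vars s' ''k'' = k \<and>
       vars s' ''b'' = card {v. v < j \<and> arrs s ''nb'' v < k \<and> k \<le> arrs s ''rk'' v}"], goal_cases)
    case (1 j s2)
    let ?S = "\<lambda>j. {v. v < j \<and> arrs s ''nb'' v < k \<and> k \<le> arrs s ''rk'' v}"
    have S: "?S (Suc j) = (if arrs s ''nb'' j < k \<and> k \<le> arrs s ''rk'' j then insert j (?S j) else ?S j)"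
      by (auto simp: less_Suc_eq)
    have "card (?S j) \<le> card {..<j}" by (intro card_mono) auto
    then have "card (?S j) < W" "Suc (card (?S j)) < W" using 1(1) bounds by auto
    moreover have "finite (?S j)" by simp
    ultimately show ?case using 1 unfolding S by (auto simp: frame_def)
  qed (use 1 bounds in \<open>auto simp: readyD[OF s] frame_def\<close>)
  have le: "card {v. v < n \<and> arrs s ''nb'' v < k \<and> k \<le> arrs s ''rk'' v} \<le> card {..<n}"
    by (intro card_mono) auto
  have "runs W (Seq count_boundary (Write ''B'' (Var ''k'') (Var ''b'')))
       (s1\<lparr>vars := (vars s1)(''b'' := 0)\<rparr>) (n * 4 + 2 + 1) (\<lambda>s'. vars s' ''k'' = k \<and>
         frame {''v'', ''k'', ''b''} {''B''} s (s'\<lparr>vars := (vars s')(''k'' := Suc k)\<rparr>) \<and>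
         (\<forall>i<Suc k. arrs (s'\<lparr>vars := (vars s')(''k'' := Suc k)\<rparr>) ''B'' i =
            card {v. v < n \<and> arrs s ''nb'' v < i \<and> i \<le> arrs s ''rk'' v}))"

  proof (rule runs_Seq[OF runs_conseq[OF loop _ order_refl]])
    fix s'
    let ?c = "\<lambda>i. card {v. v < n \<and> arrs s ''nb'' v < i \<and> i \<le> arrs s ''rk'' v}"
    assume "frame {''v'', ''k'', ''b''} {''B''} s s' \<and> arrs s' ''B'' = arrs s1 ''B'' \<and> vars s' ''k'' = k \<and> vars s' ''b'' = ?c k"
    then have fr: "frame {''v'', ''k'', ''b''} {''B''} s s'" and B: "arrs s' ''B'' = arrs s1 ''B''" "vars s' ''k'' = k" "vars s' ''b'' = ?c k"
      by blast+
    have "k < W" "?c k < W" using 1(1) le bounds by simp_all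
    moreover have "((arrs s1 ''B'')(k := ?c k)) i = ?c i" if "i < Suc k" for i using 1(2) that by (cases "i = k") simp_all
    ultimately show "runs W (Write ''B'' (Var ''k'') (Var ''b'')) s' 1 (\<lambda>s'. vars s' ''k'' = k \<and>
         frame {''v'', ''k'', ''b''} {''B''} s (s'\<lparr>vars := (vars s')(''k'' := Suc k)\<rparr>) \<and>
         (\<forall>i<Suc k. arrs (s'\<lparr>vars := (vars s')(''k'' := Suc k)\<rparr>) ''B'' i = ?c i))"
      using fr by (simp add: B frame_def)
  qed simp
  then show ?case using bounds by (simp add: numeral_eq_Suc)
next
  case 6 show ?case by (simp add: algebra_simps)
qed (use bounds in \<open>auto simp: readyD[OF s] frame_def\<close>)

end

section \<open>Selection and output of the best prefixes\<close>

definition valid_b :: "string \<Rightarrow> bexp" where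
  "valid_b k = Conj (Less (Const 0) (Var k)) (Conj (le_b (Var k) (Var ''cnt''))
     (le_b (Mul (Const 2) (Var k)) (Var ''n'')))"

text \<open>The quality of a search is the least threshold met by more than \<open>D / 64\<close>
  prefixes. It is attained at one of the ratios \<open>B k / k\<close>, so it suffices to count for
  each \<open>k\<close> the prefixes that are at least as good.\<close>

definition count_rivals :: com where
  "count_rivals = For ''j'' (Var ''n'') (Cond (Conj (valid_b ''j'')
       (le_b (Mul (Read ''B'' (Var ''j'')) (Var ''k'')) (Mul (Read ''B'' (Var ''k'')) (Var ''j''))))
     (Assign ''z'' (Add (Var ''z'') (Const 1))) Skip)"

definition update_best :: com where
  "update_best = Cond (Conj (Less (Var ''D'') (Mul (Const 64) (Var ''z'')))
       (Less (Mul (Read ''B'' (Var ''k'')) (Var ''bk'')) (Mul (Var ''bB'') (Var ''k''))))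
     (Seq (Assign ''bB'' (Read ''B'' (Var ''k''))) (Seq (Assign ''bk'' (Var ''k'')) (Assign ''imp'' (Const 1))))
     Skip"

definition select_pass :: com where
  "select_pass = For ''k'' (Var ''n'') (Cond (valid_b ''k'')
     (Seq (Assign ''z'' (Const 0)) (Seq count_rivals update_best)) Skip)"

definition select_best :: com where
  "select_best = Seq (Assign ''imp'' (Const 0)) select_pass"

text \<open>Zeros are written explicitly because an earlier family may have left ones in the
  row.\<close>

definition write_row :: com where
  "write_row = For ''v'' (Var ''n'') (Cond (Less (Read ''rk'' (Var ''v'')) (Var ''k''))
     (Write ''out'' (Add (Mul (Var ''t'') (Var ''n'')) (Var ''v'')) (Const 1))
     (Write ''out'' (Add (Mul (Var ''t'') (Var ''n'')) (Var ''v'')) (Const 0)))"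

definition output_pass :: com where
  "output_pass = For ''k'' (Var ''n'') (Cond (Conj (valid_b ''k'')
       (le_b (Mul (Read ''B'' (Var ''k'')) (Var ''bk'')) (Mul (Var ''bB'') (Var ''k''))))
     (Seq (Assign ''t'' (Add (Var ''t'') (Const 1))) write_row) Skip)"

definition output_best :: com where
  "output_best = Cond (Less (Const 0) (Var ''imp'')) (Seq (Assign ''t'' (Const 0)) output_pass) Skip"

text \<open>The ratios \<open>a / b\<close>, \<open>c / d\<close>, \<open>e / f\<close> are compared by cross multiplication; \<open>c / 0\<close> with \<open>0 < c\<close>
  serves as infinity.\<close>

lemma ratio_trans:
  fixes a b c d e f :: nat
  assumes "a * d \<le> c * b" "c * f \<le> e * d" "0 < d \<or> 0 < c" shows "a * f \<le> e * b"
proof (cases "d = 0")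
  case False
  have "d * (a * f) \<le> c * b * f" using mult_right_mono[OF assms(1), of f] by (simp add: mult_ac)
  also have "\<dots> \<le> d * (e * b)" using mult_right_mono[OF assms(2), of b] by (simp add: mult_ac)
  finally show ?thesis using False by simp
qed (use assms in auto)

context ram
begin

definition valid :: "nat \<Rightarrow> nat \<Rightarrow> bool" where
  "valid c k \<longleftrightarrow> 0 < k \<and> k \<le> c \<and> 2 * k \<le> n"

lemma valid_less: "valid c k \<Longrightarrow> k < n"
  by (auto simp: valid_def)

lemma bval_valid_b: "bval (valid_b i) s \<longleftrightarrow> 0 < vars s i \<and> vars s i \<le> vars s ''cnt'' \<and> 2 * vars s i \<le> vars s ''n''"
  unfolding valid_b_def by simp

definition rivals :: "nat \<Rightarrow> (nat \<Rightarrow> nat) \<Rightarrow> nat \<Rightarrow> nat set" where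
  "rivals c B k = {j. valid c j \<and> B j * k \<le> B k * j}"

definition eligible :: "nat \<Rightarrow> nat \<Rightarrow> (nat \<Rightarrow> nat) \<Rightarrow> nat \<Rightarrow> bool" where
  "eligible D c B k \<longleftrightarrow> valid c k \<and> D < 64 * card (rivals c B k)"

lemma runs_count_rivals:
  assumes s: "vars s ''n'' = n" and k: "vars s ''k'' = k"
  shows "runs W count_rivals (s\<lparr>vars := (vars s)(''z'' := 0)\<rparr>) (n * 4 + 2)
     (\<lambda>s'. frame {''j'', ''z''} {} s s' \<and> vars s' ''z'' = card (rivals (vars s ''cnt'') (arrs s ''B'') k))"
  unfolding count_rivals_def
proof (rule runs_For[where T = 2 and N = n and I = "\<lambda>i s'. frame {''j'', ''z''} {} s s' \<and>
     vars s' ''z'' = card {j. j < i \<and> j \<in> rivals (vars s ''cnt'') (arrs s ''B'') k}"], goal_cases)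
  case (1 i s')
  let ?R = "rivals (vars s ''cnt'') (arrs s ''B'') k" and ?S = "\<lambda>i. {j. j < i \<and> j \<in> rivals (vars s ''cnt'') (arrs s ''B'') k}"
  have S: "?S (Suc i) = (if i \<in> ?R then insert i (?S i) else ?S i)" by (auto simp: less_Suc_eq)
  have "card (?S i) \<le> card {..<i}" by (intro card_mono) auto
  then have c: "Suc (card (?S i)) < W" using 1(1) bounds by auto
  have cS: "card (?S (Suc i)) = (if i \<in> ?R then Suc (card (?S i)) else card (?S i))" unfolding S by simp
  have fr: "frame {''j'', ''z''} {} s s'" "vars s' ''z'' = card (?S i)" using 1(2) by auto
  have eqs: "vars s' ''k'' = k" "vars s' ''n'' = n" "vars s' ''cnt'' = vars s ''cnt''" "arrs s' = arrs s"
    using fr(1) s k by (auto simp: frame_def)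
  have R: "bval (Conj (valid_b ''j'')
     (le_b (Mul (Read ''B'' (Var ''j'')) (Var ''k'')) (Mul (Read ''B'' (Var ''k'')) (Var ''j'')))) s' \<longleftrightarrow> i \<in> ?R"
    using 1(3) by (simp add: bval_valid_b eqs rivals_def valid_def)
  show ?case unfolding runs_Cond R cS using fr c 1(3) by (auto simp: frame_def)
next
  case (5 s')
  have "{j. j < n \<and> j \<in> rivals (vars s ''cnt'') (arrs s ''B'') k} = rivals (vars s ''cnt'') (arrs s ''B'') k"
    by (auto simp: rivals_def dest: valid_less)
  then show ?case using 5 by simp
qed (use s bounds in \<open>auto simp: frame_def\<close>)

text \<open>The stored ratio is replaced only by a strictly smaller one, so earlier comparisons stay
  valid by transitivity of the cross-multiplied order. The flag \<open>imp\<close> tells the output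
  phase whether the sets written so far are out of date.\<close>

lemma runs_select_best:
  assumes s: "vars s ''n'' = n" and B: "\<forall>k<n. arrs s ''B'' k \<le> n"
    and best: "0 < vars s ''bk'' \<or> 0 < vars s ''bB''"
  shows "runs W select_best s (n * (n * 4 + 10) + 3) (\<lambda>s'. frame {''k'', ''j'', ''z'', ''imp'', ''bk'', ''bB''} {} s s' \<and>
     (0 < vars s' ''bk'' \<or> 0 < vars s' ''bB'') \<and> vars s' ''bB'' * vars s ''bk'' \<le> vars s ''bB'' * vars s' ''bk'' \<and>
     (\<forall>k. eligible (vars s ''D'') (vars s ''cnt'') (arrs s ''B'') k \<longrightarrow> vars s' ''bB'' * k \<le> arrs s ''B'' k * vars s' ''bk'') \<and>
     (vars s' ''imp'' = 0 \<and> vars s' ''bk'' = vars s ''bk'' \<and> vars s' ''bB'' = vars s ''bB'' \<or>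
      vars s' ''imp'' = 1 \<and> eligible (vars s ''D'') (vars s ''cnt'') (arrs s ''B'') (vars s' ''bk'') \<and>
        vars s' ''bB'' = arrs s ''B'' (vars s' ''bk'')))" (is "runs _ _ _ _ ?Q")
proof -
  define bB0 bk0 D c b where "bB0 = vars s ''bB''" and "bk0 = vars s ''bk''" and "D = vars s ''D''"
    and "c = vars s ''cnt''" and "b = arrs s ''B''"
  define X where "X = {''k'', ''j'', ''z'', ''imp'', ''bk'', ''bB''}"
  define I where "I k s' \<longleftrightarrow> frame X {} s s' \<and>
     (0 < vars s' ''bk'' \<or> 0 < vars s' ''bB'') \<and> vars s' ''bB'' * bk0 \<le> bB0 * vars s' ''bk'' \<and>
     (\<forall>i<k. eligible D c b i \<longrightarrow> vars s' ''bB'' * i \<le> b i * vars s' ''bk'') \<and>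
     (vars s' ''imp'' = 0 \<and> vars s' ''bk'' = bk0 \<and> vars s' ''bB'' = bB0 \<or>
      vars s' ''imp'' = 1 \<and> eligible D c b (vars s' ''bk'') \<and> vars s' ''bB'' = b (vars s' ''bk''))" for k s'
  have I_frame: "I k s'" if "I k s''" "frame {''k'', ''j'', ''z''} {} s'' s'" for k s' s''
    using that unfolding I_def X_def by (auto simp: frame_def)
  have loop: "runs W select_pass (s\<lparr>vars := (vars s)(''imp'' := 0)\<rparr>) (n * (n * 4 + 10) + 2) (I n)"
    unfolding select_pass_def
  proof (rule runs_For[where T = "n * 4 + 8" and N = n and I = I], goal_cases)
    case (1 k s1)
    have fr: "frame X {} s s1" using 1(2) unfolding I_def by simp
    have eqs: "vars s1 ''n'' = n" "vars s1 ''cnt'' = c" "vars s1 ''D'' = D" "arrs s1 ''B'' = b"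
      using fr s unfolding X_def c_def D_def b_def by (auto simp: frame_def)
    have v: "bval (valid_b ''k'') s1 \<longleftrightarrow> valid c k" using 1(3) eqs by (simp add: bval_valid_b valid_def)
    show ?case
    proof (cases "valid c k")
      case False
      then have "I (Suc k) s1" using 1(2) unfolding I_def by (auto simp: less_Suc_eq eligible_def)
      then have "I (Suc k) (s1\<lparr>vars := (vars s1)(''k'' := Suc k)\<rparr>)" by (rule I_frame) (simp add: frame_def)
      then show ?thesis using False v 1(3) by simp
    next
      case True
      have "runs W (Seq count_rivals update_best) (s1\<lparr>vars := (vars s1)(''z'' := 0)\<rparr>) (n * 4 + 6)
         (\<lambda>s'. vars s' ''k'' = k \<and> I (Suc k) (s'\<lparr>vars := (vars s')(''k'' := Suc k)\<rparr>))"
      proof (rule runs_Seq[where ?T1.0 = "n * 4 + 2" and ?T2.0 = 4,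
            OF runs_conseq[OF runs_count_rivals[OF eqs(1) 1(3)] _ order_refl]], goal_cases)
        case (1 s2)
        then have fr2: "frame {''j'', ''z''} {} s1 s2" and z: "vars s2 ''z'' = card (rivals c b k)" using eqs by auto
        have eqs2: "vars s2 ''k'' = k" "vars s2 ''D'' = D" "arrs s2 ''B'' = b"
          using fr2 eqs \<open>vars s1 ''k'' = k\<close> by (auto simp: frame_def)
        have I2: "I k s2" using \<open>I k s1\<close> by (rule I_frame) (use fr2 in \<open>auto simp: frame_def\<close>)
        have kn: "k < n" using \<open>k < n\<close> .
        have bkW: "b k < W" "k < W" using B kn bounds unfolding b_def by auto
        define better where "better \<longleftrightarrow> D < 64 * card (rivals c b k) \<and> b k * vars s2 ''bk'' < vars s2 ''bB'' * k"
        have cond: "bval (Conj (Less (Var ''D'') (Mul (Const 64) (Var ''z'')))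
           (Less (Mul (Read ''B'' (Var ''k'')) (Var ''bk'')) (Mul (Var ''bB'') (Var ''k'')))) s2 \<longleftrightarrow> better"
          unfolding better_def by (simp add: eqs2 z)
        show ?case
        proof (cases better)
          case False
          have "eligible D c b k \<Longrightarrow> vars s2 ''bB'' * k \<le> b k * vars s2 ''bk''"
            using False unfolding better_def eligible_def by auto
          then have "I (Suc k) s2" using I2 unfolding I_def by (auto simp: less_Suc_eq)
          then have "I (Suc k) (s2\<lparr>vars := (vars s2)(''k'' := Suc k)\<rparr>)" by (rule I_frame) (simp add: frame_def)
          then show ?thesis unfolding update_best_def runs_Cond cond using False eqs2 by simp
        next
          case bt: True
          define s3 where "s3 = s2\<lparr>vars := (vars s2)(''bB'' := b k, ''bk'' := k, ''imp'' := 1)\<rparr>"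
          have q: "eligible D c b k" using bt True unfolding better_def eligible_def by simp
          have k0: "0 < k" using True unfolding valid_def by simp
          have lt: "b k * vars s2 ''bk'' \<le> vars s2 ''bB'' * k" using bt unfolding better_def by simp
          have r2: "0 < vars s2 ''bk'' \<or> 0 < vars s2 ''bB''" using I2 unfolding I_def by simp
          have "b k * bk0 \<le> bB0 * k"
            using I2 ratio_trans[OF lt _ r2] unfolding I_def by blast
          moreover have "b k * i \<le> b i * k" if "i < Suc k" "eligible D c b i" for i
          proof (cases "i = k")
            case False
            then have "vars s2 ''bB'' * i \<le> b i * vars s2 ''bk''" using I2 that unfolding I_def by simp
            then show ?thesis using ratio_trans[OF lt _ r2] by blast
          qed simp
          moreover have "frame X {} s s3" using I2 unfolding I_def s3_def X_def by (simp add: frame_def)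
          ultimately have "I (Suc k) s3" using k0 q unfolding I_def by (simp add: s3_def)
          then have "I (Suc k) (s3\<lparr>vars := (vars s3)(''k'' := Suc k)\<rparr>)" by (rule I_frame) (simp add: frame_def)
          then show ?thesis unfolding update_best_def runs_Cond cond using bt eqs2 bkW bounds by (simp add: s3_def)
        qed
      qed simp
      then show ?thesis using True v bounds by (simp add: numeral_eq_Suc)
    qed
  next
    case 2
    show ?case using best unfolding I_def X_def bB0_def bk0_def by (simp add: frame_def)
  next
    case (3 k s')
    then show ?case using s unfolding I_def X_def by (simp add: frame_def)
  next
    case 6 show ?case by (simp add: algebra_simps)
  qed (use bounds in auto)
  have "runs W select_best s (n * (n * 4 + 10) + 3) (I n)"
    using loop bounds unfolding select_best_def by (simp add: numeral_eq_Suc)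
  then show ?thesis
  proof (rule runs_conseq)
    fix s' assume I: "I n s'"
    have "k < n" if "eligible D c b k" for k using that by (auto simp: eligible_def dest: valid_less)
    then have "\<forall>k. eligible D c b k \<longrightarrow> vars s' ''bB'' * k \<le> b k * vars s' ''bk''"
      using I unfolding I_def by blast
    then show "?Q s'"
      using I unfolding I_def X_def bB0_def bk0_def D_def c_def b_def by (elim conjE) (intro conjI; assumption)
  qed simp
qed

end

context ram
begin

definition chosen :: "nat \<Rightarrow> (nat \<Rightarrow> nat) \<Rightarrow> nat \<Rightarrow> nat \<Rightarrow> nat set" where
  "chosen c B b k = {j. valid c j \<and> B j * k \<le> b * j}"

definition rows :: "nat set \<Rightarrow> (nat \<Rightarrow> nat) \<Rightarrow> nat \<Rightarrow> (nat \<Rightarrow> nat) \<Rightarrow> bool" where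
  "rows K rk t out \<longleftrightarrow> t = card K \<and> (\<exists>\<kappa>. (\<forall>j\<in>{1..t}. \<kappa> j \<in> K \<and>
       (\<forall>v<n. out (j * n + v) = (if rk v < \<kappa> j then 1 else 0))) \<and>
     (\<forall>i j. 1 \<le> i \<longrightarrow> i < j \<longrightarrow> j \<le> t \<longrightarrow> \<kappa> i < \<kappa> j))"

text \<open>Sizes are treated in increasing order and row \<open>t + 1\<close> starts at address
  \<open>(t + 1) * n\<close>, so appending a row disturbs neither the order nor the earlier
  rows.\<close>

lemma rows_insert:
  assumes R: "rows K rk t out" and K: "\<And>i. i \<in> K \<Longrightarrow> i < k" "finite K"
    and new: "\<And>v. v < n \<Longrightarrow> out' (Suc t * n + v) = (if rk v < k then 1 else 0)"
    and old: "\<And>i. i < Suc t * n \<Longrightarrow> out' i = out i"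
  shows "rows (insert k K) rk (Suc t) out'"
proof -
  obtain \<kappa> where \<kappa>: "\<And>j. j \<in> {1..t} \<Longrightarrow> \<kappa> j \<in> K"
      "\<And>j v. j \<in> {1..t} \<Longrightarrow> v < n \<Longrightarrow> out (j * n + v) = (if rk v < \<kappa> j then 1 else 0)"
      "\<And>i j. 1 \<le> i \<Longrightarrow> i < j \<Longrightarrow> j \<le> t \<Longrightarrow> \<kappa> i < \<kappa> j" and t: "t = card K"
    using R unfolding rows_def by blast
  let ?\<kappa> = "\<kappa>(Suc t := k)"
  have "out' (j * n + v) = (if rk v < ?\<kappa> j then 1 else 0)" if "j \<in> {1..Suc t}" "v < n" for j v
  proof (cases "j = Suc t")
    case False
    then have "j * n \<le> t * n" using that by (intro mult_right_mono) auto
    then have "j * n + v < Suc t * n" unfolding mult_Suc using that(2) by linarith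
    then show ?thesis using old \<kappa>(2)[of j v] that False by auto
  qed (use new that in simp)
  moreover have "?\<kappa> j \<in> insert k K" if "j \<in> {1..Suc t}" for j using that \<kappa>(1) by auto
  moreover have "?\<kappa> i < ?\<kappa> j" if "1 \<le> i" "i < j" "j \<le> Suc t" for i j
    using that \<kappa>(3)[of i j] K(1)[OF \<kappa>(1), of i] by auto
  moreover have "Suc t = card (insert k K)"
  proof -
    have "k \<notin> K" using K(1)[of k] by blast
    then show ?thesis using t K(2) by simp
  qed
  ultimately show ?thesis unfolding rows_def by (intro conjI exI[of _ ?\<kappa>]) blast+
qed

lemma runs_write_row:
  assumes s: "vars s ''n'' = n" "vars s ''k'' = k" "vars s ''t'' = t" and t: "t \<le> n"
  shows "runs W write_row s (n * 4 + 2)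
     (\<lambda>s'. frame {''v''} {''out''} s s' \<and>
       (\<forall>v<n. arrs s' ''out'' (t * n + v) = (if arrs s ''rk'' v < k then 1 else 0)) \<and>
       (\<forall>i<t * n. arrs s' ''out'' i = arrs s ''out'' i))"
  unfolding write_row_def
proof (rule runs_For[where T = 2 and N = n and I = "\<lambda>l s'. frame {''v''} {''out''} s s' \<and>
       (\<forall>v<l. arrs s' ''out'' (t * n + v) = (if arrs s ''rk'' v < k then 1 else 0)) \<and>
       (\<forall>i<t * n. arrs s' ''out'' i = arrs s ''out'' i)"], goal_cases)
  case (1 l s')
  \<comment> \<open>The largest address, below \<open>n * n + n\<close>, is what forces the
    quadratic term in the lower bound on \<open>W\<close>.\<close>
  have "t * n \<le> n * n" using t by (intro mult_right_mono) auto
  then have "t * n + l < W" using 1(1) W by linarith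
  moreover have "vars s' ''n'' = n" "vars s' ''k'' = k" "vars s' ''t'' = t" "arrs s' ''rk'' = arrs s ''rk''"
    using 1(2) s by (auto simp: frame_def)
  ultimately show ?case using 1(2,3) bounds by (auto simp: frame_def less_Suc_eq)
qed (use s bounds in \<open>auto simp: frame_def\<close>)

lemma runs_output_best:
  assumes s: "vars s ''n'' = n"
  shows "runs W output_best s (n * (n * 4 + 6) + 4) (\<lambda>s'. frame {''k'', ''v'', ''t''} {''out''} s s' \<and>
     (if vars s ''imp'' = 0 then s' = s
      else rows (chosen (vars s ''cnt'') (arrs s ''B'') (vars s ''bB'') (vars s ''bk'')) (arrs s ''rk'') (vars s' ''t'') (arrs s' ''out'')))"
proof (cases "vars s ''imp'' = 0")
  case True
  then show ?thesis unfolding output_best_def by (simp add: frame_def)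
next
  case False
  define K where "K = chosen (vars s ''cnt'') (arrs s ''B'') (vars s ''bB'') (vars s ''bk'')"
  define X where "X = {''k'', ''v'', ''t''}"
  have loop: "runs W output_pass (s\<lparr>vars := (vars s)(''t'' := 0)\<rparr>) (n * (n * 4 + 6) + 2)
     (\<lambda>s'. frame X {''out''} s s' \<and> rows K (arrs s ''rk'') (vars s' ''t'') (arrs s' ''out''))"
    unfolding output_pass_def
  proof (rule runs_For[where T = "n * 4 + 4" and N = n and I = "\<lambda>k s'. frame X {''out''} s s' \<and>
      rows {j \<in> K. j < k} (arrs s ''rk'') (vars s' ''t'') (arrs s' ''out'')"], goal_cases)
    case (1 k s1)
    then have fr: "frame X {''out''} s s1" and R: "rows {j \<in> K. j < k} (arrs s ''rk'') (vars s1 ''t'') (arrs s1 ''out'')" by auto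
    have eqs: "vars s1 ''n'' = n" "vars s1 ''cnt'' = vars s ''cnt''" "arrs s1 ''B'' = arrs s ''B''" "arrs s1 ''rk'' = arrs s ''rk''"
       "vars s1 ''bB'' = vars s ''bB''" "vars s1 ''bk'' = vars s ''bk''"
      using fr s unfolding X_def by (auto simp: frame_def)
    have cond: "bval (Conj (valid_b ''k'')
           (le_b (Mul (Read ''B'' (Var ''k'')) (Var ''bk'')) (Mul (Var ''bB'') (Var ''k'')))) s1 \<longleftrightarrow> k \<in> K"
      using 1(3) by (simp add: bval_valid_b eqs K_def chosen_def valid_def)
    have fin: "finite {j \<in> K. j < k}" by simp
    have "card {j \<in> K. j < k} \<le> card {..<k}" by (intro card_mono) auto
    then have "vars s1 ''t'' \<le> k" using R unfolding rows_def by simp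
    then have t: "Suc (vars s1 ''t'') \<le> n" "Suc (vars s1 ''t'') < W" using 1(1) bounds by auto
    show ?case
    proof (cases "k \<in> K")
      case False
      then have "{j \<in> K. j < Suc k} = {j \<in> K. j < k}" by (auto simp: less_Suc_eq)
      then show ?thesis unfolding runs_Cond cond using False fr R 1(3) by (simp add: frame_def X_def)
    next
      case True
      then have ins: "{j \<in> K. j < Suc k} = insert k {j \<in> K. j < k}" by (auto simp: less_Suc_eq)
      let ?s = "s1\<lparr>vars := (vars s1)(''t'' := Suc (vars s1 ''t''))\<rparr>"
      have "runs W write_row ?s (n * 4 + 2)
          (\<lambda>s'. vars s' ''k'' = k \<and> frame X {''out''} s (s'\<lparr>vars := (vars s')(''k'' := Suc k)\<rparr>) \<and>
            rows {j \<in> K. j < Suc k} (arrs s ''rk'') (vars s' ''t'') (arrs s' ''out''))"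
      proof (rule runs_conseq[OF runs_write_row[where k = k and t = "Suc (vars s1 ''t'')"]], goal_cases)
        case (5 s')
        have t': "vars s' ''t'' = Suc (vars s1 ''t'')" "vars s' ''k'' = k" using 5 1(3) by (auto simp: frame_def)
        have "rows {j \<in> K. j < Suc k} (arrs s ''rk'') (vars s' ''t'') (arrs s' ''out'')"
          unfolding ins t' by (rule rows_insert[OF R _ fin]) (use 5 eqs in auto)
        moreover have "frame X {''out''} s (s'\<lparr>vars := (vars s')(''k'' := Suc k)\<rparr>)"
          using 5 fr by (simp add: frame_def X_def)
        ultimately show ?case using t' by simp
      qed (use t eqs 1(3) in simp_all)
      then show ?thesis unfolding runs_Cond cond using True t(2) by (simp add: numeral_eq_Suc)
    qed
  next
    case (5 s')
    have "{j \<in> K. j < n} = K" unfolding K_def by (auto simp: chosen_def dest: valid_less)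
    then show ?case using 5 by simp
  next
    case 6 show ?case by (simp add: algebra_simps)
  qed (use s bounds in \<open>auto simp: frame_def X_def rows_def\<close>)
  then show ?thesis using False bounds unfolding output_best_def K_def X_def by (simp add: numeral_eq_Suc)
qed

end

section \<open>One search with a fixed set of removed nodes and a fixed centre\<close>

definition family :: com where
  "family = Seq init_levels (Seq levels (Seq ranks (Seq neighbours (Seq boundaries (Seq select_best output_best)))))"

lemma runsE:
  assumes "runs W c s T Q" obtains T' s' where "exec W c s T' s'" "T' \<le> T" "Q s'"
  using assms unfolding runs_def by blast

lemma frame_trans: "frame X A s s' \<Longrightarrow> frame X' A' s' s'' \<Longrightarrow> frame (X \<union> X') (A \<union> A') s s''"
  unfolding frame_def by simp

lemma frame_mono: "frame X A s s' \<Longrightarrow> X \<subseteq> X' \<Longrightarrow> A \<subseteq> A' \<Longrightarrow> frame X' A' s s'"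
  unfolding frame_def by blast

context ram
begin

lemma ready_frame:
  assumes "frame X A s s'" "ready s" "''n'' \<notin> X" "''m'' \<notin> X" "''src'' \<notin> A" "''tgt'' \<notin> A" shows "ready s'"
  using assms unfolding frame_def ready_def by simp

abbreviation bnd :: "nat set \<Rightarrow> nat" where
  "bnd S \<equiv> card (node_boundary {..<n} edges S)"

text \<open>A node ranked before a node of a ball has no larger label, hence lies in the ball. The
  ranks of a ball are thus downward closed, and the ball is a prefix.\<close>

lemma ranked_ball_chain:
  assumes x: "x < n" and L: "\<And>v. v < n \<Longrightarrow> L v = level M x n v" and rk: "ranked L (seen L (n + 1) 0) rk c"
  shows "ball_chain {..<n} edges M x c (\<lambda>k. {v. v < n \<and> rk v < k})"
proof -
  let ?Z = "iball M x n"
  have ZV: "iball M x r \<subseteq> {..<n}" for r using removal_ball_subset[of x "{..<n}"] x by simp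
  have Z: "seen L (n + 1) 0 = ?Z"
  proof -
    have "v \<in> seen L (n + 1) 0 \<longleftrightarrow> v \<in> ?Z" if "v < n" for v
      using that L[OF that] Least_ball(1)[of v M x n] unfolding seen_def level_def by auto
    then show ?thesis using ZV[of n] unfolding seen_def by blast
  qed
  have R: "bij_betw rk ?Z {..<c}" "\<And>u v. u \<in> ?Z \<Longrightarrow> v \<in> ?Z \<Longrightarrow> L u < L v \<Longrightarrow> rk u < rk v"
     "\<And>u. u < n \<Longrightarrow> u \<notin> ?Z \<Longrightarrow> rk u = n" using rk unfolding ranked_def Z by auto
  have c: "c \<le> n" using ranked_card[OF rk] by simp
  \<comment> \<open>Unreached nodes have rank \<open>n\<close>, which is at least \<open>c\<close>,
    so they belong to no prefix considered here.\<close>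
  have pre: "{v. v < n \<and> rk v < k} = {v \<in> ?Z. rk v < k}" if "k \<le> c" for k
    using that c R(3) ZV[of n] by (auto simp: not_less) (metis leD order_trans)
  have inj: "inj_on rk ?Z" and img: "rk ` ?Z = {..<c}" using R(1) by (auto simp: bij_betw_def)
  have "card {v. v < n \<and> rk v < k} = k" if "k \<le> c" for k
  proof -
    have "rk ` {v \<in> ?Z. rk v < k} = {..<k}"
    proof
      show "{..<k} \<subseteq> rk ` {v \<in> ?Z. rk v < k}"
      proof
        fix i assume "i \<in> {..<k}"
        then have "i \<in> rk ` ?Z" using that img by simp
        then show "i \<in> rk ` {v \<in> ?Z. rk v < k}" using \<open>i \<in> {..<k}\<close> by auto
      qed
    qed auto
    moreover have "inj_on rk {v \<in> ?Z. rk v < k}" using inj by (rule inj_on_subset) auto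
    ultimately have "card {v \<in> ?Z. rk v < k} = card {..<k}" by (metis card_image)
    then show ?thesis unfolding pre[OF that] by simp
  qed
  moreover have "\<exists>k\<le>c. iball M x r = {v. v < n \<and> rk v < k}" for r
  proof -
    have sub: "iball M x r \<subseteq> ?Z" using removal_ball_stable[of "{..<n}" x edges M r] x by simp
    have Lr: "u \<in> iball M x r \<longleftrightarrow> L u \<le> Suc r" if u: "u \<in> ?Z" for u
    proof -
      have "L u = Suc (LEAST i. u \<in> iball M x i)" using L[of u] u ZV[of n] unfolding level_def by auto
      moreover have "u \<in> iball M x (LEAST i. u \<in> iball M x i)" using u by (rule LeastI)
      ultimately show ?thesis using Least_ball(1)[of u M x r] removal_ball_mono[of _ r "{..<n}" edges M x] by auto
    qed
    have fin: "finite (iball M x r)" using finite_subset[OF ZV[of r]] by simp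
    let ?A = "rk ` iball M x r"
    have "?A = {..<card ?A}"
    proof (rule down_closed_eq_lessThan)
      fix i j assume i: "i \<in> ?A" and j: "j < i"
      obtain u where u: "u \<in> iball M x r" "i = rk u" using i by auto
      have "i < c" using u sub img by blast
      then obtain w where w: "w \<in> ?Z" "j = rk w" using img j by (metis imageE lessThan_iff less_trans)
      have "\<not> L u < L w" using R(2)[of u w] u w sub j by auto
      then have "w \<in> iball M x r" using Lr[OF w(1)] Lr[of u] u sub by auto
      then show "j \<in> ?A" using w by simp
    qed (use fin in simp)
    then have A: "rk u < card ?A \<longleftrightarrow> u \<in> iball M x r" if "u \<in> ?Z" for u
      using that inj sub by (metis inj_on_image_mem_iff lessThan_iff)
    have le: "card ?A \<le> c"
    proof -
      have "?A \<subseteq> {..<c}" using sub img by blast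
      then show ?thesis using card_mono[of "{..<c}" ?A] by simp
    qed
    have "iball M x r = {v. v < n \<and> rk v < card ?A}" unfolding pre[OF le] using A sub by auto
    then show ?thesis using le by blast
  qed
  ultimately show ?thesis unfolding ball_chain_def by auto
qed

lemma node_boundary_prefix:
  fixes rk nb :: "nat \<Rightarrow> nat"
  assumes nb: "\<And>v. v < n \<Longrightarrow> nb v < k \<longleftrightarrow> (\<exists>e<m. tgt e = v \<and> rk (src e) < k \<or> src e = v \<and> rk (tgt e) < k)"
  shows "node_boundary {..<n} edges {v. v < n \<and> rk v < k} = {v. v < n \<and> nb v < k \<and> k \<le> rk v}"
proof -
  have "(\<exists>u\<in>{v. v < n \<and> rk v < k}. {u, v} \<in> edges) \<longleftrightarrow> nb v < k" if v: "v < n" for v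
    unfolding nb[OF v] edges_def using src tgt by (auto simp: doubleton_eq_iff)
  then show ?thesis unfolding node_boundary_def by (auto simp: not_less)
qed

text \<open>Optimality relative to one search: the stored ratio \<open>bB / bk\<close> is at most
  every eligible ratio of the order that this search produced.\<close>

definition covers :: "state \<Rightarrow> nat set \<Rightarrow> nat \<Rightarrow> bool" where
  "covers s M x \<longleftrightarrow> (\<exists>c P. ball_chain {..<n} edges M x c P \<and>
     (\<forall>k. eligible (vars s ''D'') c (\<lambda>k. bnd (P k)) k \<longrightarrow> vars s ''bB'' * k \<le> bnd (P k) * vars s ''bk''))"

text \<open>Soundness of the output, with the search it comes from left open. The value
  \<open>bk = 0\<close> represents an infinite ratio, before any family has been written.\<close>

definition outcome :: "nat \<Rightarrow> nat \<Rightarrow> state \<Rightarrow> bool" where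
  "outcome p q s \<longleftrightarrow> (0 < vars s ''bk'' \<or> 0 < vars s ''bB'') \<and> (0 < vars s ''bk'' \<longrightarrow>
     (\<exists>M x c P \<kappa>. x \<in> {p, q} \<and> ball_chain {..<n} edges M x c P \<and> vars s ''D'' < 64 * vars s ''t'' \<and>
       (\<forall>j\<in>{1..vars s ''t''}. valid c (\<kappa> j) \<and> bnd (P (\<kappa> j)) * vars s ''bk'' \<le> vars s ''bB'' * \<kappa> j \<and>
          {v. v < n \<and> arrs s ''out'' (j * n + v) = 1} = P (\<kappa> j)) \<and>
       (\<forall>i j. 1 \<le> i \<longrightarrow> i < j \<longrightarrow> j \<le> vars s ''t'' \<longrightarrow> \<kappa> i < \<kappa> j)))"

lemma rivals_cong:
  assumes "\<And>k. k < n \<Longrightarrow> B k = B' k" "valid c k" shows "rivals c B k = rivals c B' k"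
proof -
  have "B j = B' j" if "valid c j" for j using assms(1) valid_less[OF that] .
  then show ?thesis using assms(2) unfolding rivals_def by auto
qed

lemma eligible_cong: "(\<And>k. k < n \<Longrightarrow> B k = B' k) \<Longrightarrow> eligible D c B k \<longleftrightarrow> eligible D c B' k"
  unfolding eligible_def using rivals_cong by metis

lemma runs_family:
  assumes s: "ready s" and x: "vars s ''x'' < n" "vars s ''x'' \<in> {p, q}" and out: "outcome p q s"
  shows "runs W family s (100 * (n * n + n * m)) (\<lambda>s'.
     frame {''v'', ''r'', ''e'', ''cnt'', ''k'', ''b'', ''j'', ''z'', ''imp'', ''bk'', ''bB'', ''t''}
       {''L'', ''rk'', ''nb'', ''B'', ''out''} s s' \<and>
     outcome p q s' \<and> covers s' (masked s) (vars s ''x'') \<and> (\<forall>M y. covers s M y \<longrightarrow> covers s' M y))"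
proof -
  define M where "M = masked s"
  define y where "y = vars s ''x''"
  obtain T1 s1 where e1: "exec W init_levels s T1 s1" "T1 \<le> n * 4 + 3" and f1: "frame {''v''} {''L''} s s1"
    and L1: "\<forall>v<n. arrs s1 ''L'' v = level M y 0 v"
    using runs_init_levels[OF s x(1)] unfolding M_def y_def by (rule runsE) blast
  have s1: "ready s1" by (rule ready_frame[OF f1 s]) auto
  obtain T2 s2 where e2: "exec W levels s1 T2 s2" "T2 \<le> n * (m * 5 + 4) + 2" and f2: "frame {''r'', ''e''} {''L''} s1 s2"
    and L2: "\<forall>v<n. arrs s2 ''L'' v = level M y n v"
    using runs_levels[OF s1 L1] by (rule runsE) blast
  have s2: "ready s2" by (rule ready_frame[OF f2 s1]) auto
  obtain T3 s3 where e3: "exec W ranks s2 T3 s3" "T3 \<le> n * 3 + 3 + ((n + 1) * (n * 5 + 4) + 2)"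
    and f3: "frame {''v'', ''r'', ''cnt''} {''rk''} s2 s3"
    and R3: "ranked (arrs s2 ''L'') (seen (arrs s2 ''L'') (n + 1) 0) (arrs s3 ''rk'') (vars s3 ''cnt'')"
    using runs_ranks[OF s2] by (rule runsE) blast
  have s3: "ready s3" by (rule ready_frame[OF f3 s2]) auto
  define rk c P where "rk = arrs s3 ''rk''" and "c = vars s3 ''cnt''" and "P k = {v. v < n \<and> rk v < k}" for k
  have chain: "ball_chain {..<n} edges M y c P"
    using ranked_ball_chain[OF _ _ R3] L2 x(1) unfolding P_def rk_def c_def y_def by simp
  have rkn: "\<forall>v<n. arrs s3 ''rk'' v \<le> n"
  proof (intro allI impI)
    fix v assume v: "v < n"
    show "arrs s3 ''rk'' v \<le> n"
    proof (cases "v \<in> seen (arrs s2 ''L'') (n + 1) 0")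
      case True
      then have "arrs s3 ''rk'' v < vars s3 ''cnt''" using R3 unfolding ranked_def by (auto dest: bij_betwE)
      then show ?thesis using ranked_card[OF R3] by simp
    next
      case False
      then show ?thesis using R3 v unfolding ranked_def by simp
    qed
  qed
  obtain T4 s4 where e4: "exec W neighbours s3 T4 s4" "T4 \<le> n * 3 + 2 + (m * 6 + 2)"
    and f4: "frame {''v'', ''e''} {''nb''} s3 s4"
    and N4: "\<forall>v<n. \<forall>i\<le>n. arrs s4 ''nb'' v < i \<longleftrightarrow>
        (\<exists>e<m. tgt e = v \<and> arrs s3 ''rk'' (src e) < i \<or> src e = v \<and> arrs s3 ''rk'' (tgt e) < i)"
    using runs_neighbours[OF s3 rkn] by (elim runsE conjE) (rule that; assumption)
  have s4: "ready s4" by (rule ready_frame[OF f4 s3]) auto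
  obtain T5 s5 where e5: "exec W boundaries s4 T5 s5" "T5 \<le> n * (n * 4 + 6) + 2"
    and f5: "frame {''v'', ''k'', ''b''} {''B''} s4 s5"
    and B5: "\<forall>k<n. arrs s5 ''B'' k = card {v. v < n \<and> arrs s4 ''nb'' v < k \<and> k \<le> arrs s4 ''rk'' v}"
    using runs_boundaries[OF s4] by (rule runsE) blast
  have s5: "ready s5" by (rule ready_frame[OF f5 s4]) auto
  have f35: "frame {''v'', ''e'', ''k'', ''b''} {''nb'', ''B''} s3 s5"
    by (rule frame_mono[OF frame_trans[OF f4 f5]]) auto
  have B: "arrs s5 ''B'' k = bnd (P k)" if "k < n" for k
  proof -
    have "arrs s4 ''rk'' = rk" using f4 unfolding rk_def by (simp add: frame_def)
    then show ?thesis using B5 that node_boundary_prefix[of "arrs s4 ''nb''" k rk] N4[folded rk_def] unfolding P_def by simp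
  qed
  have "bnd S \<le> n" for S
    using card_mono[of "{..<n}" "node_boundary {..<n} edges S"] by (simp add: node_boundary_def subset_iff)
  then have Bn: "\<forall>k<n. arrs s5 ''B'' k \<le> n" using B by simp
  have f05: "frame {''v'', ''r'', ''e'', ''cnt'', ''k'', ''b''} {''L'', ''rk'', ''nb'', ''B''} s s5"
    by (rule frame_mono[OF frame_trans[OF frame_trans[OF frame_trans[OF f1 f2] f3] f35]]) auto
  define D where "D = vars s ''D''"
  have eq5: "vars s5 ''bk'' = vars s ''bk''" "vars s5 ''bB'' = vars s ''bB''" "vars s5 ''D'' = D"
     "vars s5 ''t'' = vars s ''t''" "arrs s5 ''out'' = arrs s ''out''"
    using f05 unfolding D_def by (auto simp: frame_def)
  have eq5': "vars s5 ''cnt'' = c" "arrs s5 ''rk'' = rk"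
    using f35 unfolding c_def rk_def by (auto simp: frame_def)
  have best5: "0 < vars s5 ''bk'' \<or> 0 < vars s5 ''bB''" using out eq5 unfolding outcome_def by simp
  have elig: "eligible D c (arrs s5 ''B'') k \<longleftrightarrow> eligible D c (\<lambda>k. bnd (P k)) k" for k
    by (rule eligible_cong) (rule B)
  obtain T6 s6 where e6: "exec W select_best s5 T6 s6" "T6 \<le> n * (n * 4 + 10) + 3"
    and f6: "frame {''k'', ''j'', ''z'', ''imp'', ''bk'', ''bB''} {} s5 s6"
    and best6: "0 < vars s6 ''bk'' \<or> 0 < vars s6 ''bB''"
    and mono6: "vars s6 ''bB'' * vars s ''bk'' \<le> vars s ''bB'' * vars s6 ''bk''"
    and cov6: "\<forall>k. eligible D c (arrs s5 ''B'') k \<longrightarrow> vars s6 ''bB'' * k \<le> arrs s5 ''B'' k * vars s6 ''bk''"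
    and imp6: "vars s6 ''imp'' = 0 \<and> vars s6 ''bk'' = vars s ''bk'' \<and> vars s6 ''bB'' = vars s ''bB'' \<or>
      vars s6 ''imp'' = 1 \<and> eligible D c (arrs s5 ''B'') (vars s6 ''bk'') \<and>
        vars s6 ''bB'' = arrs s5 ''B'' (vars s6 ''bk'')"
    using runs_select_best[OF readyD(1)[OF s5] Bn best5] unfolding eq5 eq5'
    by (elim runsE conjE) (rule that; assumption)
  have s6: "ready s6" by (rule ready_frame[OF f6 s5]) auto
  obtain T7 s7 where e7: "exec W output_best s6 T7 s7" "T7 \<le> n * (n * 4 + 6) + 4"
    and f7: "frame {''k'', ''v'', ''t''} {''out''} s6 s7"
    and o7: "if vars s6 ''imp'' = 0 then s7 = s6
      else rows (chosen (vars s6 ''cnt'') (arrs s6 ''B'') (vars s6 ''bB'') (vars s6 ''bk'')) (arrs s6 ''rk'') (vars s7 ''t'') (arrs s7 ''out'')"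
    using runs_output_best[OF readyD(1)[OF s6]] by (rule runsE) blast
  have eq6: "vars s6 ''cnt'' = c" "arrs s6 ''rk'' = rk" "arrs s6 ''B'' = arrs s5 ''B''" "vars s6 ''D'' = D"
      "vars s6 ''t'' = vars s ''t''" "arrs s6 ''out'' = arrs s ''out''"
    using f6 eq5 eq5' by (auto simp: frame_def)
  have eq7: "vars s7 ''bk'' = vars s6 ''bk''" "vars s7 ''bB'' = vars s6 ''bB''" "vars s7 ''D'' = D"
    using f7 eq6 by (auto simp: frame_def)
  have "exec W family s (T1 + (T2 + (T3 + (T4 + (T5 + (T6 + T7)))))) s7"
    unfolding family_def using e1(1) e2(1) e3(1) e4(1) e5(1) e6(1) e7(1) by (intro exec.Seq)
  moreover have "T1 + (T2 + (T3 + (T4 + (T5 + (T6 + T7))))) \<le> 100 * (n * n + n * m)"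
  proof -
    define N K where "N = n * n" and "K = n * m"
    have N: "1 \<le> N" "n \<le> N" "m \<le> K" using n unfolding N_def K_def by auto
    have "T2 \<le> 5 * K + 4 * n + 2" "T3 \<le> 5 * N + 12 * n + 9" "T5 \<le> 4 * N + 6 * n + 2"
      "T6 \<le> 4 * N + 10 * n + 3" "T7 \<le> 4 * N + 6 * n + 4"
      using e2(2) e3(2) e5(2) e6(2) e7(2) unfolding N_def K_def by (auto simp: algebra_simps)
    then have "T1 + (T2 + (T3 + (T4 + (T5 + (T6 + T7))))) \<le> 17 * N + 5 * K + 45 * n + 6 * m + 27"
      using e1(2) e4(2) by simp
    also have "\<dots> \<le> 100 * (N + K)" using N by simp
    finally show ?thesis unfolding N_def K_def .
  qed
  moreover have "frame {''v'', ''r'', ''e'', ''cnt'', ''k'', ''b'', ''j'', ''z'', ''imp'', ''bk'', ''bB'', ''t''}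
       {''L'', ''rk'', ''nb'', ''B'', ''out''} s s7"
    by (rule frame_mono[OF frame_trans[OF frame_trans[OF f05 f6] f7]]) auto
  moreover have "covers s7 M y"
    unfolding covers_def eq7
  proof (intro exI conjI allI impI)
    show "ball_chain {..<n} edges M y c P" by (rule chain)
    fix k assume el: "eligible D c (\<lambda>k. bnd (P k)) k"
    then have "k < n" unfolding eligible_def by (auto dest: valid_less)
    then show "vars s6 ''bB'' * k \<le> bnd (P k) * vars s6 ''bk''"
      using cov6[rule_format, of k] el elig[of k] B[of k] by simp
  qed
  moreover have "covers s7 M' y'" if "covers s M' y'" for M' y'
  proof -
    \<comment> \<open>The stored ratio never increases, so searches covered earlier remain
      covered.\<close>
    have "vars s6 ''bB'' * k \<le> b * vars s6 ''bk''" if "vars s ''bB'' * k \<le> b * vars s ''bk''" for k b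
      using ratio_trans[OF mono6 that] out unfolding outcome_def by simp
    then show ?thesis using that unfolding covers_def eq7 D_def[symmetric] by meson
  qed
  moreover have "outcome p q s7"
  proof (cases "vars s6 ''imp'' = 0")
    case True
    then have "s7 = s6" "vars s6 ''bk'' = vars s ''bk''" "vars s6 ''bB'' = vars s ''bB''" using o7 imp6 by auto
    then show ?thesis using out eq6 unfolding outcome_def D_def by simp
  next
    case False
    define K where "K = chosen c (arrs s5 ''B'') (vars s6 ''bB'') (vars s6 ''bk'')"
    have rows: "rows K rk (vars s7 ''t'') (arrs s7 ''out'')" using o7 False unfolding eq6 K_def by simp
    have el: "eligible D c (arrs s5 ''B'') (vars s6 ''bk'')" "vars s6 ''bB'' = arrs s5 ''B'' (vars s6 ''bk'')"
      using imp6 False by auto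
    \<comment> \<open>The new threshold is the ratio of \<open>bk\<close> itself, so the written
      sizes are exactly its rivals, which eligibility has counted.\<close>
    have "rivals c (arrs s5 ''B'') (vars s6 ''bk'') = K" unfolding rivals_def K_def chosen_def el(2) ..
    then have Dt: "D < 64 * vars s7 ''t''" using el(1) rows unfolding eligible_def rows_def by simp
    obtain \<kappa> where \<kappa>: "\<And>j. j \<in> {1..vars s7 ''t''} \<Longrightarrow> \<kappa> j \<in> K"
      "\<And>j v. j \<in> {1..vars s7 ''t''} \<Longrightarrow> v < n \<Longrightarrow> arrs s7 ''out'' (j * n + v) = (if rk v < \<kappa> j then 1 else 0)"
      "\<And>i j. 1 \<le> i \<Longrightarrow> i < j \<Longrightarrow> j \<le> vars s7 ''t'' \<Longrightarrow> \<kappa> i < \<kappa> j"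
      using rows unfolding rows_def by blast
    have "valid c (\<kappa> j) \<and> bnd (P (\<kappa> j)) * vars s6 ''bk'' \<le> vars s6 ''bB'' * \<kappa> j \<and>
        {v. v < n \<and> arrs s7 ''out'' (j * n + v) = 1} = P (\<kappa> j)" if j: "j \<in> {1..vars s7 ''t''}" for j
    proof (intro conjI)
      show v: "valid c (\<kappa> j)" using \<kappa>(1)[OF j] unfolding K_def chosen_def by simp
      show "bnd (P (\<kappa> j)) * vars s6 ''bk'' \<le> vars s6 ''bB'' * \<kappa> j"
        using \<kappa>(1)[OF j] B[OF valid_less[OF v]] unfolding K_def chosen_def by simp
      show "{v. v < n \<and> arrs s7 ''out'' (j * n + v) = 1} = P (\<kappa> j)"
        unfolding P_def using \<kappa>(2)[OF j] by (auto split: if_splits)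
    qed
    then show ?thesis unfolding outcome_def eq7 using chain Dt \<kappa>(3) best6 x(2)
      unfolding y_def[symmetric] by (intro conjI impI exI[of _ M] exI[of _ y] exI[of _ c] exI[of _ P] exI[of _ \<kappa>]) auto
  qed
  ultimately show ?thesis unfolding runs_def M_def y_def by blast
qed

end

section \<open>The complete program and its running time\<close>

definition distances :: "string \<Rightarrow> com" where
  "distances a = Seq init_levels (Seq levels
     (For ''v'' (Var ''n'') (Write a (Var ''v'') (Sub (Read ''L'' (Var ''v'')) (Const 1)))))"

definition families :: com where
  "families = For ''f'' (Var ''n'')
     (Seq (Assign ''x'' (Var ''p'')) (Seq family (Seq (Assign ''x'' (Var ''q'')) family)))"

definition main_prog :: com where
  "main_prog = Seq (Assign ''x'' (Var ''p'')) (Seq (distances ''dp'')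
     (Seq (Assign ''x'' (Var ''q'')) (Seq (distances ''dq'')
     (Seq (Assign ''D'' (Read ''dp'' (Var ''q''))) (Seq (Assign ''bB'' (Const 1)) families)))))"

context ram
begin

lemma level_le: "level M x n v \<le> n + 2"
  using Least_ball(1)[of v M x n] unfolding level_def by auto

lemma runs_distances:
  assumes s: "ready s" and x: "vars s ''x'' < n" and M: "masked s = {}" and a: "a \<notin> {''src'', ''tgt'', ''L''}"
  shows "runs W (distances a) s (30 * (n * n + n * m)) (\<lambda>s'. frame {''v'', ''r'', ''e''} {''L'', a} s s' \<and>
     (\<forall>v<n. arrs s' a v = level {} (vars s ''x'') n v - 1))"
proof -
  obtain T1 s1 where e1: "exec W init_levels s T1 s1" "T1 \<le> n * 4 + 3" and f1: "frame {''v''} {''L''} s s1"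
    and L1: "\<forall>v<n. arrs s1 ''L'' v = level {} (vars s ''x'') 0 v"
    using runs_init_levels[OF s x] unfolding M by (rule runsE) blast
  have s1: "ready s1" by (rule ready_frame[OF f1 s]) auto
  obtain T2 s2 where e2: "exec W levels s1 T2 s2" "T2 \<le> n * (m * 5 + 4) + 2" and f2: "frame {''r'', ''e''} {''L''} s1 s2"
    and L2: "\<forall>v<n. arrs s2 ''L'' v = level {} (vars s ''x'') n v"
    using runs_levels[OF s1 L1] by (rule runsE) blast
  have s2: "ready s2" by (rule ready_frame[OF f2 s1]) auto
  have "runs W (For ''v'' (Var ''n'') (Write a (Var ''v'') (Sub (Read ''L'' (Var ''v'')) (Const 1)))) s2 (n * 3 + 2)
     (\<lambda>s'. frame {''v''} {a} s2 s' \<and> (\<forall>v<n. arrs s' a v = level {} (vars s ''x'') n v - 1))"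
  proof (rule runs_For[where T = 1 and N = n and I = "\<lambda>k s'. frame {''v''} {a} s2 s' \<and>
      (\<forall>v<k. arrs s' a v = level {} (vars s ''x'') n v - 1)"], goal_cases)
    case (1 k s')
    have "arrs s' ''L'' k = level {} (vars s ''x'') n k" using 1 L2 a by (auto simp: frame_def)
    moreover have "level {} (vars s ''x'') n k - 1 < W" using level_le[of "{}" "vars s ''x''" k] bounds by linarith
    ultimately show ?case using 1 bounds by (auto simp: frame_def less_Suc_eq)
  qed (use readyD(1)[OF s2] bounds in \<open>auto simp: frame_def\<close>)
  then obtain T3 s3 where e3: "exec W (For ''v'' (Var ''n'') (Write a (Var ''v'') (Sub (Read ''L'' (Var ''v'')) (Const 1)))) s2 T3 s3"
    "T3 \<le> n * 3 + 2" and f3: "frame {''v''} {a} s2 s3" and L3: "\<forall>v<n. arrs s3 a v = level {} (vars s ''x'') n v - 1"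
    by (rule runsE) blast
  have "exec W (distances a) s (T1 + (T2 + T3)) s3"
    unfolding distances_def using e1(1) e2(1) e3(1) by (intro exec.Seq)
  moreover have "T1 + (T2 + T3) \<le> 30 * (n * n + n * m)"
  proof -
    define N K where "N = n * n" and "K = n * m"
    have N: "1 \<le> N" "n \<le> N" using n unfolding N_def by auto
    have "T2 \<le> 5 * K + 4 * n + 2" using e2(2) unfolding K_def by (simp add: algebra_simps)
    then have "T1 + (T2 + T3) \<le> 5 * K + 11 * n + 7" using e1(2) e3(2) by simp
    also have "\<dots> \<le> 30 * (N + K)" using N by simp
    finally show ?thesis unfolding N_def K_def .
  qed
  moreover have "frame {''v'', ''r'', ''e''} {''L'', a} s s3"
    by (rule frame_mono[OF frame_trans[OF frame_trans[OF f1 f2] f3]]) auto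
  ultimately show ?thesis using L3 unfolding runs_def by blast
qed

definition mask_at :: "state \<Rightarrow> nat \<Rightarrow> nat set" where
  "mask_at s f = masked (s\<lparr>vars := (vars s)(''f'' := f)\<rparr>)"

definition fam_vars :: "string set" where
  "fam_vars = {''v'', ''r'', ''e'', ''cnt'', ''k'', ''b'', ''j'', ''z'', ''imp'', ''bk'', ''bB'', ''t''}"

definition fam_arrs :: "string set" where
  "fam_arrs = {''L'', ''rk'', ''nb'', ''B'', ''out''}"

lemma covers_frame:
  assumes "frame (- {''D'', ''bB'', ''bk''}) A s s'" shows "covers s' M x \<longleftrightarrow> covers s M x"
  using assms unfolding covers_def frame_def by simp

lemma outcome_frame:
  assumes "frame (- {''D'', ''bB'', ''bk'', ''t''}) (- {''out''}) s s'" shows "outcome p q s' \<longleftrightarrow> outcome p q s"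
  using assms unfolding outcome_def frame_def by simp

lemma runs_families:
  assumes s: "ready s" and p: "vars s ''p'' = p" "p < n" and q: "vars s ''q'' = q" "q < n" and out: "outcome p q s"
  shows "runs W families s (n * (200 * (n * n + n * m) + 4) + 2) (\<lambda>s'. outcome p q s' \<and> vars s' ''D'' = vars s ''D'' \<and>
     (\<forall>f<n. \<forall>x\<in>{p, q}. covers s' (mask_at s f) x))"
  unfolding families_def
proof (rule runs_For[where T = "200 * (n * n + n * m) + 2" and N = n and I = "\<lambda>k s'.
    frame ({''f'', ''x''} \<union> fam_vars) fam_arrs s s' \<and> outcome p q s' \<and> (\<forall>f<k. \<forall>x\<in>{p, q}. covers s' (mask_at s f) x)"], goal_cases)
  case (1 k s1)
  let ?F = "frame ({''f'', ''x''} \<union> fam_vars) fam_arrs"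
  have upd: "?F s (s'\<lparr>vars := (vars s')(y := v)\<rparr>)" if "?F s s'" "y \<in> {''f'', ''x''}" for s' y v
    using that by (auto simp: frame_def)
  have keep: "outcome p q (s'\<lparr>vars := (vars s')(y := v)\<rparr>) \<longleftrightarrow> outcome p q s'"
     "covers (s'\<lparr>vars := (vars s')(y := v)\<rparr>) M x \<longleftrightarrow> covers s' M x" if "y \<in> {''f'', ''x''}" for s' y v M x
    using that by (auto intro!: outcome_frame covers_frame simp: frame_def)
  have rd: "ready s'" "vars s' ''p'' = p" "vars s' ''q'' = q" "masked s' = mask_at s (vars s' ''f'')" if "?F s s'" for s'
    using that s p q unfolding fam_vars_def fam_arrs_def
    by (auto simp: frame_def ready_def mask_at_def masked_def)
  have W': "p < W" "q < W" using p q bounds by auto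
  define s2 where "s2 = s1\<lparr>vars := (vars s1)(''x'' := p)\<rparr>"
  have F2: "?F s s2" "vars s2 ''x'' = p" "vars s2 ''f'' = k" using upd[of s1 "''x''"] 1 unfolding s2_def by auto
  have o2: "outcome p q s2" "\<And>M x. covers s2 M x \<longleftrightarrow> covers s1 M x" using keep 1 unfolding s2_def by auto
  have "runs W family s2 (100 * (n * n + n * m)) (\<lambda>s'. frame fam_vars fam_arrs s2 s' \<and>
     outcome p q s' \<and> covers s' (masked s2) (vars s2 ''x'') \<and> (\<forall>M y. covers s2 M y \<longrightarrow> covers s' M y))"
    unfolding fam_vars_def fam_arrs_def by (rule runs_family[OF rd(1)[OF F2(1)] _ _ o2(1)]) (use F2 p in auto)
  then obtain T3 s3 where e3: "exec W family s2 T3 s3" "T3 \<le> 100 * (n * n + n * m)" and f3: "frame fam_vars fam_arrs s2 s3"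
    and o3: "outcome p q s3" "covers s3 (mask_at s k) p" "\<And>M y. covers s1 M y \<Longrightarrow> covers s3 M y"
    unfolding rd(4)[OF F2(1)] F2 o2(2) by (rule runsE) blast
  have F3: "?F s s3" by (rule frame_mono[OF frame_trans[OF F2(1) f3]]) auto
  have f3k: "vars s3 ''f'' = k" using f3 F2(3) unfolding fam_vars_def by (simp add: frame_def)
  define s4 where "s4 = s3\<lparr>vars := (vars s3)(''x'' := q)\<rparr>"
  have F4: "?F s s4" "vars s4 ''x'' = q" "vars s4 ''f'' = k" using upd[of s3 "''x''"] F3 f3k unfolding s4_def by auto
  have o4: "outcome p q s4" "\<And>M x. covers s4 M x \<longleftrightarrow> covers s3 M x" using keep o3 unfolding s4_def by auto
  have "runs W family s4 (100 * (n * n + n * m)) (\<lambda>s'. frame fam_vars fam_arrs s4 s' \<and>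
     outcome p q s' \<and> covers s' (masked s4) (vars s4 ''x'') \<and> (\<forall>M y. covers s4 M y \<longrightarrow> covers s' M y))"
    unfolding fam_vars_def fam_arrs_def by (rule runs_family[OF rd(1)[OF F4(1)] _ _ o4(1)]) (use F4 q in auto)
  then obtain T5 s5 where e5: "exec W family s4 T5 s5" "T5 \<le> 100 * (n * n + n * m)" and f5: "frame fam_vars fam_arrs s4 s5"
    and o5: "outcome p q s5" "covers s5 (mask_at s k) q" "\<And>M y. covers s3 M y \<Longrightarrow> covers s5 M y"
    unfolding rd(4)[OF F4(1)] F4 o4(2) by (rule runsE) blast
  have F5: "?F s s5" by (rule frame_mono[OF frame_trans[OF F4(1) f5]]) auto
  have f5k: "vars s5 ''f'' = k" using f5 F4(3) unfolding fam_vars_def by (simp add: frame_def)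
  have "exec W (Assign ''x'' (Var ''p'')) s1 1 s2"
    unfolding exec_Assign_iff s2_def using rd(2)[of s1] 1(2) W' by simp
  moreover have "exec W (Assign ''x'' (Var ''q'')) s3 1 s4"
    unfolding exec_Assign_iff s4_def using rd(3)[OF F3] W' by simp
  ultimately have "exec W (Seq (Assign ''x'' (Var ''p'')) (Seq family (Seq (Assign ''x'' (Var ''q'')) family)))
      s1 (1 + (T3 + (1 + T5))) s5"
    using e3(1) e5(1) by (intro exec.Seq)
  moreover have "1 + (T3 + (1 + T5)) \<le> 200 * (n * n + n * m) + 2" using e3(2) e5(2) by simp
  moreover have "covers s5 (mask_at s f) x" if "f < Suc k" "x \<in> {p, q}" for f x
    using that 1(2) o3 o5 by (cases "f = k") auto
  ultimately show ?case using F5 f5k o5(1) keep upd[OF F5]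
    unfolding runs_def by (intro exI[of _ "1 + (T3 + (1 + T5))"] exI[of _ s5]) simp
next
  case 2
  show ?case using out by (simp add: frame_def) (subst outcome_frame[where s = s], auto simp: frame_def)
next
  case 6 show ?case by (simp add: algebra_simps)
qed (use bounds in \<open>auto simp: readyD[OF s] frame_def fam_vars_def\<close>)

end

section \<open>Translation to the encoded graph\<close>

text \<open>Selects the worst of the cheap prefixes: all the others are then its rivals, which makes
  it eligible.\<close>

lemma ex_max_ratio:
  fixes b :: "nat \<Rightarrow> nat"
  assumes "finite K" "K \<noteq> {}" "0 \<notin> K" shows "\<exists>k\<in>K. \<forall>j\<in>K. b j * k \<le> b k * j"
  using assms
proof (induction K rule: finite_ne_induct)
  case (insert x K)
  then obtain k where k: "k \<in> K" "\<And>j. j \<in> K \<Longrightarrow> b j * k \<le> b k * j" by auto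
  show ?case
  proof (cases "b x * k \<le> b k * x")
    case True
    then show ?thesis using k by auto
  next
    case False
    then have kx: "b k * x \<le> b x * k" by simp
    have "b j * x \<le> b x * j" if "j \<in> K" for j
    proof (rule ratio_trans[of _ k "b k"])
      show "b j * k \<le> b k * j" using k(2)[OF that] .
      show "b k * x \<le> b x * k" using kx .
      show "0 < k \<or> 0 < b k" using insert.prems k(1) by (metis insertCI neq0_conv)
    qed
    then show ?thesis by auto
  qed
qed simp

locale encoded_graph = conn_graph V E for V :: "'a set" and E +
  fixes p q :: 'a and \<nu> :: "nat \<Rightarrow> 'a" and s :: state
  assumes input: "input_state V E p q \<nu> s" and size: "3 \<le> card V"
begin

abbreviation "ip \<equiv> vars s ''p''"
abbreviation "iq \<equiv> vars s ''q''"

lemma \<nu>: "bij_betw \<nu> {..<card V} V" using input unfolding input_state_def by blast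

lemma ends: "ip < card V" "iq < card V" "\<nu> ip = p" "\<nu> iq = q"
  using input unfolding input_state_def by blast+

lemma \<nu>_in: "v < card V \<Longrightarrow> \<nu> v \<in> V" using \<nu> by (auto dest: bij_betwE)

lemma p: "p \<in> V" and q: "q \<in> V" using \<nu>_in ends by metis+

lemma edges_bound: "card E \<le> card V * card V"
proof -
  have "E \<subseteq> (\<lambda>(u, v). {u, v}) ` (V \<times> V)" using simple unfolding simple_graph_def by auto
  then have "card E \<le> card ((\<lambda>(u, v). {u, v}) ` (V \<times> V))" by (intro card_mono) auto
  also have "\<dots> \<le> card (V \<times> V)" by (intro card_image_le) auto
  finally show ?thesis by (simp add: card_cartesian_product)
qed

text \<open>At \<open>n = 2\<close> the first inequality would be \<open>8 < 8\<close>; the cubic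
  word bound therefore starts at three nodes.\<close>

lemma word_size: "card V * card V + card V + 2 < card V ^ 3" "card E < card V ^ 3"
proof -
  define n where "n = card V"
  have "3 * (n * n) \<le> n * (n * n)" "3 * n \<le> n * n" using size unfolding n_def by (auto intro: mult_right_mono)
  moreover have "n ^ 3 = n * (n * n)" by (simp add: power3_eq_cube)
  ultimately show "card V * card V + card V + 2 < card V ^ 3" using size unfolding n_def[symmetric] by linarith
  then show "card E < card V ^ 3" using edges_bound by linarith
qed

sublocale ram "card V" "card E" "card V ^ 3" "arrs s ''src''" "arrs s ''tgt''"
  by unfold_locales (use size word_size input in \<open>auto simp: input_state_def\<close>)

lemma edges_iff:
  assumes "u < card V" "v < card V" shows "{u, v} \<in> edges \<longleftrightarrow> {\<nu> u, \<nu> v} \<in> E"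
proof -
  let ?s = "arrs s ''src''" and ?t = "arrs s ''tgt''"
  have E: "E = (\<lambda>e. {\<nu> (?s e), \<nu> (?t e)}) ` {..<card E}"
    using input unfolding input_state_def bij_betw_def by metis
  have inj: "inj_on \<nu> {..<card V}" using \<nu> by (simp add: bij_betw_def)
  have "{\<nu> u, \<nu> v} = {\<nu> (?s e), \<nu> (?t e)} \<longleftrightarrow> {u, v} = {?s e, ?t e}" if "e < card E" for e
    using inj_on_image_eq_iff[OF inj, of "{u, v}" "{?s e, ?t e}"] assms src[OF that] tgt[OF that] by simp
  then show ?thesis unfolding edges_def by (subst E) auto
qed

text \<open>The intersection is taken because the masks computed from arrays are not restricted to
  node numbers.\<close>

definition lift :: "nat set \<Rightarrow> 'a set" where "lift M = \<nu> ` (M \<inter> {..<card V})"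

lemma lift_mem: "v < card V \<Longrightarrow> \<nu> v \<in> lift M \<longleftrightarrow> v \<in> M"
  using \<nu> unfolding lift_def bij_betw_def by (auto dest: inj_onD)

lemma lift_subset: "lift M \<subseteq> V" using \<nu>_in unfolding lift_def by auto

lemma V_eq: "V = \<nu> ` {..<card V}" using \<nu> by (simp add: bij_betw_def)

lemma lift_eqI:
  assumes "\<And>v. v < card V \<Longrightarrow> v \<in> M \<longleftrightarrow> \<nu> v \<in> A" "A \<subseteq> V" shows "lift M = A"
proof
  show "lift M \<subseteq> A" using assms(1) unfolding lift_def by auto
  show "A \<subseteq> lift M"
  proof
    fix a assume a: "a \<in> A"
    then obtain v where "v < card V" "a = \<nu> v" using assms(2) V_eq by blast
    then show "a \<in> lift M" using a assms(1) lift_mem by simp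
  qed
qed

lemma lift_card:
  assumes "M \<subseteq> {..<card V}" shows "card (lift M) = card M"
proof -
  have "inj_on \<nu> M" using \<nu> assms unfolding bij_betw_def by (blast intro: inj_on_subset)
  then show ?thesis unfolding lift_def using assms by (simp add: card_image inf_absorb1)
qed

lemma lift_mono: "M \<subseteq> M' \<Longrightarrow> lift M \<subseteq> lift M'" unfolding lift_def by auto

lemma lift_ball:
  assumes x: "x < card V" shows "lift (iball M x r) = removal_ball V E (lift M) (\<nu> x) r"
proof (induction r)
  case 0
  show ?case using x by (auto simp: lift_def)
next
  case (Suc r)
  have sub: "iball M x r \<subseteq> {..<card V}" using x by (intro removal_ball_subset) simp
  have IH: "removal_ball V E (lift M) (\<nu> x) r = \<nu> ` iball M x r"
    unfolding Suc[symmetric] unfolding lift_def using sub by (simp add: inf_absorb1)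
  show ?case
  proof (rule lift_eqI)
    show "removal_ball V E (lift M) (\<nu> x) (Suc r) \<subseteq> V" using \<nu>_in[OF x] by (rule removal_ball_subset)
    fix v assume v: "v < card V"
    have "(\<exists>u\<in>iball M x r. {u, v} \<in> edges) \<longleftrightarrow> (\<exists>u\<in>\<nu> ` iball M x r. {u, \<nu> v} \<in> E)"
      using sub edges_iff[OF _ v] by auto
    moreover have "v \<in> iball M x r \<longleftrightarrow> \<nu> v \<in> \<nu> ` iball M x r"
      using lift_mem[OF v, of "iball M x r"] sub unfolding lift_def by (simp add: inf_absorb1)
    ultimately show "v \<in> iball M x (Suc r) \<longleftrightarrow> \<nu> v \<in> removal_ball V E (lift M) (\<nu> x) (Suc r)"
      using v lift_mem[OF v, of M] \<nu>_in[OF v] by (simp add: IH)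
  qed
qed

lemma lift_boundary:
  assumes "S \<subseteq> {..<card V}" shows "card (node_boundary V E (lift S)) = bnd S"
proof -
  have "lift (node_boundary {..<card V} edges S) = node_boundary V E (lift S)"
  proof (rule lift_eqI)
    fix v assume v: "v < card V"
    have "(\<exists>u\<in>S. {u, v} \<in> edges) \<longleftrightarrow> (\<exists>u\<in>lift S. {u, \<nu> v} \<in> E)"
      using assms edges_iff[OF _ v] unfolding lift_def by auto
    then show "v \<in> node_boundary {..<card V} edges S \<longleftrightarrow> \<nu> v \<in> node_boundary V E (lift S)"
      using v lift_mem[OF v, of S] \<nu>_in[OF v] unfolding node_boundary_def by auto
  qed (auto simp: node_boundary_def)
  then show ?thesis using lift_card[of "node_boundary {..<card V} edges S"] by (auto simp: node_boundary_def)
qed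

lemma lift_ball_chain:
  assumes x: "x < card V" and ch: "ball_chain {..<card V} edges M x c P"
  shows "ball_chain V E (lift M) (\<nu> x) c (\<lambda>k. lift (P k))"
  unfolding ball_chain_def
proof (intro conjI allI impI)
  fix k assume k: "k \<le> c"
  then have "P k \<subseteq> {..<card V}" "card (P k) = k" using ch unfolding ball_chain_def by auto
  then show "lift (P k) \<subseteq> V" "card (lift (P k)) = k" using lift_subset lift_card by auto
next
  fix j k assume "j \<le> k" "k \<le> c"
  then show "lift (P j) \<subseteq> lift (P k)" using ch unfolding ball_chain_def by (intro lift_mono) blast
next
  fix r
  obtain k where "k \<le> c" "iball M x r = P k" using ch unfolding ball_chain_def by blast
  then show "\<exists>k\<le>c. removal_ball V E (lift M) (\<nu> x) r = lift (P k)" using lift_ball[OF x, of M r] by auto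
qed

lemma level_gdist:
  assumes "x < card V" "v < card V" shows "level {} x (card V) v = Suc (gd (\<nu> x) (\<nu> v))"
proof -
  have "lift {} = {}" by (simp add: lift_def)
  then have *: "v \<in> iball {} x r \<longleftrightarrow> gd (\<nu> x) (\<nu> v) \<le> r" for r
    using lift_mem[OF assms(2), of "iball {} x r"] lift_ball[OF assms(1), of "{}" r]
      removal_ball_gdist[OF \<nu>_in[OF assms(1)] \<nu>_in[OF assms(2)]] by simp
  moreover have "gd (\<nu> x) (\<nu> v) \<le> card V" using gdist_less_card[OF \<nu>_in[OF assms(1)] \<nu>_in[OF assms(2)]] by simp
  ultimately show ?thesis unfolding level_def by (simp add: Least_equality)
qed

lemma runs_main:
  "\<exists>T s'. exec (card V ^ 3) main_prog s T s' \<and> T \<le> 500 * (card V * (card V * card V + card V * card E)) \<and>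
     outcome ip iq s' \<and> vars s' ''D'' = gd p q \<and>
     (\<forall>f<card V. \<forall>x\<in>{ip, iq}. \<exists>M. lift M = cylinder V E p q f \<and> covers s' M x)"
proof -
  let ?n = "card V" and ?W = "card V ^ 3"
  have zero: "vars s x = 0" if "x \<notin> {''n'', ''m'', ''p'', ''q''}" for x using input that unfolding input_state_def by blast
  have s: "ready s" using input unfolding ready_def input_state_def by simp
  define s1 where "s1 = s\<lparr>vars := (vars s)(''x'' := ip)\<rparr>"
  have e1: "exec ?W (Assign ''x'' (Var ''p'')) s 1 s1" unfolding exec_Assign_iff s1_def using ends bounds by simp
  have s1: "ready s1" using s unfolding s1_def ready_def by simp
  \<comment> \<open>\<open>D\<close> and \<open>f\<close> are still 0, so the mask test fails
    everywhere and the same code computes distances in the full graph.\<close>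
  have m1: "masked s1 = {}" unfolding masked_def s1_def using zero by simp
  obtain T2 s2 where e2: "exec ?W (distances ''dp'') s1 T2 s2" "T2 \<le> 30 * (?n * ?n + ?n * card E)"
    and f2: "frame {''v'', ''r'', ''e''} {''L'', ''dp''} s1 s2" and L2: "\<forall>v<?n. arrs s2 ''dp'' v = level {} (vars s1 ''x'') ?n v - 1"
    by (rule runsE[OF runs_distances[OF s1 _ m1, of "''dp''"]]) (use ends in \<open>auto simp: s1_def\<close>)
  define s3 where "s3 = s2\<lparr>vars := (vars s2)(''x'' := iq)\<rparr>"
  have eq2: "vars s2 ''p'' = ip" "vars s2 ''q'' = iq" "vars s2 ''D'' = 0" "vars s2 ''f'' = 0" "vars s2 ''bk'' = 0"
    using f2 zero unfolding s1_def by (auto simp: frame_def)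
  have e3: "exec ?W (Assign ''x'' (Var ''q'')) s2 1 s3" unfolding exec_Assign_iff s3_def using ends eq2 bounds by simp
  have "ready s2" by (rule ready_frame[OF f2 s1]) auto
  then have s3: "ready s3" unfolding s3_def ready_def by simp
  have m3: "masked s3 = {}" unfolding masked_def s3_def using eq2 by simp
  obtain T4 s4 where e4: "exec ?W (distances ''dq'') s3 T4 s4" "T4 \<le> 30 * (?n * ?n + ?n * card E)"
    and f4: "frame {''v'', ''r'', ''e''} {''L'', ''dq''} s3 s4" and L4: "\<forall>v<?n. arrs s4 ''dq'' v = level {} (vars s3 ''x'') ?n v - 1"
    by (rule runsE[OF runs_distances[OF s3 _ m3, of "''dq''"]]) (use ends in \<open>auto simp: s3_def\<close>)
  have s4: "ready s4" by (rule ready_frame[OF f4 s3]) auto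
  have dq: "arrs s4 ''dq'' v = gd q (\<nu> v)" if "v < ?n" for v
    using L4 that level_gdist[OF ends(2) that] ends unfolding s3_def by simp
  have "arrs s4 ''dp'' = arrs s2 ''dp''" using f4 unfolding s3_def by (simp add: frame_def)
  then have dp: "arrs s4 ''dp'' v = gd p (\<nu> v)" if "v < ?n" for v
    using L2 that level_gdist[OF ends(1) that] ends unfolding s1_def by simp
  have eq4: "vars s4 ''p'' = ip" "vars s4 ''q'' = iq" "vars s4 ''bk'' = 0"
    using f4 eq2 unfolding s3_def by (auto simp: frame_def)
  define s6 where "s6 = s4\<lparr>vars := (vars s4)(''D'' := gd p q, ''bB'' := 1)\<rparr>"
  have D: "arrs s4 ''dp'' iq = gd p q" using dp[OF ends(2)] ends by simp
  have "gd p q < ?W" using gdist_less_card[OF p q] bounds by simp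
  then have e5: "exec ?W (Assign ''D'' (Read ''dp'' (Var ''q''))) s4 1 (s4\<lparr>vars := (vars s4)(''D'' := gd p q)\<rparr>)"
    unfolding exec_Assign_iff using eq4 D by simp
  have e6: "exec ?W (Assign ''bB'' (Const 1)) (s4\<lparr>vars := (vars s4)(''D'' := gd p q)\<rparr>) 1 s6"
    unfolding exec_Assign_iff s6_def using bounds by simp
  have s6: "ready s6" using s4 unfolding s6_def ready_def by simp
  \<comment> \<open>With \<open>bk = 0\<close> and \<open>bB = 1\<close> the stored ratio is
    infinite and nothing is claimed about the output array yet.\<close>
  have o6: "outcome ip iq s6" unfolding outcome_def s6_def using eq4 by simp
  have eq6: "vars s6 ''p'' = ip" "vars s6 ''q'' = iq" unfolding s6_def using eq4 by auto
  obtain T7 s7 where e7: "exec ?W families s6 T7 s7" "T7 \<le> ?n * (200 * (?n * ?n + ?n * card E) + 4) + 2"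
    and o7: "outcome ip iq s7" "vars s7 ''D'' = vars s6 ''D''" "\<forall>f<?n. \<forall>x\<in>{ip, iq}. covers s7 (mask_at s6 f) x"
    using runs_families[OF s6 eq6(1) ends(1) eq6(2) ends(2) o6] by (elim runsE conjE) (rule that; assumption)
  have "exec ?W main_prog s (1 + (T2 + (1 + (T4 + (1 + (1 + T7)))))) s7"
    unfolding main_prog_def using e1 e2(1) e3 e4(1) e5 e6 e7(1) by (intro exec.Seq)
  moreover have "1 + (T2 + (1 + (T4 + (1 + (1 + T7))))) \<le> 500 * (?n * (?n * ?n + ?n * card E))"
  proof -
    define N where "N = ?n * ?n + ?n * card E"
    have "1 \<le> ?n * ?n" using size by simp
    then have N1: "1 \<le> N" unfolding N_def by linarith
    have nN: "N \<le> ?n * N" "?n \<le> ?n * N" using size N1 by auto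
    have "T7 \<le> 200 * (?n * N) + 4 * ?n + 2" using e7(2) unfolding N_def[symmetric] by (simp add: algebra_simps)
    moreover have "T2 \<le> 30 * N" "T4 \<le> 30 * N" using e2(2) e4(2) unfolding N_def by auto
    ultimately show ?thesis using nN N1 unfolding N_def[symmetric] by linarith
  qed
  moreover have "lift (mask_at s6 f) = cylinder V E p q f" for f
  proof (rule lift_eqI)
    fix v assume "v < ?n"
    then show "v \<in> mask_at s6 f \<longleftrightarrow> \<nu> v \<in> cylinder V E p q f"
      using dp dq \<nu>_in unfolding mask_at_def masked_def cylinder_def s6_def by simp
  qed (rule cylinder_subset)
  moreover have "vars s7 ''D'' = gd p q" using o7(2) unfolding s6_def by simp
  ultimately show ?thesis using o7 by blast
qed

text \<open>The worst cheap prefix of the promising search is eligible, so coverage bounds the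
  stored ratio by \<open>\<theta>\<close>. The written sets may belong to another radius and centre,
  but their expansions are at most the stored ratio.\<close>

lemma main_correct:
  fixes \<theta> :: real
  assumes exec: "outcome ip iq s'" "vars s' ''D'' = gd p q"
    and cov: "\<forall>f<card V. \<forall>x\<in>{ip, iq}. \<exists>M. lift M = cylinder V E p q f \<and> covers s' M x"
    and f: "f < card V" and y: "y \<in> {p, q}"
    and cheap: "many_cheap V E (gd p q) (cylinder V E p q f) \<theta> y"
  shows "\<exists>t S. gd p q < 64 * t \<and> output_state V \<nu> s' t S \<and>
     (\<forall>j\<in>{1..t}. {} \<subset> S j \<and> S j \<subset> V \<and> 2 * card (S j) \<le> card V \<and> node_expansion V E (S j) \<le> \<theta>) \<and>
     (\<forall>j\<in>{1..<t}. S j \<subset> S (j + 1)) \<and> ((\<forall>j\<in>{1..t}. p \<in> S j) \<or> (\<forall>j\<in>{1..t}. q \<in> S j))"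
proof -
  define bk bB where "bk = vars s' ''bk''" and "bB = vars s' ''bB''"
  obtain x where x: "x \<in> {ip, iq}" "\<nu> x = y" "x < card V" using y ends by blast
  obtain M where M: "lift M = cylinder V E p q f" "covers s' M x" using cov f x by blast
  obtain c P where ch: "ball_chain {..<card V} edges M x c P"
    and el: "\<And>k. eligible (gd p q) c (\<lambda>k. bnd (P k)) k \<Longrightarrow> bB * k \<le> bnd (P k) * bk"
    using M(2) unfolding covers_def exec(2) bk_def bB_def by blast
  define K where "K = cheap V E c (\<lambda>k. lift (P k)) \<theta>"
  have PV: "P k \<subseteq> {..<card V}" if "k \<le> c" for k using ch that unfolding ball_chain_def by auto
  have K: "valid c k" "real (bnd (P k)) \<le> \<theta> * k" if "k \<in> K" for k
    using that lift_boundary[OF PV, of k] unfolding K_def cheap_def valid_def by auto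
  have many: "gd p q < 64 * card K" using cheap lift_ball_chain[OF x(3) ch] unfolding M(1) x(2) K_def many_cheap_def by blast
  then have "K \<noteq> {}" by auto
  then obtain k where k: "k \<in> K" "\<forall>j\<in>K. bnd (P j) * k \<le> bnd (P k) * j"
    using ex_max_ratio[of K "\<lambda>k. bnd (P k)"] K(1) unfolding K_def valid_def by fastforce
  have "K \<subseteq> rivals c (\<lambda>k. bnd (P k)) k" using k K(1) unfolding rivals_def by blast
  moreover have "finite (rivals c (\<lambda>k. bnd (P k)) k)"
    by (rule finite_subset[of _ "{..c}"]) (auto simp: rivals_def valid_def)
  ultimately have "card K \<le> card (rivals c (\<lambda>k. bnd (P k)) k)" by (intro card_mono)
  then have "eligible (gd p q) c (\<lambda>k. bnd (P k)) k" using many K(1)[OF k(1)] unfolding eligible_def by simp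
  then have best: "bB * k \<le> bnd (P k) * bk" by (rule el)
  have k0: "0 < k" using K(1)[OF k(1)] unfolding valid_def by simp
  \<comment> \<open>An infinite stored ratio would contradict \<open>best\<close>, as
    \<open>k\<close> is positive and \<open>bB\<close> would be too.\<close>
  have bk: "0 < bk"
    using best k0 exec(1) unfolding outcome_def bk_def bB_def by (cases "vars s' ''bk'' = 0") auto
  have "real bB * k \<le> \<theta> * k * bk"
  proof -
    have "real bB * k \<le> real (bnd (P k)) * bk" using best by (metis of_nat_le_iff of_nat_mult)
    also have "\<dots> \<le> \<theta> * k * bk" using K(2)[OF k(1)] by (intro mult_right_mono) auto
    finally show ?thesis .
  qed
  then have bB: "real bB \<le> \<theta> * bk" using k0 by (simp add: mult_ac)
  define t where "t = vars s' ''t''"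
  obtain M' x' c' P' \<kappa> where x': "x' \<in> {ip, iq}" and ch': "ball_chain {..<card V} edges M' x' c' P'"
    and t': "vars s' ''D'' < 64 * vars s' ''t''"
    and rows: "\<forall>j\<in>{1..vars s' ''t''}. valid c' (\<kappa> j) \<and> bnd (P' (\<kappa> j)) * vars s' ''bk'' \<le> vars s' ''bB'' * \<kappa> j \<and>
      {v. v < card V \<and> arrs s' ''out'' (j * card V + v) = 1} = P' (\<kappa> j)"
    and mono: "\<forall>i j. 1 \<le> i \<longrightarrow> i < j \<longrightarrow> j \<le> vars s' ''t'' \<longrightarrow> \<kappa> i < \<kappa> j"
    using exec(1)[unfolded outcome_def, THEN conjunct2, THEN mp, OF bk[unfolded bk_def]]
    by (elim exE conjE) (rule that; assumption)
  have t: "gd p q < 64 * t" using t' exec(2) unfolding t_def by simp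
  have \<kappa>: "valid c' (\<kappa> j)" "bnd (P' (\<kappa> j)) * bk \<le> bB * \<kappa> j"
      "{v. v < card V \<and> arrs s' ''out'' (j * card V + v) = 1} = P' (\<kappa> j)" if "j \<in> {1..t}" for j
    using rows that unfolding t_def bk_def bB_def by auto
  have \<kappa>_mono: "\<kappa> i < \<kappa> j" if "1 \<le> i" "i < j" "j \<le> t" for i j using mono that unfolding t_def by blast
  have x'V: "x' < card V" using x' ends by blast
  define S where "S j = lift {v. v < card V \<and> arrs s' ''out'' (j * card V + v) = 1}" for j
  have ch2: "ball_chain V E (lift M') (\<nu> x') c' (\<lambda>k. lift (P' k))" using lift_ball_chain[OF x'V ch'] .
  have S: "S j = lift (P' (\<kappa> j))" if "j \<in> {1..t}" for j unfolding S_def \<kappa>(3)[OF that] ..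
  have \<kappa>c: "1 \<le> \<kappa> j" "\<kappa> j \<le> c'" "2 * \<kappa> j \<le> card V" if "j \<in> {1..t}" for j
    using \<kappa>(1)[OF that] unfolding valid_def by auto
  have cS: "card (S j) = \<kappa> j" "S j \<subseteq> V" if "j \<in> {1..t}" for j
    using ch2 \<kappa>c(2)[OF that] unfolding ball_chain_def S[OF that] by auto
  have xS: "\<nu> x' \<in> S j" if "j \<in> {1..t}" for j
    unfolding S[OF that] using ball_chain_centre[OF ch2 \<kappa>c(1,2)[OF that]] .
  have "\<forall>j\<in>{1..t}. {} \<subset> S j \<and> S j \<subset> V \<and> 2 * card (S j) \<le> card V \<and> node_expansion V E (S j) \<le> \<theta>"
  proof (intro ballI conjI)
    fix j assume j: "j \<in> {1..t}"
    show "{} \<subset> S j" using xS[OF j] by blast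
    show half: "2 * card (S j) \<le> card V" using cS[OF j] \<kappa>c[OF j] by simp
    have "card (S j) < card V" using half \<kappa>c(1)[OF j] cS(1)[OF j] by linarith
    then show "S j \<subset> V" using cS(2)[OF j] by auto
    have "P' (\<kappa> j) \<subseteq> {..<card V}" using ch' \<kappa>c(2)[OF j] unfolding ball_chain_def by auto
    then have b: "card (node_boundary V E (S j)) = bnd (P' (\<kappa> j))" unfolding S[OF j] by (rule lift_boundary)
    have "real (bnd (P' (\<kappa> j))) * bk \<le> real bB * \<kappa> j" using \<kappa>(2)[OF j] by (metis of_nat_le_iff of_nat_mult)
    also have "\<dots> \<le> \<theta> * bk * \<kappa> j" using bB by (intro mult_right_mono) auto
    finally have "real (bnd (P' (\<kappa> j))) \<le> \<theta> * \<kappa> j" using bk by (simp add: mult_ac)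
    then show "node_expansion V E (S j) \<le> \<theta>"
      unfolding node_expansion_def b cS(1)[OF j] using \<kappa>c(1)[OF j] by (simp add: divide_le_eq)
  qed
  moreover have "\<forall>j\<in>{1..<t}. S j \<subset> S (j + 1)"
  proof
    fix j assume "j \<in> {1..<t}"
    then have j: "j \<in> {1..t}" "j + 1 \<in> {1..t}" by auto
    have lt: "\<kappa> j < \<kappa> (j + 1)" using \<kappa>_mono[of j "j + 1"] j by auto
    then have "S j \<subseteq> S (j + 1)" using ch2 \<kappa>c(2)[OF j(2)] unfolding ball_chain_def S[OF j(1)] S[OF j(2)] by auto
    moreover have "card (S j) \<noteq> card (S (j + 1))" using lt cS j by simp
    ultimately show "S j \<subset> S (j + 1)" by auto
  qed
  moreover have "output_state V \<nu> s' t S"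

  proof -
    have "{v. v < card V \<and> arrs s' ''out'' (j * card V + v) = 1} \<inter> {..<card V} =
        {v. v < card V \<and> arrs s' ''out'' (j * card V + v) = 1}" for j by auto
    then show ?thesis unfolding output_state_def t_def S_def lift_def by simp
  qed
  moreover have "(\<forall>j\<in>{1..t}. p \<in> S j) \<or> (\<forall>j\<in>{1..t}. q \<in> S j)" using xS x' ends by auto
  ultimately show ?thesis using t
    by - (rule exI[of _ t], rule exI[of _ S], intro conjI; assumption)
qed

end

section \<open>Running time, number of sets, and the theorem\<close>

lemma real_time_bound:
  fixes n m :: nat
  assumes "2 \<le> n" "T \<le> 500 * (n * (n * n + n * m))"
  shows "real T \<le> 500 * (real n ^ 3 * log 2 (real n) + real m * real n ^ 2)"
proof -
  have "real T \<le> real (500 * (n * (n * n + n * m)))" using assms(2) by (simp only: of_nat_le_iff)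
  also have "\<dots> = 500 * (real n ^ 3 + real m * real n ^ 2)" by (simp add: algebra_simps power2_eq_square power3_eq_cube)
  also have "\<dots> \<le> 500 * (real n ^ 3 * log 2 (real n) + real m * real n ^ 2)"
  proof -
    have "1 \<le> log 2 (real n)" using assms(1) by (subst le_log_iff) auto
    then show ?thesis using mult_left_mono[of 1 "log 2 (real n)" "real n ^ 3"] by simp
  qed
  finally show ?thesis .
qed

text \<open>Since \<open>d \<ge> 3\<close>, \<open>d ^ 2 \<ge> 8\<close> and so
  \<open>log 2 d \<ge> 3 / 2\<close>. Hence \<open>56 * log 2 d\<close> exceeds 64, and
  \<open>real D powr \<mu> \<le> D\<close> gives the rest.\<close>

lemma number_of_sets:
  fixes \<mu> :: real and d t D :: nat
  assumes \<mu>: "0 < \<mu>" "\<mu> < 1" and d: "2 < d" and t: "D < 64 * t"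
  shows "max (real D powr \<mu> / (56 * log 2 (real d))) 1 \<le> real t"
proof -
  have "3 = log 2 (2 ^ 3 :: real)" by (simp only: log_pow_cancel)
  also have "\<dots> \<le> log 2 (real d ^ 2)"
  proof -
    have "(3 :: real) ^ 2 \<le> real d ^ 2" using d by (intro power_mono) auto
    then show ?thesis by (intro log_mono) auto
  qed
  also have "\<dots> = 2 * log 2 (real d)" using d by (simp add: log_nat_power)
  finally have lg: "64 \<le> 56 * log 2 (real d)" by simp
  have "real D powr \<mu> \<le> D"
  proof (cases "D = 0")
    case False
    then show ?thesis using powr_mono[of \<mu> 1 "real D"] \<mu> by simp
  qed simp
  also have "\<dots> \<le> 64 * real t" using t by linarith
  also have "\<dots> \<le> 56 * log 2 (real d) * real t" using lg by (intro mult_right_mono) auto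
  finally have "real D powr \<mu> / (56 * log 2 (real d)) \<le> real t"
    using lg by (simp add: divide_le_eq mult_ac)
  then show ?thesis using t by simp
qed

theorem theorem1:
  fixes \<mu> :: real
  assumes "0 < \<mu>" and "\<mu> < 1"
  shows "\<exists>(prog :: com) (c :: nat) (C :: real). \<forall>\<delta>\<^sub>0 > 0. \<exists>N :: nat.
    \<forall>(V :: 'a set) (E :: 'a set set) (d :: nat) (\<delta> :: real) (p :: 'a) (q :: 'a)
      (n :: nat) (m :: nat) (\<Delta> :: nat).
      simple_graph V E \<and> connected_graph V E \<and> n = card V \<and> m = card E \<and> N \<le> n \<and>
      d > 2 \<and> (\<forall>v\<in>V. node_degree V E v \<le> d) \<and>
      \<delta> \<ge> \<delta>\<^sub>0 \<and> hyperbolic V E \<delta> \<and>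
      p \<in> V \<and> q \<in> V \<and> \<Delta> = gdist V E p q
      \<longrightarrow> (\<forall>\<nu> s. input_state V E p q \<nu> s \<longrightarrow>
        (\<exists>(t :: nat) (S :: nat \<Rightarrow> 'a set).
          real t \<ge> max (real \<Delta> powr \<mu> / (56 * log 2 (real d))) 1 \<and>
          (\<forall>j\<in>{1..t}. {} \<subset> S j \<and> S j \<subset> V \<and> real (card (S j)) \<le> real n / 2) \<and>
          (\<forall>j\<in>{1..<t}. S j \<subset> S (j + 1)) \<and>
          (\<forall>j\<in>{1..t}. \<Delta> > 0 \<longrightarrow>
             node_expansion V E (S j) \<le>
               min (8 * ln (real n / 2) / real \<Delta>)
                 (max ((1 / real \<Delta>) powr (1 - \<mu>))
                    (500 * ln (real n) /
                      (real \<Delta> * 2 powr (real \<Delta> powr \<mu> / (28 * \<delta> * log 2 (2 * real d))))))) \<and>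
          (\<exists>T s'. exec (n ^ c) prog s T s' \<and> output_state V \<nu> s' t S \<and>
             real T \<le> C * (real n ^ 3 * log 2 (real n) + real m * real n ^ 2)) \<and>
          ((\<forall>j\<in>{1..t}. p \<in> S j) \<or> (\<forall>j\<in>{1..t}. q \<in> S j))))"
proof (rule exI[of _ main_prog], rule exI[of _ 3], rule exI[of _ 500], intro allI impI, goal_cases)
  case \<delta>\<^sub>0: (1 \<delta>\<^sub>0)
  obtain n0 where n0: "\<forall>(V :: 'a set) E d \<delta> p q. conn_graph V E \<and> n0 \<le> card V \<and> d > 2 \<and>
      (\<forall>v\<in>V. node_degree V E v \<le> d) \<and> \<delta> \<ge> \<delta>\<^sub>0 \<and> hyperbolic V E \<delta> \<and> p \<in> V \<and> q \<in> V \<and> 0 < gdist V E p q \<longrightarrow>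
      (\<exists>f<card V. \<exists>x\<in>{p, q}. many_cheap V E (gdist V E p q) (cylinder V E p q f)
        (expansion_bound \<mu> d \<delta> (card V) (gdist V E p q)) x)"
    using cheap_family_exists[OF assms \<delta>\<^sub>0] by (elim exE) (rule that)
  show ?case
  proof (rule exI[of _ "max n0 3"], intro allI impI, elim conjE, goal_cases)
    case (1 V E d \<delta> p q n m \<Delta> \<nu> s)
    then interpret encoded_graph V E p q \<nu> s by unfold_locales auto
    \<comment> \<open>For \<open>\<Delta> = 0\<close> no expansion is claimed, but one set is still
      due; the trivial bound 2 provides it.\<close>
    define \<theta> where "\<theta> = (if \<Delta> = 0 then 2 else expansion_bound \<mu> d \<delta> n \<Delta>)"
    have "\<exists>f<card V. \<exists>x\<in>{p, q}. many_cheap V E (gd p q) (cylinder V E p q f) \<theta> x"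
    proof (cases "\<Delta> = 0")
      case True
      have "many_cheap V E (gd p q) (cylinder V E p q 0) 2 p" unfolding many_cheap_def cylinder_0[OF p q]
        using cheap_if_ge_2[OF p, of _ _ 2] size gdist_less_card[OF p q] by (auto intro: less_trans)
      then show ?thesis using True size unfolding \<theta>_def by (intro exI[of _ 0]) auto
    next
      case False
      then show ?thesis using n0[THEN spec, of V, THEN spec, of E, THEN spec, of d, THEN spec, of \<delta>,
          THEN spec, of p, THEN spec, of q] 1 conn_graph_axioms unfolding \<theta>_def by simp
    qed
    then obtain f y where f: "f < card V" "y \<in> {p, q}"
      "many_cheap V E (gd p q) (cylinder V E p q f) \<theta> y" by blast
    obtain T s' where T: "exec (card V ^ 3) main_prog s T s'" "T \<le> 500 * (card V * (card V * card V + card V * card E))"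
      and s': "outcome ip iq s'" "vars s' ''D'' = gd p q"
       "\<forall>f<card V. \<forall>x\<in>{ip, iq}. \<exists>M. lift M = cylinder V E p q f \<and> covers s' M x"
      using runs_main by blast
    obtain t S where t: "gd p q < 64 * t" and out: "output_state V \<nu> s' t S"
      and S: "\<forall>j\<in>{1..t}. {} \<subset> S j \<and> S j \<subset> V \<and> 2 * card (S j) \<le> card V \<and> node_expansion V E (S j) \<le> \<theta>"
       "\<forall>j\<in>{1..<t}. S j \<subset> S (j + 1)" "(\<forall>j\<in>{1..t}. p \<in> S j) \<or> (\<forall>j\<in>{1..t}. q \<in> S j)"
      using main_correct[OF s' f] by blast
    have n: "n = card V" "m = card E" "\<Delta> = gd p q" using 1 by auto
    have "\<forall>j\<in>{1..t}. {} \<subset> S j \<and> S j \<subset> V \<and> real (card (S j)) \<le> real n / 2" using S(1) n(1) by auto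
    moreover have "\<forall>j\<in>{1..t}. 0 < \<Delta> \<longrightarrow> node_expansion V E (S j) \<le> expansion_bound \<mu> d \<delta> n \<Delta>"
      using S(1) unfolding \<theta>_def by auto
    moreover have "max (real \<Delta> powr \<mu> / (56 * log 2 (real d))) 1 \<le> real t"
      using number_of_sets[OF assms] 1 t by simp
    moreover have "\<exists>T s'. exec (n ^ 3) main_prog s T s' \<and> output_state V \<nu> s' t S \<and>
        real T \<le> 500 * (real n ^ 3 * log 2 (real n) + real m * real n ^ 2)"
      using T out real_time_bound[of "card V" T "card E"] size n by auto
    ultimately show ?case using S(2,3) unfolding expansion_bound_def
      by - (rule exI[of _ t], rule exI[of _ S], intro conjI; assumption)
  qed
qed

end
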